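(* Let $Y=(Y_t:t>0)$ be the STIT tessellation process in $\mathbb{R}^\ell$ driven by the measure $\Lambda$. For every $t>0$ the tail $\sigma$-algebra $\mathcal{B}_{-\infty}(\mathbb{T})$ is trivial for $Y_t$; that is, for all $\mathcal{E}\in\mathcal{B}_{-\infty}(\mathbb{T})$ we have $\mathbb{P}(Y_t\in\mathcal{E})=0$ or $\mathbb{P}(Y_t\in\mathcal{E})=1$.
   Context: Setting. Let $\mathcal{H}$ be the set of affine hyperplanes of $\mathbb{R}^\ell$, and for $B\subseteq\mathbb{R}^\ell$ let $[B]=\{H\in\mathcal{H}:H\cap B\neq\emptyset\}$. $\Lambda$ is a non-zero, translation invariant measure on $\mathcal{H}$ with $\Lambda([B])<\infty$ for every bounded $B$, and such that there is no line in $\mathbb{R}^\ell$ to which all hyperplanes in the support of $\Lambda$ are parallel. A window is a compact convex polytope in $\mathbb{R}^\ell$ with non-empty interior. Tessellations. A tessellation $T$ of $\mathbb{R}^\ell$ is a locally finite countable set of compact convex polytopes with non-empty interiors (the cells), with pairwise disjoint interiors and with union $\mathbb{R}^\ell$; $\partial T$ is the union of the boundaries of its cells (a closed set that determines $T$). $\mathbb{T}$ is the set of all tessellations of $\mathbb{R}^\ell$. For a window $W$, $T\wedge W$ is the tessellation of $W$ whose cells are the sets $C\cap W$, $C$ a cell of $T$, having non-empty interior. STIT process. For a window $W$, the process $Y\wedge W=(Y_t\wedge W:t>0)$ is the pure jump Markov process of tessellations of $W$ constructed as follows. At time $0$ the only cell is $W$. Every cell $C$, from the moment of its birth, independently of all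 other cells, has an exponentially distributed lifetime with parameter $\Lambda([C])$; at the end of its lifetime it dies and is divided into two new cells by a random hyperplane with distribution $\Lambda(\cdot\cap[C])/\Lambda([C])$, independent of the lifetime. $Y_t\wedge W$ consists of the cells born at or before time $t$ and dying after time $t$. These processes are consistent in $W$, and the STIT process $Y=(Y_t:t>0)$ is the $\mathbb{T}$-valued Markov process such that for every window $W$ the process $(Y_t\wedge W:t>0)$ has the law just described. $\mathbb{P}$ denotes its law. $\sigma$-algebras. Let $\mathcal{C}$ be the set of compact subsets of $\mathbb{R}^\ell$. $\mathcal{B}(\mathbb{T})$ is the $\sigma$-algebra on $\mathbb{T}$ generated by the sets $\{T\in\mathbb{T}:\partial T\cap C=\emptyset\}$, $C\in\mathcal{C}$. For a window $W$ with complement $W^c$, $\mathcal{B}(\mathbb{T}_{W^c})$ is the $\sigma$-algebra on $\mathbb{T}$ generated by the sets $\{T\in\mathbb{T}:\partial T\cap C=\emptyset\}$ with $C\in\mathcal{C}$, $C\subset W^c$. The tail $\sigma$-algebra is $\mathcal{B}_{-\infty}(\mathbb{T})=\bigcap_{n=1}^\infty\mathcal{B}(\mathbb{T}_{W_n^c})$, where $(W_n)$ is any increasing sequence of windows with $W_n\subset\operatorname{int}W_{n+1}$ for all $n$ and $\bigcup_nW_n=\mathbb{R}^\ell$ (it does not depend on the choice of the sequence; e.g. $W_n=[-n,n]^\ell$). *)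

theory Defs
  imports "HOL-Probability.Probability" "HOL-Library.Sublist"
begin

section \<open>Hyperplanes and the driving measure\<close>

definition hyperplanes :: "'a::euclidean_space set set" where
  "hyperplanes = {H. affine H \<and> aff_dim H = int DIM('a) - 1}"

definition hits :: "'a::euclidean_space set \<Rightarrow> 'a set set" where
  "hits B = {H \<in> hyperplanes. H \<inter> B \<noteq> {}}"

text \<open>The Fell (hit-or-miss) topology restricted to the hyperplanes. It agrees with the topology
  obtained from parametrising a hyperplane by a unit normal and an offset.\<close>

definition hyperplane_topology :: "'a::euclidean_space set topology" where
  "hyperplane_topology = topology_generated_by
     ({hyperplanes - hits K | K. compact K} \<union> {hits G | G. open G})"

definition hyperplane_borel :: "'a::euclidean_space set measure" where
  "hyperplane_borel = sigma hyperplanes {U. openin hyperplane_topology U}"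

definition hyperplane_support :: "'a::euclidean_space set measure \<Rightarrow> 'a set set" where
  "hyperplane_support \<Lambda> =
     {H \<in> hyperplanes. \<forall>U. openin hyperplane_topology U \<longrightarrow> H \<in> U \<longrightarrow> emeasure \<Lambda> U \<noteq> 0}"

definition is_line :: "'a::euclidean_space set \<Rightarrow> bool" where
  "is_line l \<longleftrightarrow> affine l \<and> aff_dim l = 1"

definition parallel_to_line :: "'a::euclidean_space set \<Rightarrow> 'a set \<Rightarrow> bool" where
  "parallel_to_line H l \<longleftrightarrow> (\<exists>v. (+) v ` l \<subseteq> H)"

text \<open>\<^term>\<open>hits B\<close> is measurable for compact \<^term>\<open>B\<close>, and every bounded set lies in a
  compact one, so the finiteness condition has the same content whether or not \<^term>\<open>hits B\<close>
  is measurable for each bounded \<^term>\<open>B\<close>.\<close>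

definition driving_measure :: "'a::euclidean_space set measure \<Rightarrow> bool" where
  "driving_measure \<Lambda> \<longleftrightarrow>
     sets \<Lambda> = sets hyperplane_borel \<and>
     emeasure \<Lambda> (space \<Lambda>) \<noteq> 0 \<and>
     (\<forall>v. \<forall>A \<in> sets \<Lambda>. emeasure \<Lambda> ((\<lambda>H. (+) v ` H) ` A) = emeasure \<Lambda> A) \<and>
     (\<forall>B. bounded B \<longrightarrow> emeasure \<Lambda> (hits B) < \<infinity>) \<and>
     (\<nexists>l. is_line l \<and> (\<forall>H \<in> hyperplane_support \<Lambda>. parallel_to_line H l))"


section \<open>Tessellations\<close>

definition window :: "'a::euclidean_space set \<Rightarrow> bool" where
  "window W \<longleftrightarrow> polytope W \<and> interior W \<noteq> {}"

definition tessellations :: "'a::euclidean_space set set set" where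
  "tessellations = {T.
     countable T \<and>
     (\<forall>B. bounded B \<longrightarrow> finite {C \<in> T. C \<inter> B \<noteq> {}}) \<and>
     (\<forall>C \<in> T. polytope C \<and> interior C \<noteq> {}) \<and>
     (\<forall>C \<in> T. \<forall>D \<in> T. C \<noteq> D \<longrightarrow> interior C \<inter> interior D = {}) \<and>
     \<Union>T = UNIV}"

definition boundary :: "'a::euclidean_space set set \<Rightarrow> 'a set" where
  "boundary T = (\<Union>C \<in> T. frontier C)"

definition restrict_tess :: "'a::euclidean_space set \<Rightarrow> 'a set set \<Rightarrow> 'a set set" where
  "restrict_tess W T = {C \<inter> W | C. C \<in> T \<and> interior (C \<inter> W) \<noteq> {}}"

text \<open>The \<open>\<sigma>\<close>-algebra on a class \<open>\<X>\<close> of families of cells that is generated by the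
  events that the boundary misses a compact subset of \<open>D\<close>.\<close>

definition boundary_algebra ::
  "'a::euclidean_space set set set \<Rightarrow> 'a set \<Rightarrow> 'a set set measure" where
  "boundary_algebra \<X> D =
     sigma \<X> {{T \<in> \<X>. boundary T \<inter> C = {}} | C. compact C \<and> C \<subseteq> D}"

abbreviation tess_borel :: "'a::euclidean_space set set measure" where
  "tess_borel \<equiv> boundary_algebra tessellations UNIV"

abbreviation tess_borel_outside :: "'a::euclidean_space set \<Rightarrow> 'a set set measure" where
  "tess_borel_outside W \<equiv> boundary_algebra tessellations (- W)"

definition exhausting_windows :: "(nat \<Rightarrow> 'a::euclidean_space set) \<Rightarrow> bool" where
  "exhausting_windows W \<longleftrightarrow>
     (\<forall>n. window (W n)) \<and> (\<forall>n. W n \<subseteq> interior (W (Suc n))) \<and> (\<Union>n. W n) = UNIV"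

definition tail_algebra :: "(nat \<Rightarrow> 'a::euclidean_space set) \<Rightarrow> 'a set set set set" where
  "tail_algebra W = (\<Inter>n. sets (tess_borel_outside (W n)))"


section \<open>Random elements\<close>

definition generated_algebra ::
  "'w measure \<Rightarrow> 'b measure \<Rightarrow> ('i \<Rightarrow> 'w \<Rightarrow> 'b) \<Rightarrow> 'i set \<Rightarrow> 'w measure" where
  "generated_algebra M S X I =
     vimage_algebra (space M) (\<lambda>\<omega>. \<lambda>i\<in>I. X i \<omega>) (\<Pi>\<^sub>M i\<in>I. S)"

definition markov_process :: "'w measure \<Rightarrow> 'b measure \<Rightarrow> (real \<Rightarrow> 'w \<Rightarrow> 'b) \<Rightarrow> bool" where
  "markov_process M S Y \<longleftrightarrow>
     (\<forall>t>0. Y t \<in> M \<rightarrow>\<^sub>M S) \<and>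
     (\<forall>s t. 0 < s \<longrightarrow> s < t \<longrightarrow> (\<forall>A \<in> sets S.
        AE \<omega> in M.
          real_cond_exp M (generated_algebra M S Y {0<..s}) (\<lambda>\<omega>. indicator A (Y t \<omega>)) \<omega> =
          real_cond_exp M (generated_algebra M S Y {s}) (\<lambda>\<omega>. indicator A (Y t \<omega>)) \<omega>))"


section \<open>The cell division process in a window\<close>

text \<open>Cells are indexed by nodes of the binary tree: the initial cell is \<open>[]\<close>, the two
  daughters of the cell \<open>v\<close> are \<open>True # v\<close> and \<open>False # v\<close>, and so \<open>u\<close> is \<open>v\<close> itself or a
  descendant of \<open>v\<close> iff \<^term>\<open>suffix v u\<close>. An orientation, i.e. a measurable choice \<open>\<nu>\<close> of a
  normal vector, serves only to decide which of the two daughters gets which name; the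
  process of unlabelled cells does not depend on it in law.\<close>

definition orientation :: "('a::euclidean_space set \<Rightarrow> 'a) \<Rightarrow> bool" where
  "orientation \<nu> \<longleftrightarrow>
     \<nu> \<in> hyperplane_borel \<rightarrow>\<^sub>M borel \<and>
     (\<forall>H \<in> hyperplanes. \<nu> H \<noteq> 0 \<and> (\<exists>b. H = {x. \<nu> H \<bullet> x = b}))"

definition half_space ::
  "('a::euclidean_space set \<Rightarrow> 'a) \<Rightarrow> bool \<Rightarrow> 'a set \<Rightarrow> 'a set" where
  "half_space \<nu> b H =
     (if b then {x. \<forall>h \<in> H. \<nu> H \<bullet> x \<ge> \<nu> H \<bullet> h} else {x. \<forall>h \<in> H. \<nu> H \<bullet> x \<le> \<nu> H \<bullet> h})"

primrec cell :: "('a::euclidean_space set \<Rightarrow> 'a) \<Rightarrow> 'a set \<Rightarrow>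
    (bool list \<Rightarrow> 'w \<Rightarrow> 'a set) \<Rightarrow> bool list \<Rightarrow> 'w \<Rightarrow> 'a set" where
  "cell \<nu> W H [] \<omega> = W"
| "cell \<nu> W H (b # v) \<omega> = cell \<nu> W H v \<omega> \<inter> half_space \<nu> b (H v \<omega>)"

primrec birth_time :: "(bool list \<Rightarrow> 'w \<Rightarrow> real) \<Rightarrow> bool list \<Rightarrow> 'w \<Rightarrow> real" where
  "birth_time L [] \<omega> = 0"
| "birth_time L (b # v) \<omega> = birth_time L v \<omega> + L v \<omega>"

definition death_time :: "(bool list \<Rightarrow> 'w \<Rightarrow> real) \<Rightarrow> bool list \<Rightarrow> 'w \<Rightarrow> real" where
  "death_time L v \<omega> = birth_time L v \<omega> + L v \<omega>"

definition cells_alive :: "('a::euclidean_space set \<Rightarrow> 'a) \<Rightarrow> 'a set \<Rightarrow>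
    (bool list \<Rightarrow> 'w \<Rightarrow> real) \<Rightarrow> (bool list \<Rightarrow> 'w \<Rightarrow> 'a set) \<Rightarrow> real \<Rightarrow> 'w \<Rightarrow> 'a set set" where
  "cells_alive \<nu> W L H t \<omega> =
     {cell \<nu> W H v \<omega> | v. birth_time L v \<omega> \<le> t \<and> t < death_time L v \<omega>}"

text \<open>The joint law of lifetime and dividing hyperplane of a given cell \<open>C\<close>: independent,
  exponential with parameter \<open>\<Lambda>[C]\<close> and \<open>\<Lambda>\<close> conditioned on \<open>[C]\<close>, respectively.\<close>

definition division_law ::
  "'a::euclidean_space set measure \<Rightarrow> 'a set \<Rightarrow> (real \<times> 'a set) measure" where
  "division_law \<Lambda> C =
     density lborel (exponential_density (measure \<Lambda> (hits C))) \<Otimes>\<^sub>M uniform_measure \<Lambda> (hits C)"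

text \<open>Since the cell of a node is itself random, independence of the other cells is
  expressed conditionally: given the lifetimes and hyperplanes of all nodes that are neither
  \<open>v\<close> nor a descendant of \<open>v\<close> (these determine the cell of \<open>v\<close> and its birth time), the pair
  at \<open>v\<close> has the division law of the cell of \<open>v\<close>.\<close>

definition cell_division :: "'a::euclidean_space set measure \<Rightarrow> 'a set \<Rightarrow> 'w measure \<Rightarrow>
    ('a set \<Rightarrow> 'a) \<Rightarrow> (bool list \<Rightarrow> 'w \<Rightarrow> real) \<Rightarrow> (bool list \<Rightarrow> 'w \<Rightarrow> 'a set) \<Rightarrow> bool" where
  "cell_division \<Lambda> W N \<nu> L H \<longleftrightarrow>
     prob_space N \<and> orientation \<nu> \<and>
     (\<forall>v. L v \<in> N \<rightarrow>\<^sub>M borel \<and> H v \<in> N \<rightarrow>\<^sub>M \<Lambda>) \<and>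
     (\<forall>v. \<forall>D \<in> sets (borel \<Otimes>\<^sub>M \<Lambda>).
        AE \<omega> in N.
          real_cond_exp N
            (generated_algebra N (borel \<Otimes>\<^sub>M \<Lambda>) (\<lambda>u \<omega>. (L u \<omega>, H u \<omega>)) {u. \<not> suffix v u})
            (\<lambda>\<omega>. indicator D (L v \<omega>, H v \<omega>)) \<omega> =
          measure (division_law \<Lambda> (cell \<nu> W H v \<omega>)) D)"


section \<open>The STIT process\<close>

text \<open>Equality in law is equality of the distributions on path space. Paths in a window are
  regarded as taking values in arbitrary families of sets, because only almost surely is
  \<^const>\<open>cells_alive\<close> a tessellation of the window at all times. The random variables of the
  construction may be taken on the canonical space of families of pairs (lifetime, hyperplane),
  which bounds the type of the existentially quantified probability space.\<close>

definition path_law ::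
  "'w measure \<Rightarrow> (real \<Rightarrow> 'w \<Rightarrow> 'a::euclidean_space set set) \<Rightarrow> (real \<Rightarrow> 'a set set) measure" where
  "path_law M Z =
     distr M (\<Pi>\<^sub>M t\<in>{0<..}. boundary_algebra UNIV UNIV) (\<lambda>\<omega>. \<lambda>t\<in>{0<..}. Z t \<omega>)"

definition stit_process :: "'a::euclidean_space set measure \<Rightarrow> 'w measure \<Rightarrow>
    (real \<Rightarrow> 'w \<Rightarrow> 'a set set) \<Rightarrow> bool" where
  "stit_process \<Lambda> M Y \<longleftrightarrow>
     prob_space M \<and>
     markov_process M tess_borel Y \<and>
     (\<forall>W. window W \<longrightarrow>
        (\<exists>(N :: (bool list \<Rightarrow> real \<times> 'a set) measure) \<nu> L H.
           cell_division \<Lambda> W N \<nu> L H \<and>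
           path_law M (\<lambda>t \<omega>. restrict_tess W (Y t \<omega>)) = path_law N (cells_alive \<nu> W L H)))"

end

theory Submission
  imports Defs
begin

text \<open>Fix a small time \<open>s < t\<close> and windows \<open>R \<subseteq> V\<close>. If at time \<open>s\<close> a single cell contains \<open>R\<close> and is
  contained in \<open>V\<close>, then from time \<open>s\<close> on the division inside \<open>R\<close> is independent of everything outside
  \<open>V\<close>, and by consistency its law does not depend on that cell. This event is expressed by the boundary
  of \<open>Y\<^sub>s\<close> alone. Its probability is close to \<open>1\<close>: \<open>R\<close> is not yet divided if \<open>s\<close> is small, and the cell
  containing \<open>R\<close> is bounded, so it lies in \<open>V\<close> if \<open>V\<close> is large. Hence a tail event is independent of
  the events that the boundary of \<open>Y\<^sub>t\<close> misses a given compact set. These generate the whole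
  \<open>\<sigma>\<close>-algebra, and so a tail event is independent of itself.\<close>

section \<open>Closed sets with the Fell sigma-algebra\<close>

text \<open>Two obstacles shape the proof. The law of the process is given window by window, on
  unrelated probability spaces with unrelated orientations; and the enclosing cell is random. Both
  are met by the recursion \<open>miss_prob\<close>, which sees only a cell, a remaining time and
  \<open>K\<close>, and whose limit is computed twice. Started at a node alive at time
  \<open>s\<close>, it is the conditional probability that the later divisions of this cell miss
  \<open>K\<close>, because exponential lifetimes are memoryless. Started at the root of a
  realisation in a window \<open>C\<close>, it is the probability that the boundary of
  \<open>Y\<close> misses \<open>K\<close>, a number in which \<open>C\<close> does not occur. Hence
  one constant \<open>q\<close> serves all enclosing cells and leaves the sum over the possible
  nodes. Realisations are compared only through path laws on the algebra of boundary-miss events, so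
  enclosure has to be a countable combination of such events; this is why it is tested on segments
  to a countable dense set. A tail event need not be visible in any bounded window, so the
  factorization is proved for generators outside \<open>V\<close>, each visible in a large window,
  and then extended.\<close>

lemma pred_Ball_countable:
  assumes "countable I" "\<And>i. i \<in> I \<Longrightarrow> Measurable.pred M (P i)"
  shows "Measurable.pred M (\<lambda>x. \<forall>i\<in>I. P i x)"
  using assms sets.sets_Collect_countable_All'[of I M P] by (simp add: pred_def)

lemma pred_Bex_countable:
  assumes "countable I" "\<And>i. i \<in> I \<Longrightarrow> Measurable.pred M (P i)"
  shows "Measurable.pred M (\<lambda>x. \<exists>i\<in>I. P i x)"
  using assms sets.sets_Collect_countable_Ex'[of I M P] by (simp add: pred_def)

text \<open>A common target for random cells, hyperplanes and half-spaces, so that all of them can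
  be intersected measurably. Missing compact sets suffices as a generator: open and closed sets are
  countable unions of compact ones.\<close>

definition fell :: "'a::euclidean_space set measure" where
  "fell = sigma {C. closed C} {{C. closed C \<and> C \<inter> K = {}} | K. compact K}"

lemma space_fell [simp]: "space fell = {C. closed C}"
  unfolding fell_def by (subst space_measure_of) auto

lemma fell_miss_compact:
  "compact K \<Longrightarrow> {C. closed C \<and> C \<inter> K = {}} \<in> sets fell"
  unfolding fell_def by (subst sets_measure_of) auto

lemma measurable_fellI:
  assumes "\<And>x. x \<in> space M \<Longrightarrow> closed (f x)"
    and "\<And>K. compact K \<Longrightarrow> {x \<in> space M. f x \<inter> K = {}} \<in> sets M"
  shows "f \<in> M \<rightarrow>\<^sub>M fell"
  unfolding fell_def
proof (rule measurable_measure_of)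
  fix A assume "A \<in> {{C. closed C \<and> C \<inter> K = {}} | K. compact (K::'b set)}"
  then obtain K where K: "compact K" "A = {C. closed C \<and> C \<inter> K = {}}" by auto
  have "f -` A \<inter> space M = {x \<in> space M. f x \<inter> K = {}}" using assms(1) K by auto
  then show "f -` A \<inter> space M \<in> sets M" using assms(2)[OF K(1)] by simp
qed (use assms(1) in auto)

lemma fell_miss_countable_compacts:
  fixes f :: "'b \<Rightarrow> 'a::euclidean_space set"
  assumes f: "f \<in> M \<rightarrow>\<^sub>M fell" and K: "\<And>n::nat. compact (K n)" "A = (\<Union>n. K n)"
  shows "{x \<in> space M. f x \<inter> A = {}} \<in> sets M"
proof -
  have cl: "closed (f x)" if "x \<in> space M" for x using measurable_space[OF f that] by simp
  have "{x \<in> space M. f x \<inter> K n = {}} \<in> sets M" for n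
  proof -
    have "f -` {C. closed C \<and> C \<inter> K n = {}} \<inter> space M \<in> sets M"
      using f fell_miss_compact[OF K(1)] by (rule measurable_sets)
    also have "f -` {C. closed C \<and> C \<inter> K n = {}} \<inter> space M = {x \<in> space M. f x \<inter> K n = {}}"
      using cl by auto
    finally show ?thesis .
  qed
  moreover have "{x \<in> space M. f x \<inter> A = {}} = {x \<in> space M. \<forall>n. f x \<inter> K n = {}}"
    using K(2) by auto
  ultimately show ?thesis by (auto intro: sets.sets_Collect_countable_All)
qed

lemma closed_countable_compacts:
  fixes A :: "'a::euclidean_space set"
  assumes "closed A"
  obtains K :: "nat \<Rightarrow> 'a set" where "\<And>n. compact (K n)" "A = (\<Union>n. K n)"
proof
  show "compact (A \<inter> cball 0 (real n))" for n
    using assms by (simp add: closed_Int_compact)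
  show "A = (\<Union>n. A \<inter> cball 0 (real n))"
  proof -
    have "\<exists>n. norm x \<le> real n" for x :: 'a using real_arch_simple by blast
    then show ?thesis by auto
  qed
qed

lemma open_countable_compacts:
  fixes A :: "'a::euclidean_space set"
  assumes "open A"
  obtains K :: "nat \<Rightarrow> 'a set" where "\<And>n. compact (K n)" "A = (\<Union>n. K n)"
proof -
  obtain C :: "nat \<Rightarrow> 'a set" where "\<And>n. compact (C n)" "\<Union>(range C) = A"
    using open_Union_compact_subsets[OF assms] by (metis (no_types, lifting))
  then show thesis using that[of C] by simp
qed

lemma pred_fell_miss_compact:
  fixes f :: "'b \<Rightarrow> 'a::euclidean_space set"
  assumes "f \<in> M \<rightarrow>\<^sub>M fell" "compact K"
  shows "Measurable.pred M (\<lambda>x. f x \<inter> K = {})"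
  using fell_miss_countable_compacts[OF assms(1), of "\<lambda>_. K" K] assms(2) by (simp add: pred_def)

lemma pred_fell_miss_closed:
  fixes f :: "'b \<Rightarrow> 'a::euclidean_space set"
  assumes "f \<in> M \<rightarrow>\<^sub>M fell" "closed A"
  shows "Measurable.pred M (\<lambda>x. f x \<inter> A = {})"
proof -
  obtain K :: "nat \<Rightarrow> 'a set" where "\<And>n. compact (K n)" "A = (\<Union>n. K n)"
    using closed_countable_compacts[OF assms(2)] by blast
  then show ?thesis using fell_miss_countable_compacts[OF assms(1)] by (simp add: pred_def)
qed

lemma pred_fell_miss_open:
  fixes f :: "'b \<Rightarrow> 'a::euclidean_space set"
  assumes "f \<in> M \<rightarrow>\<^sub>M fell" "open A"
  shows "Measurable.pred M (\<lambda>x. f x \<inter> A = {})"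
proof -
  obtain K :: "nat \<Rightarrow> 'a set" where "\<And>n. compact (K n)" "A = (\<Union>n. K n)"
    using open_countable_compacts[OF assms(2)] by blast
  then show ?thesis using fell_miss_countable_compacts[OF assms(1)] by (simp add: pred_def)
qed

text \<open>Two closed sets have no common point in a compact set iff, inside this compact set, they can
  be separated by finite unions of members of a countable base.\<close>

lemma measurable_fell_Int:
  fixes f g :: "'b \<Rightarrow> 'a::euclidean_space set"
  assumes f: "f \<in> M \<rightarrow>\<^sub>M fell" and g: "g \<in> M \<rightarrow>\<^sub>M fell"
  shows "(\<lambda>x. f x \<inter> g x) \<in> M \<rightarrow>\<^sub>M fell"
proof (rule measurable_fellI)
  have clf: "closed (f x)" if "x \<in> space M" for x using measurable_space[OF f that] by simp
  have clg: "closed (g x)" if "x \<in> space M" for x using measurable_space[OF g that] by simp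
  show "closed (f x \<inter> g x)" if "x \<in> space M" for x using clf clg that by auto
  fix K :: "'a set" assume K: "compact K"
  obtain \<B> :: "'a set set" where B: "countable \<B>" "\<And>C. C \<in> \<B> \<Longrightarrow> open C"
    "\<And>S. open S \<Longrightarrow> \<exists>U. U \<subseteq> \<B> \<and> S = \<Union>U"
    using Elementary_Topology.univ_second_countable by metis
  define \<F> where "\<F> = {F. finite F \<and> F \<subseteq> \<B>}"
  have cF: "countable \<F>" unfolding \<F>_def using B(1) by (rule countable_Collect_finite_subset)
  have oF: "open (\<Union>F)" if "F \<in> \<F>" for F using that B(2) by (auto simp: \<F>_def)
  have sep: "f x \<inter> g x \<inter> K = {} \<longleftrightarrow>
     (\<exists>F\<in>\<F>. \<exists>G\<in>\<F>. \<Union>F \<inter> \<Union>G = {} \<and> f x \<inter> (K - \<Union>F) = {} \<and> g x \<inter> (K - \<Union>G) = {})"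
    if x: "x \<in> space M" for x
  proof
    assume d: "f x \<inter> g x \<inter> K = {}"
    have cf: "compact (f x \<inter> K)" "compact (g x \<inter> K)" using clf[OF x] clg[OF x] K
      by (auto simp: closed_Int_compact)
    have "(f x \<inter> K) \<inter> (g x \<inter> K) = {}" using d by auto
    then obtain U V where UV: "open U" "open V" "f x \<inter> K \<subseteq> U" "g x \<inter> K \<subseteq> V" "U \<inter> V = {}"
      using separation_normal_compact[OF cf(1) compact_imp_closed[OF cf(2)]] by metis
    have cover: "\<exists>F\<in>\<F>. S \<subseteq> \<Union>F \<and> \<Union>F \<subseteq> U" if S: "compact S" "S \<subseteq> U" "open U" for S U
    proof -
      obtain \<U> where U: "\<U> \<subseteq> \<B>" "U = \<Union>\<U>" using B(3)[OF S(3)] by auto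
      have "S \<subseteq> \<Union>\<U>" "\<And>C. C \<in> \<U> \<Longrightarrow> open C" using S(2) U B(2) by auto
      then obtain F where F: "F \<subseteq> \<U>" "finite F" "S \<subseteq> \<Union>F"
        using compactE[OF S(1)] by metis
      have "F \<in> \<F>" using F U(1) by (auto simp: \<F>_def)
      moreover have "\<Union>F \<subseteq> U" using F(1) U(2) by auto
      ultimately show ?thesis using F(3) by (auto intro: bexI[of _ F])
    qed
    obtain F where "F \<in> \<F>" "f x \<inter> K \<subseteq> \<Union>F" "\<Union>F \<subseteq> U" using cover[OF cf(1) UV(3,1)] by auto
    moreover obtain G where "G \<in> \<F>" "g x \<inter> K \<subseteq> \<Union>G" "\<Union>G \<subseteq> V" using cover[OF cf(2) UV(4,2)] by auto
    moreover have "\<Union>F \<inter> \<Union>G = {}" "f x \<inter> (K - \<Union>F) = {}" "g x \<inter> (K - \<Union>G) = {}"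
      if "f x \<inter> K \<subseteq> \<Union>F" "\<Union>F \<subseteq> U" "g x \<inter> K \<subseteq> \<Union>G" "\<Union>G \<subseteq> V" for F G
    proof -
      have "\<Union>F \<inter> \<Union>G \<subseteq> U \<inter> V" using that(2,4) by (rule Int_mono)
      then show "\<Union>F \<inter> \<Union>G = {}" using UV(5) by simp
      have "A \<inter> (K - P) = {}" if "A \<inter> K \<subseteq> P" for A P :: "'a set" using that by blast
      then show "f x \<inter> (K - \<Union>F) = {}" "g x \<inter> (K - \<Union>G) = {}" using that(1,3) by simp_all
    qed
    ultimately show "\<exists>F\<in>\<F>. \<exists>G\<in>\<F>. \<Union>F \<inter> \<Union>G = {} \<and> f x \<inter> (K - \<Union>F) = {} \<and> g x \<inter> (K - \<Union>G) = {}"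
      by meson
  next
    assume "\<exists>F\<in>\<F>. \<exists>G\<in>\<F>. \<Union>F \<inter> \<Union>G = {} \<and> f x \<inter> (K - \<Union>F) = {} \<and> g x \<inter> (K - \<Union>G) = {}"
    then obtain F G where "\<Union>F \<inter> \<Union>G = {}" "f x \<inter> (K - \<Union>F) = {}" "g x \<inter> (K - \<Union>G) = {}" by auto
    moreover have "A \<inter> B \<inter> K = {}" if "P \<inter> Q = {}" "A \<inter> (K - P) = {}" "B \<inter> (K - Q) = {}"
      for A B P Q :: "'a set" using that by blast
    ultimately show "f x \<inter> g x \<inter> K = {}" by metis
  qed
  have "{x \<in> space M. f x \<inter> g x \<inter> K = {}} =
     {x \<in> space M. \<exists>F\<in>\<F>. \<exists>G\<in>\<F>. \<Union>F \<inter> \<Union>G = {} \<and> f x \<inter> (K - \<Union>F) = {} \<and> g x \<inter> (K - \<Union>G) = {}}"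
    using sep by (intro Collect_cong conj_cong refl)
  moreover have "Measurable.pred M
     (\<lambda>x. \<exists>F\<in>\<F>. \<exists>G\<in>\<F>. \<Union>F \<inter> \<Union>G = {} \<and> f x \<inter> (K - \<Union>F) = {} \<and> g x \<inter> (K - \<Union>G) = {})"
    by (intro pred_Bex_countable pred_intros_conj1' pred_intros_logic(3) pred_fell_miss_compact f g cF
          compact_diff K oF)
  ultimately show "{x \<in> space M. f x \<inter> g x \<inter> K = {}} \<in> sets M"
    by (simp add: pred_def)
qed

lemma measurable_fell_singleton:
  "(\<lambda>x. {x}) \<in> borel \<rightarrow>\<^sub>M (fell :: 'a::euclidean_space set measure)"
proof (rule measurable_fellI)
  fix K :: "'a set" assume "compact K"
  then have "- K \<in> sets borel" by (simp add: compact_imp_closed)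
  moreover have "{x \<in> space borel. {x} \<inter> K = {}} = - K" by auto
  ultimately show "{x \<in> space borel. {x} \<inter> K = {}} \<in> sets borel" by simp
qed auto

text \<open>A random point lies in a random closed set iff its singleton meets the set, so the
  measurability of intersections applies.\<close>

lemma pred_fell_member:
  fixes f :: "'b \<Rightarrow> 'a::euclidean_space set"
  assumes f: "f \<in> M \<rightarrow>\<^sub>M fell" and g: "g \<in> M \<rightarrow>\<^sub>M borel"
  shows "Measurable.pred M (\<lambda>x. g x \<in> f x)"
proof -
  have "(\<lambda>x. {g x} \<inter> f x) \<in> M \<rightarrow>\<^sub>M fell"
    using measurable_fell_Int[OF measurable_compose[OF g measurable_fell_singleton] f] .
  from pred_fell_miss_closed[OF this, of UNIV]
  have "Measurable.pred M (\<lambda>x. \<not> ({g x} \<inter> f x \<inter> UNIV = {}))" by (intro pred_intros_logic) simp_all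
  then show ?thesis by simp
qed


section \<open>Hyperplanes and half-spaces\<close>

lemma space_hyperplane_borel [simp]: "space hyperplane_borel = hyperplanes"
proof -
  have "topspace hyperplane_topology \<subseteq> (hyperplanes :: 'a set set)"
    unfolding hyperplane_topology_def by (auto simp: hits_def)
  then have "{U. openin hyperplane_topology U} \<subseteq> Pow (hyperplanes :: 'a set set)"
    using openin_subset by blast
  then show ?thesis unfolding hyperplane_borel_def by (rule space_measure_of)
qed

lemma hyperplane_closed: "H \<in> hyperplanes \<Longrightarrow> closed H"
  by (simp add: hyperplanes_def affine_closed)

lemma measurable_hyperplane_fell: "(\<lambda>H. H) \<in> hyperplane_borel \<rightarrow>\<^sub>M (fell :: 'a::euclidean_space set measure)"
proof (rule measurable_fellI)
  fix K :: "'a set" assume K: "compact K"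
  have "openin hyperplane_topology (hyperplanes - hits K)"
    unfolding hyperplane_topology_def using K
    by (intro topology_generated_by_Basis) auto
  moreover have "topspace hyperplane_topology \<subseteq> (hyperplanes :: 'a set set)"
    unfolding hyperplane_topology_def by (auto simp: hits_def)
  then have "{U. openin hyperplane_topology U} \<subseteq> Pow (hyperplanes :: 'a set set)"
    using openin_subset by blast
  ultimately have "hyperplanes - hits K \<in> sets hyperplane_borel"
    unfolding hyperplane_borel_def by auto
  moreover have "{H \<in> space hyperplane_borel. H \<inter> K = {}} = hyperplanes - hits K"
    by (auto simp: hits_def)
  ultimately show "{H \<in> space hyperplane_borel. H \<inter> K = {}} \<in> sets hyperplane_borel" by simp
qed (simp add: hyperplane_closed)

text \<open>The quantifier over \<open>K\<close> is uncountable, and a strict inequality on a dense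
  subset does not pass to the closure. Compactness helps: the maximum is attained, so the inequality
  holds with a gap \<open>1 / real (Suc n)\<close>, and the version with a gap can be tested on a
  countable dense set.\<close>

lemma pred_inner_less_on_compact:
  fixes a :: "'b \<Rightarrow> 'a::euclidean_space" and c :: "'b \<Rightarrow> real"
  assumes [measurable]: "a \<in> borel_measurable M" "c \<in> borel_measurable M" and K: "compact K"
  shows "Measurable.pred M (\<lambda>x. \<forall>y\<in>K. a x \<bullet> y < c x)"
proof -
  obtain D where D: "countable D" "D \<subseteq> K" "K \<subseteq> closure D" using separable by blast
  have eq: "(\<forall>y\<in>K. a x \<bullet> y < c x) \<longleftrightarrow> (\<exists>n::nat. \<forall>y\<in>D. a x \<bullet> y \<le> c x - 1 / real (Suc n))" for x
  proof
    assume l: "\<forall>y\<in>K. a x \<bullet> y < c x"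
    show "\<exists>n::nat. \<forall>y\<in>D. a x \<bullet> y \<le> c x - 1 / real (Suc n)"
    proof (cases "K = {}")
      case True then show ?thesis using D by auto
    next
      case False
      obtain z where z: "z \<in> K" "\<forall>y\<in>K. a x \<bullet> y \<le> a x \<bullet> z"
        using continuous_attains_sup[OF K False, of "\<lambda>y. a x \<bullet> y"] continuous_on_inner[OF continuous_on_const continuous_on_id]
        by blast
      have "0 < c x - a x \<bullet> z" using l z by simp
      then obtain n where "1 / real (Suc n) < c x - a x \<bullet> z" using nat_approx_posE by blast
      then have "\<forall>y\<in>D. a x \<bullet> y \<le> c x - 1 / real (Suc n)" using z D(2) by force
      then show ?thesis by blast
    qed
  next
    assume "\<exists>n::nat. \<forall>y\<in>D. a x \<bullet> y \<le> c x - 1 / real (Suc n)"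
    then obtain n :: nat where n: "\<forall>y\<in>D. a x \<bullet> y \<le> c x - 1 / real (Suc n)" by blast
    have "closed {y. a x \<bullet> y \<le> c x - 1 / real (Suc n)}" by (rule closed_halfspace_le)
    then have "closure D \<subseteq> {y. a x \<bullet> y \<le> c x - 1 / real (Suc n)}"
      using n by (intro closure_minimal) auto
    moreover have "0 < 1 / real (Suc n)" by simp
    ultimately show "\<forall>y\<in>K. a x \<bullet> y < c x" using D(3) by (smt (verit, best) mem_Collect_eq subsetD)
  qed
  have "Measurable.pred M (\<lambda>x. \<exists>n::nat. \<forall>y\<in>D. a x \<bullet> y \<le> c x - 1 / real (Suc n))"
    by (intro pred_intros_countable pred_Ball_countable D(1)) measurable
  then show ?thesis by (simp add: eq)
qed

lemma hyperplane_offset: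
  assumes "orientation \<nu>" "H \<in> hyperplanes"
  obtains c where "\<nu> H \<noteq> 0" "H = {x. \<nu> H \<bullet> x = c}"
    "half_space \<nu> True H = {x. \<nu> H \<bullet> x \<ge> c}" "half_space \<nu> False H = {x. \<nu> H \<bullet> x \<le> c}"
proof -
  obtain c where c: "\<nu> H \<noteq> 0" "H = {x. \<nu> H \<bullet> x = c}"
    using assms unfolding orientation_def by blast
  have "\<nu> H \<bullet> (c / (\<nu> H \<bullet> \<nu> H)) *\<^sub>R \<nu> H = c" using c(1) by simp
  then have ex: "(c / (\<nu> H \<bullet> \<nu> H)) *\<^sub>R \<nu> H \<in> H" using c(2) by blast
  have eq: "\<nu> H \<bullet> h = c" if "h \<in> H" for h using that c(2) by blast
  have "(\<forall>h\<in>H. \<nu> H \<bullet> x \<ge> \<nu> H \<bullet> h) \<longleftrightarrow> \<nu> H \<bullet> x \<ge> c" "(\<forall>h\<in>H. \<nu> H \<bullet> x \<le> \<nu> H \<bullet> h) \<longleftrightarrow> \<nu> H \<bullet> x \<le> c" for x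
    using eq ex by auto
  then show thesis using c by (intro that[of c]) (simp_all add: half_space_def)
qed

lemma half_space_closed: "orientation \<nu> \<Longrightarrow> H \<in> hyperplanes \<Longrightarrow> closed (half_space \<nu> b H)"
proof -
  assume "orientation \<nu>" "H \<in> hyperplanes"
  then obtain c where "half_space \<nu> True H = {x. \<nu> H \<bullet> x \<ge> c}" "half_space \<nu> False H = {x. \<nu> H \<bullet> x \<le> c}"
    by (rule hyperplane_offset)
  then show "closed (half_space \<nu> b H)" by (cases b) (simp_all add: closed_halfspace_ge closed_halfspace_le)
qed

text \<open>The normal is measurable by assumption; the point is that the offset \<open>c\<close> is
  too. The quotient of \<open>\<bar>c H\<bar>\<close> by the norm of the normal is the distance of
  \<open>H\<close> from the origin, and its sublevel sets are the events that \<open>H\<close> hits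
  a closed ball. The sign of \<open>c\<close> is recovered by asking whether the point
  \<open>p H\<close>, built from the absolute value, lies on \<open>H\<close>.\<close>

lemma measurable_half_space:
  fixes \<nu> :: "'a::euclidean_space set \<Rightarrow> 'a"
  assumes \<nu>: "orientation \<nu>"
  shows "half_space \<nu> b \<in> hyperplane_borel \<rightarrow>\<^sub>M fell"
proof -
  have \<nu>m [measurable]: "\<nu> \<in> hyperplane_borel \<rightarrow>\<^sub>M borel" using \<nu> by (simp add: orientation_def)
  define c where "c H = (SOME c. \<nu> H \<noteq> 0 \<and> H = {x. \<nu> H \<bullet> x = c} \<and>
    half_space \<nu> True H = {x. \<nu> H \<bullet> x \<ge> c} \<and> half_space \<nu> False H = {x. \<nu> H \<bullet> x \<le> c})" for H
  have c: "\<nu> H \<noteq> 0 \<and> H = {x. \<nu> H \<bullet> x = c H} \<and>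
    half_space \<nu> True H = {x. \<nu> H \<bullet> x \<ge> c H} \<and> half_space \<nu> False H = {x. \<nu> H \<bullet> x \<le> c H}"
    if "H \<in> hyperplanes" for H
    unfolding c_def by (rule someI_ex) (metis hyperplane_offset[OF \<nu> that])
  have nz: "\<nu> H \<noteq> 0" and mem: "x \<in> H \<longleftrightarrow> \<nu> H \<bullet> x = c H"
    and hs: "half_space \<nu> True H = {x. \<nu> H \<bullet> x \<ge> c H}" "half_space \<nu> False H = {x. \<nu> H \<bullet> x \<le> c H}"
    if "H \<in> hyperplanes" for H x
    using c[OF that] by blast+
  define p where "p H = (\<bar>c H\<bar> / (\<nu> H \<bullet> \<nu> H)) *\<^sub>R \<nu> H" for H
  have n: "\<bar>c H\<bar> / norm (\<nu> H) \<le> r \<longleftrightarrow> H \<inter> cball 0 r \<noteq> {}" if H: "H \<in> hyperplanes" for H r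
  proof
    assume r: "\<bar>c H\<bar> / norm (\<nu> H) \<le> r"
    have "\<nu> H \<bullet> (c H / (\<nu> H \<bullet> \<nu> H)) *\<^sub>R \<nu> H = c H" using nz[OF H] by simp
    then have "(c H / (\<nu> H \<bullet> \<nu> H)) *\<^sub>R \<nu> H \<in> H" using mem[OF H] by simp
    moreover have "norm ((c H / (\<nu> H \<bullet> \<nu> H)) *\<^sub>R \<nu> H) = \<bar>c H\<bar> / norm (\<nu> H)"
      by (simp add: power2_norm_eq_inner[symmetric] power2_eq_square)
    ultimately show "H \<inter> cball 0 r \<noteq> {}" using r by auto
  next
    assume "H \<inter> cball 0 r \<noteq> {}"
    then obtain x where x: "x \<in> H" "norm x \<le> r" by auto
    then have "c H = \<nu> H \<bullet> x" using mem[OF H] by simp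
    then have "\<bar>c H\<bar> \<le> norm (\<nu> H) * norm x" using Cauchy_Schwarz_ineq2 by simp
    also have "\<dots> \<le> norm (\<nu> H) * r" using x by (simp add: mult_left_mono)
    finally show "\<bar>c H\<bar> / norm (\<nu> H) \<le> r" using nz[OF H] by (simp add: divide_le_eq mult.commute)
  qed
  have "(\<lambda>H. \<bar>c H\<bar> / norm (\<nu> H)) \<in> borel_measurable hyperplane_borel"
    unfolding borel_measurable_iff_le
  proof
    fix r
    have "{H \<in> space hyperplane_borel. \<bar>c H\<bar> / norm (\<nu> H) \<le> r} = {H \<in> space hyperplane_borel. \<not> (H \<inter> cball 0 r = {})}"
      using n by auto
    moreover have "Measurable.pred hyperplane_borel (\<lambda>H. \<not> (H \<inter> cball 0 r = {}))"
      using pred_fell_miss_compact[OF measurable_hyperplane_fell compact_cball] by (rule pred_intros_logic(2))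
    ultimately show "{H \<in> space hyperplane_borel. \<bar>c H\<bar> / norm (\<nu> H) \<le> r} \<in> sets hyperplane_borel"
      by (simp add: pred_def)
  qed
  then have "(\<lambda>H. \<bar>c H\<bar> / norm (\<nu> H) * norm (\<nu> H)) \<in> borel_measurable hyperplane_borel"
    by measurable
  then have ac [measurable]: "(\<lambda>H. \<bar>c H\<bar>) \<in> borel_measurable hyperplane_borel"
    by (subst measurable_cong[where g = "\<lambda>H. \<bar>c H\<bar> / norm (\<nu> H) * norm (\<nu> H)"]) (use nz in auto)
  have pm: "p \<in> borel_measurable hyperplane_borel" unfolding p_def by measurable
  have pin: "p H \<in> H \<longleftrightarrow> c H = \<bar>c H\<bar>" if H: "H \<in> hyperplanes" for H
  proof -
    have "p H \<in> H \<longleftrightarrow> \<nu> H \<bullet> p H = c H" by (rule mem[OF H])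
    then show ?thesis using nz[OF H] by (auto simp: p_def)
  qed
  have [measurable]: "Measurable.pred hyperplane_borel (\<lambda>H. p H \<in> H)"
    using pred_fell_member[OF measurable_hyperplane_fell pm] .
  have "(\<lambda>H. if p H \<in> H then \<bar>c H\<bar> else - \<bar>c H\<bar>) \<in> borel_measurable hyperplane_borel"
    by measurable
  then have cm [measurable]: "c \<in> borel_measurable hyperplane_borel"
    by (subst measurable_cong[where g = "\<lambda>H. if p H \<in> H then \<bar>c H\<bar> else - \<bar>c H\<bar>"]) (use pin in auto)
  show ?thesis
  proof (rule measurable_fellI)
    show "closed (half_space \<nu> b H)" if "H \<in> space hyperplane_borel" for H
      using that \<nu> by (simp add: half_space_closed)
    fix K :: "'a set" assume K: "compact K"
    have "{H \<in> space hyperplane_borel. half_space \<nu> b H \<inter> K = {}} =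
      {H \<in> space hyperplane_borel. \<forall>y\<in>K. (if b then \<nu> H else - \<nu> H) \<bullet> y < (if b then c H else - c H)}"
    proof (intro Collect_cong conj_cong refl)
      fix H :: "'a set" assume "H \<in> space hyperplane_borel"
      then have H: "H \<in> hyperplanes" by simp
      have "half_space \<nu> b H = (if b then {x. \<nu> H \<bullet> x \<ge> c H} else {x. \<nu> H \<bullet> x \<le> c H})"
        using hs[OF H] by (cases b) simp_all
      then show "(half_space \<nu> b H \<inter> K = {}) = (\<forall>y\<in>K. (if b then \<nu> H else - \<nu> H) \<bullet> y < (if b then c H else - c H))"
        by (cases b) (auto simp: disjoint_iff not_le[symmetric])
    qed
    also have "\<dots> \<in> sets hyperplane_borel"
      using pred_inner_less_on_compact[OF _ _ K, of "\<lambda>H. if b then \<nu> H else - \<nu> H" hyperplane_borel "\<lambda>H. if b then c H else - c H"]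
      by (simp add: pred_def)
    finally show "{H \<in> space hyperplane_borel. half_space \<nu> b H \<inter> K = {}} \<in> sets hyperplane_borel" .
  qed
qed

section \<open>Conditional laws and the division kernel\<close>

lemma nn_integral_distr_Pair:
  assumes "sets K = sets S" "x \<in> space F" "f \<in> borel_measurable (F \<Otimes>\<^sub>M S)"
  shows "(\<integral>\<^sup>+z. f z \<partial>distr K (F \<Otimes>\<^sub>M S) (Pair x)) = (\<integral>\<^sup>+y. f (x, y) \<partial>K)"
proof -
  have eq: "(K \<rightarrow>\<^sub>M F \<Otimes>\<^sub>M S) = (S \<rightarrow>\<^sub>M F \<Otimes>\<^sub>M S)" by (rule measurable_cong_sets[OF assms(1) refl])
  have P: "Pair x \<in> K \<rightarrow>\<^sub>M F \<Otimes>\<^sub>M S" unfolding eq using assms(2) by (rule measurable_Pair1')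
  have f: "f \<in> borel_measurable (distr K (F \<Otimes>\<^sub>M S) (Pair x))"
    using assms(3) by (simp only: measurable_distr_eq1)
  show ?thesis by (rule nn_integral_distr[OF P f])
qed

text \<open>The hypothesis has a separate null set for every \<open>D\<close>. Integrating it over
  sets of \<open>F\<close> shows that the joint law and the measure built from the kernel agree on
  rectangles, hence everywhere; this gives the formula for integrands that depend jointly on
  \<open>w\<close> and \<open>X w\<close>.\<close>

lemma nn_integral_conditional_kernel:
  assumes N: "prob_space N" and F: "subalgebra N F" and X [measurable]: "X \<in> N \<rightarrow>\<^sub>M S"
    and \<kappa> [measurable]: "\<kappa> \<in> F \<rightarrow>\<^sub>M subprob_algebra S"
    and cond: "\<And>D. D \<in> sets S \<Longrightarrow>
      AE w in N. real_cond_exp N F (\<lambda>w. indicator D (X w)) w = measure (\<kappa> w) D"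
    and \<phi> [measurable]: "\<phi> \<in> borel_measurable (F \<Otimes>\<^sub>M S)"
  shows "(\<integral>\<^sup>+w. \<phi> (w, X w) \<partial>N) = (\<integral>\<^sup>+w. (\<integral>\<^sup>+y. \<phi> (w, y) \<partial>\<kappa> w) \<partial>N)"
proof -
  interpret prob_space N by (rule N)
  interpret finite_measure_subalgebra N F by standard (rule F)
  have FN: "f \<in> N \<rightarrow>\<^sub>M R" if "f \<in> F \<rightarrow>\<^sub>M R" for f R
    using measurable_from_subalg[OF F that] .
  have spF: "space F = space N" using F by (simp add: subalgebra_def)
  have [measurable]: "(\<lambda>w. (w, X w)) \<in> N \<rightarrow>\<^sub>M F \<Otimes>\<^sub>M S"
    by (intro measurable_Pair FN[OF measurable_ident, unfolded id_def] X)
  define k where "k = (\<lambda>w. distr (\<kappa> w) (F \<Otimes>\<^sub>M S) (Pair w))"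
  have k [measurable]: "k \<in> F \<rightarrow>\<^sub>M subprob_algebra (F \<Otimes>\<^sub>M S)"
    unfolding k_def by (rule measurable_distr2[where M = S]) simp_all
  have sk: "sets (\<kappa> w) = sets S" "subprob_space (\<kappa> w)" if "w \<in> space N" for w
    using measurable_space[OF \<kappa>, of w] that spF by (auto simp: space_subprob_algebra)
  let ?N = "restr_to_subalg N F"
  have spR: "space ?N = space N" by (simp add: space_restr_to_subalg)
  have setsR: "sets ?N = sets F" using F by (rule sets_restr_to_subalg)
  have kR: "k \<in> ?N \<rightarrow>\<^sub>M subprob_algebra (F \<Otimes>\<^sub>M S)"
    using k measurable_cong_sets[OF setsR refl] by blast
  have ne: "space ?N \<noteq> {}" using not_empty spR by simp
  have int_bind: "(\<integral>\<^sup>+z. f z \<partial>(?N \<bind> k)) = (\<integral>\<^sup>+w. (\<integral>\<^sup>+y. f (w, y) \<partial>\<kappa> w) \<partial>N)"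
    if f [measurable]: "f \<in> borel_measurable (F \<Otimes>\<^sub>M S)" for f
  proof -
    have "(\<integral>\<^sup>+z. f z \<partial>(?N \<bind> k)) = (\<integral>\<^sup>+w. (\<integral>\<^sup>+z. f z \<partial>k w) \<partial>?N)"
      by (rule nn_integral_bind[OF f kR])
    also have "\<dots> = (\<integral>\<^sup>+w. (\<integral>\<^sup>+z. f z \<partial>k w) \<partial>N)"
      by (rule nn_integral_subalgebra2[OF F
          measurable_compose[OF k nn_integral_measurable_subprob_algebra[OF f]]])
    also have "\<dots> = (\<integral>\<^sup>+w. (\<integral>\<^sup>+y. f (w, y) \<partial>\<kappa> w) \<partial>N)"
      unfolding k_def
      by (intro nn_integral_cong nn_integral_distr_Pair) (simp_all add: sk spF)
    finally show ?thesis .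
  qed
  have "distr N (F \<Otimes>\<^sub>M S) (\<lambda>w. (w, X w)) = ?N \<bind> k"
  proof (rule measure_eqI_generator_eq[OF Int_stable_pair_measure_generator[of F S]])
    show "{a \<times> b |a b. a \<in> sets F \<and> b \<in> sets S} \<subseteq> Pow (space F \<times> space S)"
      by (auto dest: sets.sets_into_space)
    show "sets (distr N (F \<Otimes>\<^sub>M S) (\<lambda>w. (w, X w))) = sigma_sets (space F \<times> space S) {a \<times> b |a b. a \<in> sets F \<and> b \<in> sets S}"
      by (simp add: sets_pair_measure)
    show "sets (?N \<bind> k) = sigma_sets (space F \<times> space S) {a \<times> b |a b. a \<in> sets F \<and> b \<in> sets S}"
      using sets_bind[OF sets_kernel[OF kR] ne] by (simp add: sets_pair_measure)
    show "range (\<lambda>_::nat. space F \<times> space S) \<subseteq> {a \<times> b |a b. a \<in> sets F \<and> b \<in> sets S}" by auto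
    show "(\<Union>i::nat. space F \<times> space S) = space F \<times> space S" by simp
    have "prob_space (distr N (F \<Otimes>\<^sub>M S) (\<lambda>w. (w, X w)))" by (rule prob_space_distr) simp
    then show "emeasure (distr N (F \<Otimes>\<^sub>M S) (\<lambda>w. (w, X w))) (space F \<times> space S) \<noteq> \<infinity>" for i :: nat
      using prob_space.emeasure_space_1[of "distr N (F \<Otimes>\<^sub>M S) (\<lambda>w. (w, X w))"] by (simp add: space_pair_measure)
    fix Z assume "Z \<in> {a \<times> b |a b. a \<in> sets F \<and> b \<in> sets S}"
    then obtain A D where Z: "Z = A \<times> D" and A [measurable]: "A \<in> sets F" and D [measurable]: "D \<in> sets S" by blast
    have AN [measurable]: "A \<in> sets N" using A F by (auto simp: subalgebra_def)
    have mk: "(\<lambda>w. measure (\<kappa> w) D) \<in> borel_measurable N" by (rule FN) measurable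
    have "(\<integral>w\<in>A. indicator D (X w) \<partial>N) = (\<integral>w\<in>A. real_cond_exp N F (\<lambda>w. indicator D (X w)) w \<partial>N)"
      by (rule real_cond_exp_intA) (auto intro!: integrable_const_bound[where B=1] simp: indicator_def)
    also have "\<dots> = (\<integral>w\<in>A. measure (\<kappa> w) D \<partial>N)"
      unfolding set_lebesgue_integral_def
      by (intro integral_cong_AE borel_measurable_scaleR borel_measurable_indicator AN mk borel_measurable_cond_exp2)
        (use cond[OF D] in auto)
    finally have eq: "(\<integral>w. indicator A w * indicator D (X w) \<partial>N) = (\<integral>w. indicator A w * measure (\<kappa> w) D \<partial>N)"
      by (simp add: set_lebesgue_integral_def)
    have le1: "measure (\<kappa> w) D \<le> 1" if "w \<in> space N" for w
      using subprob_space.subprob_measure_le_1[OF sk(2)[OF that]] .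
    have "emeasure (distr N (F \<Otimes>\<^sub>M S) (\<lambda>w. (w, X w))) Z = (\<integral>\<^sup>+w. indicator A w * indicator D (X w) \<partial>N)"
      unfolding Z by (subst nn_integral_indicator[symmetric], simp, subst nn_integral_distr)
        (auto simp: indicator_times intro!: nn_integral_cong split: split_indicator)
    also have "\<dots> = (\<integral>\<^sup>+w. ennreal (indicator A w * indicator D (X w)) \<partial>N)"
      by (auto intro!: nn_integral_cong split: split_indicator)
    also have "\<dots> = ennreal (\<integral>w. indicator A w * indicator D (X w) \<partial>N)"
      by (intro nn_integral_eq_integral integrable_const_bound[where B=1]) (auto split: split_indicator)
    also have "\<dots> = ennreal (\<integral>w. indicator A w * measure (\<kappa> w) D \<partial>N)" by (simp add: eq)
    also have "\<dots> = (\<integral>\<^sup>+w. ennreal (indicator A w * measure (\<kappa> w) D) \<partial>N)"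
      by (intro nn_integral_eq_integral[symmetric] integrable_const_bound[where B=1])
        (use le1 mk in \<open>auto intro!: borel_measurable_times split: split_indicator\<close>)
    also have "\<dots> = (\<integral>\<^sup>+w. (\<integral>\<^sup>+y. indicator (A \<times> D) (w, y) \<partial>\<kappa> w) \<partial>N)"
    proof (rule nn_integral_cong)
      fix w assume w: "w \<in> space N"
      interpret K: subprob_space "\<kappa> w" by (rule sk(2)[OF w])
      have "(\<integral>\<^sup>+y. indicator (A \<times> D) (w, y) \<partial>\<kappa> w) = (\<integral>\<^sup>+y. indicator A w * indicator D y \<partial>\<kappa> w)"
        by (simp add: indicator_times)
      also have "\<dots> = indicator A w * emeasure (\<kappa> w) D"
        by (rule nn_integral_cmult_indicator) (simp only: sk(1)[OF w] D)
      finally show "ennreal (indicator A w * measure (\<kappa> w) D) = (\<integral>\<^sup>+y. indicator (A \<times> D) (w, y) \<partial>\<kappa> w)"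
        by (auto simp: K.emeasure_eq_measure split: split_indicator)
    qed
    also have "\<dots> = emeasure (?N \<bind> k) Z"
    proof -
      have "indicator (A \<times> D) \<in> borel_measurable (F \<Otimes>\<^sub>M S)" by measurable
      note int_bind[OF this, symmetric]
      moreover have "A \<times> D \<in> sets (?N \<bind> k)"
        by (simp only: sets_bind[OF sets_kernel[OF kR] ne] A D pair_measureI)
      ultimately show ?thesis by (simp only: Z nn_integral_indicator)
    qed
    finally show "emeasure (distr N (F \<Otimes>\<^sub>M S) (\<lambda>w. (w, X w))) Z = emeasure (?N \<bind> k) Z" .
  qed
  then have "(\<integral>\<^sup>+z. \<phi> z \<partial>distr N (F \<Otimes>\<^sub>M S) (\<lambda>w. (w, X w))) = (\<integral>\<^sup>+z. \<phi> z \<partial>(?N \<bind> k))" by simp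
  then show ?thesis by (simp add: int_bind nn_integral_distr)
qed

text \<open>In \<open>ennreal\<close> the quotient is 0 if \<open>x\<close> is 0 or infinite. This
  is how degenerate hitting masses turn into mass 0 instead of an undefined law.\<close>

lemma ennreal_divide_self_le_1: "x / x \<le> (1 :: ennreal)"
proof (cases "x = \<infinity>")
  case True then show ?thesis by (simp add: divide_ennreal_def)
next
  case False
  then show ?thesis by (cases "x = 0") (auto simp: ennreal_divide_self less_top)
qed

section \<open>The driving measure and the division law as a kernel\<close>

locale driving =
  fixes \<Lambda> :: "'a::euclidean_space set measure"
  assumes driving: "driving_measure \<Lambda>"
begin

lemma sets_\<Lambda> [measurable_cong]: "sets \<Lambda> = sets hyperplane_borel"
  using driving by (simp add: driving_measure_def)

lemma space_\<Lambda> [simp]: "space \<Lambda> = hyperplanes"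
  using sets_eq_imp_space_eq[OF sets_\<Lambda>] by simp

lemma id_fell [measurable]: "(\<lambda>H. H) \<in> \<Lambda> \<rightarrow>\<^sub>M fell"
  using measurable_hyperplane_fell measurable_cong_sets[OF sets_\<Lambda> refl] by blast

lemma hits_sets [measurable]: "closed C \<Longrightarrow> hits C \<in> sets \<Lambda>"
proof -
  assume "closed C"
  then have "Measurable.pred \<Lambda> (\<lambda>H. \<not> (H \<inter> C = {}))"
    by (intro pred_intros_logic(2) pred_fell_miss_closed id_fell)
  moreover have "{H \<in> space \<Lambda>. \<not> (H \<inter> C = {})} = hits C" by (auto simp: hits_def)
  ultimately show ?thesis by (simp add: pred_def)
qed

lemma finite_hits: "bounded B \<Longrightarrow> emeasure \<Lambda> (hits B) < \<infinity>"
  using driving by (simp add: driving_measure_def)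

lemma hits_mono: "A \<subseteq> B \<Longrightarrow> hits A \<subseteq> hits B"
  by (auto simp: hits_def)

sublocale sigma_finite_measure \<Lambda>
proof
  let ?A = "range (\<lambda>n::nat. hits (cball 0 (real n)))"
  have "\<Union>?A = space \<Lambda>"
  proof -
    have "\<exists>n::nat. H \<in> hits (cball 0 (real n))" if H: "H \<in> hyperplanes" for H :: "'a set"
    proof -
      have "H \<noteq> {}" using H by (auto simp: hyperplanes_def)
      then obtain x where "x \<in> H" by auto
      moreover obtain n :: nat where "norm x \<le> n" using real_arch_simple by blast
      ultimately have "x \<in> H \<inter> cball 0 (real n)" by simp
      then show ?thesis using H unfolding hits_def by blast
    qed
    then show ?thesis by (auto simp: hits_def)
  qed
  moreover have "emeasure \<Lambda> a \<noteq> \<infinity>" if "a \<in> ?A" for a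
    using that finite_hits[OF bounded_cball] by (auto simp: less_top[symmetric])
  moreover have "?A \<subseteq> sets \<Lambda>" by auto
  ultimately show "\<exists>A. countable A \<and> A \<subseteq> sets \<Lambda> \<and> \<Union>A = space \<Lambda> \<and> (\<forall>a\<in>A. emeasure \<Lambda> a \<noteq> \<infinity>)"
    by (intro exI[of _ ?A]) auto
qed

lemma pred_hits [measurable (raw)]:
  assumes "f \<in> M \<rightarrow>\<^sub>M fell" "g \<in> M \<rightarrow>\<^sub>M \<Lambda>"
  shows "Measurable.pred M (\<lambda>x. g x \<in> hits (f x))"
proof -
  have "(\<lambda>x. g x \<inter> f x) \<in> M \<rightarrow>\<^sub>M fell"
    using measurable_fell_Int[OF measurable_compose[OF assms(2) id_fell] assms(1)] .
  from pred_fell_miss_closed[OF this, of UNIV]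
  have "Measurable.pred M (\<lambda>x. \<not> (g x \<inter> f x = {}))" by simp
  then show ?thesis
    by (rule measurable_cong[THEN iffD1, rotated])
      (use measurable_space[OF assms(2)] in \<open>auto simp: hits_def\<close>)
qed

text \<open>The set \<open>hits C\<close> is the section at \<open>C\<close> of the incidence set in
  a product space, so sigma-finiteness gives measurability of its mass.\<close>

lemma emeasure_hits_measurable [measurable]: "(\<lambda>C. emeasure \<Lambda> (hits C)) \<in> borel_measurable fell"
proof -
  let ?Q = "{p \<in> space (fell \<Otimes>\<^sub>M \<Lambda>). snd p \<in> hits (fst p)}"
  have "?Q \<in> sets (fell \<Otimes>\<^sub>M \<Lambda>)" by measurable
  then have "(\<lambda>C. emeasure \<Lambda> (Pair C -` ?Q)) \<in> borel_measurable fell"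
    by (rule measurable_emeasure_Pair)
  then show ?thesis
    by (rule measurable_cong[THEN iffD1, rotated])
      (auto simp: space_pair_measure hits_def intro!: arg_cong[where f="emeasure \<Lambda>"])
qed

abbreviation marks :: "(real \<times> 'a set) measure" where
  "marks \<equiv> borel \<Otimes>\<^sub>M \<Lambda>"

definition rate :: "'a set \<Rightarrow> real" where
  "rate C = measure \<Lambda> (hits C)"

lemma rate_measurable [measurable]: "rate \<in> borel_measurable fell"
  unfolding rate_def measure_def by measurable

lemma rate_nonneg [simp]: "0 \<le> rate C" by (simp add: rate_def)

lemma rate_mono: "closed C \<Longrightarrow> closed D \<Longrightarrow> C \<subseteq> D \<Longrightarrow> bounded D \<Longrightarrow> rate C \<le> rate D"
  unfolding rate_def using finite_hits[of D]
  by (intro measure_mono_fmeasurable hits_mono) (auto simp: fmeasurable_def)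

abbreviation uniform_density :: "'a set \<Rightarrow> 'a set \<Rightarrow> ennreal" where
  "uniform_density C h \<equiv> indicator (hits C) h / emeasure \<Lambda> (hits C)"

text \<open>The density of the division law with respect to a product measure that does not depend
  on the cell. Since it is jointly measurable in the cell and the mark, the division law becomes a
  kernel.\<close>

definition division_density :: "'a set \<Rightarrow> real \<times> 'a set \<Rightarrow> ennreal" where
  "division_density C = (\<lambda>(x, h). ennreal (exponential_density (rate C) x) *
     (uniform_density C h))"

lemma division_density_measurable [measurable]:
  "(\<lambda>(C, z). division_density C z) \<in> borel_measurable (fell \<Otimes>\<^sub>M marks)"
  unfolding division_density_def exponential_density_def indicator_def of_bool_def
  by measurable

lemma division_density_measurable' [measurable]:
  "closed C \<Longrightarrow> division_density C \<in> borel_measurable marks"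
  unfolding division_density_def by measurable

lemma uniform_le_1: "closed C \<Longrightarrow> emeasure (uniform_measure \<Lambda> (hits C)) (space \<Lambda>) \<le> 1"
proof -
  assume C: "closed C"
  have "hits C \<inter> space \<Lambda> = hits C" by (auto simp: hits_def)
  then have "emeasure (uniform_measure \<Lambda> (hits C)) (space \<Lambda>) = emeasure \<Lambda> (hits C) / emeasure \<Lambda> (hits C)"
    using C sets.top[of \<Lambda>] by (subst emeasure_uniform_measure) auto
  also have "\<dots> \<le> 1" by (rule ennreal_divide_self_le_1)
  finally show ?thesis .
qed

lemma division_law_density:
  assumes C: "closed C"
  shows "division_law \<Lambda> C = density (lborel \<Otimes>\<^sub>M \<Lambda>) (division_density C)"
proof -
  have "finite_measure (uniform_measure \<Lambda> (hits C))"
    using uniform_le_1[OF C] by (intro finite_measureI) (auto simp: top_unique)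
  then have "sigma_finite_measure (density \<Lambda> (\<lambda>h. uniform_density C h))"
    unfolding uniform_measure_def by (rule finite_measure.axioms)
  then show ?thesis
    unfolding division_law_def uniform_measure_def division_density_def rate_def
    using C by (intro pair_measure_density) (auto intro: sigma_finite_measure_axioms)
qed

lemma sets_division_law [measurable_cong]: "sets (division_law \<Lambda> C) = sets marks"
  unfolding division_law_def by (intro sets_pair_measure_cong) auto

lemma space_division_law: "space (division_law \<Lambda> C) = UNIV \<times> hyperplanes"
  unfolding division_law_def by (simp add: space_pair_measure)

lemma exponential_le_1:
  assumes "0 \<le> l" shows "emeasure (density lborel (\<lambda>x. ennreal (exponential_density l x))) UNIV \<le> 1"
proof (cases "l = 0")
  case True
  then have "ennreal (exponential_density l x) = 0" for x by (simp add: exponential_density_def)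
  then show ?thesis by (simp add: emeasure_density)
next
  case False
  with assms interpret prob_space "density lborel (\<lambda>x. ennreal (exponential_density l x))"
    using prob_space_exponential_density by auto
  show ?thesis using emeasure_space_1 by simp
qed

text \<open>For an arbitrary closed \<open>C\<close> the hitting mass may be 0 or infinite, and then
  the law has mass 0. Mass 1 for windows is obtained later from the realisations.\<close>

lemma subprob_division_law:
  assumes C: "closed C" shows "subprob_space (division_law \<Lambda> C)"
proof
  have fin: "finite_measure (uniform_measure \<Lambda> (hits C))"
    using uniform_le_1[OF C] by (intro finite_measureI) (auto simp: top_unique)
  then interpret U: sigma_finite_measure "uniform_measure \<Lambda> (hits C)" by (rule finite_measure.axioms)
  have "emeasure (division_law \<Lambda> C) (space (division_law \<Lambda> C)) =
    emeasure (density lborel (\<lambda>x. ennreal (exponential_density (rate C) x))) UNIV *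
      emeasure (uniform_measure \<Lambda> (hits C)) hyperplanes"
    unfolding division_law_def rate_def[symmetric]
    by (simp add: space_pair_measure) (subst U.emeasure_pair_measure_Times, auto simp flip: space_\<Lambda>)
  also have "\<dots> \<le> 1 * 1" using exponential_le_1[OF rate_nonneg] uniform_le_1[OF C] by (intro mult_mono) auto
  finally show "emeasure (division_law \<Lambda> C) (space (division_law \<Lambda> C)) \<le> 1" by simp
  have "space \<Lambda> \<noteq> {}" using driving by (auto simp: driving_measure_def)
  then show "space (division_law \<Lambda> C) \<noteq> {}" by (simp add: space_division_law)
qed

lemma division_law_kernel [measurable]: "division_law \<Lambda> \<in> fell \<rightarrow>\<^sub>M subprob_algebra marks"
proof (rule measurable_subprob_algebra)
  fix D :: "(real \<times> 'a set) set" assume D [measurable]: "D \<in> sets marks"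
  interpret P: pair_sigma_finite lborel \<Lambda> by standard
  have s: "sets (fell \<Otimes>\<^sub>M marks) = sets (fell \<Otimes>\<^sub>M (lborel \<Otimes>\<^sub>M \<Lambda>))"
    by (intro sets_pair_measure_cong refl sets_lborel[symmetric])
  have [measurable]: "(\<lambda>(C, z). division_density C z) \<in> borel_measurable (fell \<Otimes>\<^sub>M (lborel \<Otimes>\<^sub>M \<Lambda>))"
    using division_density_measurable measurable_cong_sets[OF s refl] by blast
  have "(\<lambda>C. \<integral>\<^sup>+z. division_density C z * indicator D z \<partial>(lborel \<Otimes>\<^sub>M \<Lambda>)) \<in> borel_measurable fell"
    by measurable
  then show "(\<lambda>C. emeasure (division_law \<Lambda> C) D) \<in> borel_measurable fell"
    by (rule measurable_cong[THEN iffD1, rotated])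
      (use D in \<open>auto simp: division_law_density emeasure_density cong: sets_pair_measure_cong\<close>)
qed (auto simp: subprob_division_law sets_division_law)

end

section \<open>The recursion for the miss probabilities\<close>

lemma strict_suffix_Cons: "strict_suffix v (b # v)"
  proof -
  have "v \<noteq> b # v" by (metis not_Cons_self)
  then show ?thesis by (simp add: strict_suffix_def suffix_Cons)
qed

text \<open>Two normals of one hyperplane are parallel; the sign of the factor decides whether the
  names of the two sides are exchanged.\<close>

lemma half_space_orientation:
  assumes \<nu>: "orientation \<nu>" and \<nu>': "orientation \<nu>'" and h: "h \<in> hyperplanes"
  shows "(\<forall>b. half_space \<nu>' b h = half_space \<nu> b h) \<or> (\<forall>b. half_space \<nu>' b h = half_space \<nu> (\<not> b) h)"
proof -
  obtain c where c: "\<nu> h \<noteq> 0" "h = {x. \<nu> h \<bullet> x = c}"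
    "half_space \<nu> True h = {x. \<nu> h \<bullet> x \<ge> c}" "half_space \<nu> False h = {x. \<nu> h \<bullet> x \<le> c}"
    using hyperplane_offset[OF \<nu> h] .
  obtain d where d: "\<nu>' h \<noteq> 0" "h = {x. \<nu>' h \<bullet> x = d}"
    "half_space \<nu>' True h = {x. \<nu>' h \<bullet> x \<ge> d}" "half_space \<nu>' False h = {x. \<nu>' h \<bullet> x \<le> d}"
    using hyperplane_offset[OF \<nu>' h] .
  define a where "a = \<nu> h"
  define a' where "a' = \<nu>' h"
  have same: "a \<bullet> x = c \<longleftrightarrow> a' \<bullet> x = d" for x
    using c(2) d(2) unfolding a_def a'_def by blast
  define p where "p = (c / (a \<bullet> a)) *\<^sub>R a"
  have p: "a \<bullet> p = c" using c(1) by (simp add: p_def a_def)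
  then have p': "a' \<bullet> p = d" using same by simp
  have orth: "a' \<bullet> y = 0" if "a \<bullet> y = 0" for y
    using same[of "p + y"] p p' that by (simp add: inner_add_right)
  define k where "k = (a' \<bullet> a) / (a \<bullet> a)"
  \<comment> \<open>The part of the second normal that is orthogonal to the first. It is a direction
    inside the hyperplane, so it is also orthogonal to the second normal, and therefore to
    itself.\<close>
  define y where "y = a' - k *\<^sub>R a"
  have ay: "a \<bullet> y = 0" using c(1) by (simp add: y_def k_def inner_diff_right a_def inner_commute)
  then have "y \<bullet> y = 0" using orth[OF ay] by (simp add: y_def inner_diff_left)
  then have a': "a' = k *\<^sub>R a" by (simp add: y_def)
  then have dk: "d = k * c" using p p' by simp
  have "k \<noteq> 0" using d(1) a' by (auto simp: a'_def)
  then consider "k > 0" | "k < 0" by linarith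
  then show ?thesis
  proof cases
    case 1
    then have "half_space \<nu>' b h = half_space \<nu> b h" for b
      using c(3,4) d(3,4) a' dk by (cases b) (simp_all add: a_def a'_def)
    then show ?thesis by simp
  next
    case 2
    then have "half_space \<nu>' b h = half_space \<nu> (\<not> b) h" for b
      using c(3,4) d(3,4) a' dk by (cases b) (simp_all add: a_def a'_def mult_le_cancel_left)
    then show ?thesis by simp
  qed
qed

context driving
begin

lemma half_space_measurable:
  "orientation \<nu> \<Longrightarrow> half_space \<nu> b \<in> \<Lambda> \<rightarrow>\<^sub>M fell"
  using measurable_half_space measurable_cong_sets[OF sets_\<Lambda> refl] by blast

text \<open>\<open>miss_prob \<nu> K n (C, r)\<close> is the probability that, in the division process started from the
  cell \<open>C\<close>, no division of a cell of generation less than \<open>n\<close> up to time \<open>r\<close> hits \<open>K\<close>. For negative \<open>r\<close>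
  the first case applies, so that no case distinction on the time is needed in the recursion.\<close>

definition miss_step ::
  "('a set \<Rightarrow> 'a) \<Rightarrow> 'a set \<Rightarrow> ('a set \<times> real \<Rightarrow> ennreal) \<Rightarrow> ('a set \<times> real) \<times> (real \<times> 'a set) \<Rightarrow> ennreal" where
  "miss_step \<nu> K f = (\<lambda>((C, r), (x, h)). if r < x then 1 else if h \<inter> C \<inter> K \<noteq> {} then 0
     else f (C \<inter> half_space \<nu> True h, r - x) * f (C \<inter> half_space \<nu> False h, r - x))"

primrec miss_prob :: "('a set \<Rightarrow> 'a) \<Rightarrow> 'a set \<Rightarrow> nat \<Rightarrow> 'a set \<times> real \<Rightarrow> ennreal" where
  "miss_prob \<nu> K 0 = (\<lambda>_. 1)"
| "miss_prob \<nu> K (Suc n) =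
    (\<lambda>(C, r). \<integral>\<^sup>+z. miss_step \<nu> K (miss_prob \<nu> K n) ((C, r), z) \<partial>division_law \<Lambda> C)"

lemma miss_step_measurable:
  assumes \<nu>: "orientation \<nu>" and K: "compact K" and f: "f \<in> borel_measurable (fell \<Otimes>\<^sub>M borel)"
    and c: "c \<in> M \<rightarrow>\<^sub>M fell" and r: "r \<in> borel_measurable M"
    and x: "x \<in> borel_measurable M" and h: "h \<in> M \<rightarrow>\<^sub>M \<Lambda>"
  shows "(\<lambda>w. miss_step \<nu> K f ((c w, r w), (x w, h w))) \<in> borel_measurable M"
proof -
  have hf: "h \<in> M \<rightarrow>\<^sub>M fell" by (rule measurable_compose[OF h id_fell])
  have hs: "(\<lambda>w. c w \<inter> half_space \<nu> b (h w)) \<in> M \<rightarrow>\<^sub>M fell" for b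
    by (intro measurable_fell_Int c measurable_compose[OF h half_space_measurable[OF \<nu>]])
  have [measurable]: "(\<lambda>w. f (c w \<inter> half_space \<nu> b (h w), r w - x w)) \<in> borel_measurable M" for b
    by (rule measurable_compose[OF measurable_Pair[OF hs] f]) (intro borel_measurable_diff r x)
  have [measurable]: "Measurable.pred M (\<lambda>w. h w \<inter> c w \<inter> K = {})"
    by (intro pred_fell_miss_compact K measurable_fell_Int hf c)
  have [measurable]: "Measurable.pred M (\<lambda>w. r w < x w)" using r x by measurable
  show ?thesis unfolding miss_step_def by simp measurable
qed

lemma miss_prob_measurable:
  assumes \<nu>: "orientation \<nu>" and K: "compact K"
  shows "miss_prob \<nu> K n \<in> borel_measurable (fell \<Otimes>\<^sub>M borel)"
proof (induction n)
  case (Suc n)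
  have "(\<lambda>p. \<integral>\<^sup>+z. miss_step \<nu> K (miss_prob \<nu> K n) (p, z) \<partial>division_law \<Lambda> (fst p)) \<in> borel_measurable (fell \<Otimes>\<^sub>M borel)"
  proof (rule nn_integral_measurable_subprob_algebra2[where N = "marks"])
    have "(\<lambda>q. miss_step \<nu> K (miss_prob \<nu> K n) ((fst (fst q), snd (fst q)), (fst (snd q), snd (snd q))))
        \<in> borel_measurable ((fell \<Otimes>\<^sub>M borel) \<Otimes>\<^sub>M marks)"
      by (intro miss_step_measurable \<nu> K Suc.IH) measurable
    then show "(\<lambda>(p, z). miss_step \<nu> K (miss_prob \<nu> K n) (p, z)) \<in> borel_measurable ((fell \<Otimes>\<^sub>M borel) \<Otimes>\<^sub>M marks)"
      by (simp add: split_def)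
    show "(\<lambda>p. division_law \<Lambda> (fst p)) \<in> fell \<Otimes>\<^sub>M borel \<rightarrow>\<^sub>M subprob_algebra marks"
      by measurable
  qed
  then show ?case by (simp add: split_def)
qed simp

lemma miss_step_section_measurable:
  assumes "orientation \<nu>" "compact K" "closed C"
  shows "(\<lambda>z. miss_step \<nu> K (miss_prob \<nu> K n) ((C, r), z)) \<in> borel_measurable (division_law \<Lambda> D)"
proof -
  have "(\<lambda>z. miss_step \<nu> K (miss_prob \<nu> K n) ((C, r), (fst z, snd z))) \<in> borel_measurable marks"
    using assms by (intro miss_step_measurable miss_prob_measurable) measurable
  then show ?thesis by (simp add: measurable_cong_sets[OF sets_division_law refl])
qed

text \<open>Realisations in different windows come with different orientations. Exchanging the two
  daughters only exchanges the two factors of the product in \<open>miss_step\<close>, so the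
  recursion does not see the orientation.\<close>

lemma miss_prob_orientation:
  assumes "orientation \<nu>" "orientation \<nu>'"
  shows "miss_prob \<nu> K n = miss_prob \<nu>' K n"
proof (induction n)
  case (Suc n)
  have "miss_step \<nu> K (miss_prob \<nu> K n) ((C, r), z) = miss_step \<nu>' K (miss_prob \<nu>' K n) ((C, r), z)"
    if zz: "z \<in> space (division_law \<Lambda> C)" for C r z
  proof -
    obtain x h where z: "z = (x, h)" "h \<in> hyperplanes" using zz unfolding space_division_law by blast
    from half_space_orientation[OF assms z(2)]
    show ?thesis by (auto simp: z(1) miss_step_def Suc.IH mult.commute)
  qed
  then show ?case by (auto intro!: ext nn_integral_cong)
qed simp

end

section \<open>Realisations of the division process and the recursion along the tree\<close>

locale cell_process = driving \<Lambda> for \<Lambda> :: "'a::euclidean_space set measure" +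
  fixes N :: "'w measure" and W :: "'a set" and \<nu> L H
  assumes cell_div: "cell_division \<Lambda> W N \<nu> L H" and W: "closed W"
begin

sublocale prob_space N using cell_div by (simp add: cell_division_def)

lemma orient: "orientation \<nu>" using cell_div by (simp add: cell_division_def)

lemma L_meas [measurable]: "L v \<in> borel_measurable N" and H_meas [measurable]: "H v \<in> N \<rightarrow>\<^sub>M \<Lambda>"
  using cell_div[unfolded cell_division_def, THEN conjunct2, THEN conjunct2, THEN conjunct1] by blast+

abbreviation cl :: "bool list \<Rightarrow> 'w \<Rightarrow> 'a set" where "cl \<equiv> cell \<nu> W H"
abbreviation birth :: "bool list \<Rightarrow> 'w \<Rightarrow> real" where "birth \<equiv> birth_time L"
abbreviation death :: "bool list \<Rightarrow> 'w \<Rightarrow> real" where "death \<equiv> death_time L"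

text \<open>The conditioning algebra of \<open>cell_division\<close>: all marks except those in the
  subtree below \<open>v\<close>. The cell and the birth time of \<open>v\<close> are measurable for
  it, the lifetime of \<open>v\<close> in general is not.\<close>

definition outside :: "bool list \<Rightarrow> 'w measure" where
  "outside v = generated_algebra N marks (\<lambda>u w. (L u w, H u w)) {u. \<not> suffix v u}"

text \<open>Stated for an arbitrary algebra \<open>A\<close> so that one induction gives
  measurability both for \<open>N\<close> and for the algebras \<open>outside v\<close>.\<close>

definition known :: "'w measure \<Rightarrow> bool list \<Rightarrow> bool" where
  "known A u \<longleftrightarrow> L u \<in> borel_measurable A \<and> H u \<in> A \<rightarrow>\<^sub>M \<Lambda>"

lemma known_N: "known N u" by (simp add: known_def)

lemma space_outside [simp]: "space (outside v) = space N"
  by (simp add: outside_def generated_algebra_def)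

lemma marks_measurable:
  "(\<lambda>w. \<lambda>u\<in>I. (L u w, H u w)) \<in> N \<rightarrow>\<^sub>M (\<Pi>\<^sub>M i\<in>I. marks)"
  by (intro measurable_restrict measurable_Pair L_meas H_meas)

lemma sets_outside: "sets (outside v) = {(\<lambda>w. \<lambda>u\<in>{u. \<not> suffix v u}. (L u w, H u w)) -` A \<inter> space N |A.
    A \<in> sets (\<Pi>\<^sub>M i\<in>{u. \<not> suffix v u}. marks)}"
  unfolding outside_def generated_algebra_def
  by (rule sets_vimage_algebra2) (rule Pi_I, rule measurable_space[OF marks_measurable])

lemma known_outside: assumes "\<not> suffix v u" shows "known (outside v) u"
proof -
  let ?I = "{u. \<not> suffix v u}"
  have m: "(\<lambda>w. \<lambda>u\<in>?I. (L u w, H u w)) \<in> outside v \<rightarrow>\<^sub>M (\<Pi>\<^sub>M i\<in>?I. marks)"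
    unfolding outside_def generated_algebra_def
    by (rule measurable_vimage_algebra1) (rule Pi_I, rule measurable_space[OF marks_measurable])
  have "(\<lambda>x. x u) \<in> (\<Pi>\<^sub>M i\<in>?I. marks) \<rightarrow>\<^sub>M marks"
    by (rule measurable_component_singleton) (simp add: assms)
  from measurable_compose[OF m this]
  have p: "(\<lambda>w. (L u w, H u w)) \<in> outside v \<rightarrow>\<^sub>M marks" using assms by simp
  show ?thesis
    using measurable_compose[OF p measurable_fst] measurable_compose[OF p measurable_snd]
    by (simp add: known_def)
qed

lemma subalgebra_outside: "subalgebra N (outside v)"
  using measurable_sets[OF marks_measurable] by (auto simp: subalgebra_def sets_outside)

lemma cell_known:
  assumes "\<And>u. strict_suffix u v \<Longrightarrow> known A u"
  shows "cl v \<in> A \<rightarrow>\<^sub>M fell"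
  using assms
proof (induction v)
  case Nil
  have "(\<lambda>_. W) \<in> A \<rightarrow>\<^sub>M fell" using W by simp
  moreover have "cl [] = (\<lambda>_. W)" by auto
  ultimately show ?case by simp
next
  case (Cons b v)
  have "known A v" by (rule Cons.prems) (rule strict_suffix_Cons)
  moreover have "cl v \<in> A \<rightarrow>\<^sub>M fell"
    by (rule Cons.IH, rule Cons.prems) (rule suffix_order.less_trans[OF _ strict_suffix_Cons])
  ultimately have "(\<lambda>w. cl v w \<inter> half_space \<nu> b (H v w)) \<in> A \<rightarrow>\<^sub>M fell"
    by (intro measurable_fell_Int measurable_compose[OF _ half_space_measurable[OF orient]]) (simp_all add: known_def)
  moreover have "cl (b # v) = (\<lambda>w. cl v w \<inter> half_space \<nu> b (H v w))" by auto
  ultimately show ?case by simp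
qed

lemma birth_known:
  assumes "\<And>u. strict_suffix u v \<Longrightarrow> known A u"
  shows "birth v \<in> borel_measurable A"
  using assms
proof (induction v)
  case Nil
  have "birth [] = (\<lambda>_. 0)" by auto
  then show ?case by simp
next
  case (Cons b v)
  have "known A v" by (rule Cons.prems) (rule strict_suffix_Cons)
  moreover have "birth v \<in> borel_measurable A"
    by (rule Cons.IH, rule Cons.prems) (rule suffix_order.less_trans[OF _ strict_suffix_Cons])
  moreover have "birth (b # v) = (\<lambda>w. birth v w + L v w)" by auto
  ultimately show ?case by (simp only: known_def borel_measurable_add)
qed

lemma strict_suffix_not_suffix: "strict_suffix u v \<Longrightarrow> \<not> suffix v u"
  by (metis suffix_order.less_le_not_le)

lemma cell_outside: "cl v \<in> outside v \<rightarrow>\<^sub>M fell" and birth_outside: "birth v \<in> borel_measurable (outside v)"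
  by (auto intro!: cell_known birth_known known_outside dest: strict_suffix_not_suffix)

lemma cl_closed: "w \<in> space N \<Longrightarrow> closed (cl v w)"
  using measurable_space[OF cell_known[OF known_N]] by auto

text \<open>The pathwise counterpart of \<open>miss_prob\<close>. A node that dies after
  \<open>t\<close> ends the recursion, since none of its descendants can divide by time
  \<open>t\<close>.\<close>

primrec missed :: "'a set \<Rightarrow> real \<Rightarrow> nat \<Rightarrow> bool list \<Rightarrow> 'w \<Rightarrow> bool" where
  "missed K t 0 = (\<lambda>v w. True)"
| "missed K t (Suc n) = (\<lambda>v w. t < death v w \<or>
    (H v w \<inter> cl v w \<inter> K = {} \<and> missed K t n (True # v) w \<and> missed K t n (False # v) w))"

lemma missed_known:
  assumes K: "compact K" and "\<And>u. suffix u v \<or> suffix v u \<Longrightarrow> known A u"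
  shows "Measurable.pred A (missed K t n v)"
  using assms(2)
proof (induction n arbitrary: v)
  case (Suc n)
  have kv: "known A v" using Suc.prems by simp
  have c: "cl v \<in> A \<rightarrow>\<^sub>M fell" and b: "birth v \<in> borel_measurable A"
    by (auto intro!: cell_known birth_known Suc.prems simp: strict_suffix_def)
  have h: "H v \<in> A \<rightarrow>\<^sub>M fell" using kv measurable_compose[OF _ id_fell] by (auto simp: known_def)
  have [measurable]: "Measurable.pred A (missed K t n (b # v))" for b
    by (rule Suc.IH, rule Suc.prems) (metis suffix_Cons suffix_ConsD suffix_order.refl)
  have [measurable]: "Measurable.pred A (\<lambda>w. H v w \<inter> cl v w \<inter> K = {})"
    by (intro pred_fell_miss_compact K measurable_fell_Int h c)
  have [measurable]: "Measurable.pred A (\<lambda>w. t < death v w)"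
    unfolding death_time_def using kv b
    by (intro borel_measurable_pred_less borel_measurable_const borel_measurable_add) (simp_all add: known_def)
  show ?case by simp measurable
qed simp

text \<open>The only place where the conditional law in \<open>cell_division\<close> is used; the
  later integrals over marks all go through this formula.\<close>

lemma division_nn_integral:
  assumes \<phi>: "\<phi> \<in> borel_measurable (outside v \<Otimes>\<^sub>M marks)"
  shows "(\<integral>\<^sup>+w. \<phi> (w, (L v w, H v w)) \<partial>N) = (\<integral>\<^sup>+w. (\<integral>\<^sup>+z. \<phi> (w, z) \<partial>division_law \<Lambda> (cl v w)) \<partial>N)"
proof (rule nn_integral_conditional_kernel[OF _ subalgebra_outside _ _ _ \<phi>])
  show "(\<lambda>w. division_law \<Lambda> (cl v w)) \<in> outside v \<rightarrow>\<^sub>M subprob_algebra marks"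
    by (rule measurable_compose[OF cell_outside division_law_kernel])
  show "AE w in N. real_cond_exp N (outside v) (\<lambda>w. indicator D (L v w, H v w)) w =
      measure (division_law \<Lambda> (cl v w)) D" if "D \<in> sets marks" for D
    using cell_div that unfolding cell_division_def outside_def by blast
qed (auto intro: prob_space_axioms)


lemma outside_mono: "sets (outside v) \<subseteq> sets (outside (b # v))"
proof -
  let ?I = "{u. \<not> suffix v u}" and ?f = "\<lambda>w u. (L u w, H u w)"
  have "(\<lambda>w. \<lambda>u\<in>?I. (L u w, H u w)) \<in> outside (b # v) \<rightarrow>\<^sub>M (\<Pi>\<^sub>M i\<in>?I. marks)"
  proof (rule measurable_restrict)
    fix u assume "u \<in> ?I"
    then have "\<not> suffix (b # v) u" by (auto dest: suffix_ConsD)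
    then show "(\<lambda>w. (L u w, H u w)) \<in> outside (b # v) \<rightarrow>\<^sub>M marks"
      using known_outside by (auto simp: known_def intro: measurable_Pair)
  qed
  note * = measurable_sets[OF this, unfolded space_outside]
  show ?thesis using * by (auto simp: sets_outside[of v])
qed

lemma outside_measurable_mono: "f \<in> outside v \<rightarrow>\<^sub>M S \<Longrightarrow> f \<in> outside (b # v) \<rightarrow>\<^sub>M S"
  using outside_mono by (intro measurable_from_subalg[of "outside (b # v)" "outside v"]) (simp_all add: subalgebra_def)

lemma outside_measurable_N: "f \<in> outside v \<rightarrow>\<^sub>M S \<Longrightarrow> f \<in> N \<rightarrow>\<^sub>M S"
  by (rule measurable_from_subalg[OF subalgebra_outside])

lemma suffix_Cons_not: "suffix u v \<Longrightarrow> \<not> suffix (b # v) u"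
  by (auto dest!: suffix_length_le)

lemma sibling_not_suffix: "suffix u (b # v) \<or> suffix (b # v) u \<Longrightarrow> b \<noteq> c \<Longrightarrow> \<not> suffix (c # v) u"
proof
  assume u: "suffix u (b # v) \<or> suffix (b # v) u" and bc: "b \<noteq> c" and cu: "suffix (c # v) u"
  from u show False
  proof
    assume "suffix u (b # v)"
    then have "suffix (c # v) (b # v)" using cu suffix_order.trans by blast
    then show False using bc by (auto simp: suffix_Cons dest: suffix_length_le)
  next
    assume "suffix (b # v) u"
    then obtain x y where "u = x @ b # v" "u = y @ c # v" using cu by (auto simp: suffix_def)
    then have "x @ [b] @ v = y @ [c] @ v" by simp
    then show False using bc by simp
  qed
qed

text \<open>Given the mark of \<open>v\<close>, the subtrees of the two daughters are independent;
  this is obtained by integrating them out one after the other, and then the mark of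
  \<open>v\<close>. The weight \<open>g\<close> may depend on the lifetime of \<open>v\<close>,
  which allows the event that \<open>v\<close> is alive at a given time to be inserted later. The
  induction hypothesis is a premise so that the step can be used outside the induction as
  well.\<close>

lemma missed_integral_step:
  assumes K: "compact K"
    and IH: "\<And>v Z. Z \<in> borel_measurable (outside v) \<Longrightarrow>
      (\<integral>\<^sup>+w. Z w * (if missed K t n v w then 1 else 0) \<partial>N) =
      (\<integral>\<^sup>+w. Z w * miss_prob \<nu> K n (cl v w, t - birth v w) \<partial>N)"
    and g: "g \<in> borel_measurable (outside v \<Otimes>\<^sub>M borel)"
  shows "(\<integral>\<^sup>+w. g (w, L v w) * (if missed K t (Suc n) v w then 1 else 0) \<partial>N) =
    (\<integral>\<^sup>+w. (\<integral>\<^sup>+z. g (w, fst z) * miss_step \<nu> K (miss_prob \<nu> K n) ((cl v w, t - birth v w), z)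
      \<partial>division_law \<Lambda> (cl v w)) \<partial>N)"
proof -
  define I where "I b w = (if missed K t n (b # v) w then 1 else 0 :: ennreal)" for b w
  define P where "P b w = miss_prob \<nu> K n (cl (b # v) w, t - birth (b # v) w)" for b w
  \<comment> \<open>\<open>A\<close> collects the paths on which \<open>v\<close> is undivided at
    time \<open>t\<close>, and \<open>B\<close> those on which its division has occurred and misses
    \<open>K\<close>.\<close>
  define A where "A w = g (w, L v w) * (if t < death v w then 1 else 0)" for w
  define B where "B w = g (w, L v w) * (if t < death v w then 0 else if H v w \<inter> cl v w \<inter> K = {} then 1 else 0)" for w
  have kn: "known (outside (b # v)) u" if "suffix u v" for u b
    by (rule known_outside) (rule suffix_Cons_not[OF that])
  have kv: "L v \<in> borel_measurable (outside (b # v))" "H v \<in> outside (b # v) \<rightarrow>\<^sub>M \<Lambda>" for b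
    using kn[of v] by (auto simp: known_def)
  have gm: "(\<lambda>w. g (w, L v w)) \<in> borel_measurable (outside (b # v))" for b
    by (rule measurable_compose[OF measurable_Pair g])
      (intro outside_measurable_mono[OF measurable_ident, unfolded id_def] kv)+
  have dm: "Measurable.pred (outside (b # v)) (\<lambda>w. t < death v w)" for b
    unfolding death_time_def
    by (intro borel_measurable_pred_less borel_measurable_const borel_measurable_add
        outside_measurable_mono[OF birth_outside] kv)
  have cm: "Measurable.pred (outside (b # v)) (\<lambda>w. H v w \<inter> cl v w \<inter> K = {})" for b
    by (intro pred_fell_miss_compact K measurable_fell_Int measurable_compose[OF kv(2) id_fell]
        outside_measurable_mono[OF cell_outside])
  have Am: "A \<in> borel_measurable (outside (b # v))" and Bm: "B \<in> borel_measurable (outside (b # v))" for b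
    unfolding A_def B_def using gm[of b] dm[of b] cm[of b] by measurable
  have Im: "I b \<in> borel_measurable (outside (c # v))" if "b \<noteq> c" for b c
  proof -
    have "Measurable.pred (outside (c # v)) (missed K t n (b # v))"
      by (rule missed_known[OF K]) (rule known_outside, rule sibling_not_suffix[OF _ that])
    then show ?thesis unfolding I_def by measurable
  qed
  have Pm: "P b \<in> borel_measurable (outside (c # v))" for b c
  proof -
    have s: "suffix u v" if "strict_suffix u (b # v)" for u
      using that by (auto simp: strict_suffix_def suffix_Cons)
    show ?thesis unfolding P_def
      by (rule measurable_compose[OF measurable_Pair miss_prob_measurable[OF orient K]])
        (intro borel_measurable_diff borel_measurable_const cell_known birth_known kn s; assumption)+
  qed
  have ImN: "I b \<in> borel_measurable N" for b
    using outside_measurable_N[OF Im[of b "\<not> b"]] by simp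
  \<comment> \<open>Relative to the subtree of \<open>True # v\<close>, the indicator of the sibling
    subtree is outside information and belongs to the weight. Once this subtree is replaced by
    \<open>P True\<close>, which depends only on \<open>v\<close> and its ancestors, the roles of
    the daughters can be exchanged.\<close>
  have "(\<integral>\<^sup>+w. B w * I False w * I True w \<partial>N) = (\<integral>\<^sup>+w. B w * I False w * P True w \<partial>N)"
    unfolding I_def[of True] P_def by (rule IH) (intro borel_measurable_times_ennreal Bm Im, simp)
  also have "\<dots> = (\<integral>\<^sup>+w. B w * P True w * I False w \<partial>N)" by (simp add: ac_simps)
  also have "\<dots> = (\<integral>\<^sup>+w. B w * P True w * P False w \<partial>N)"
    unfolding I_def P_def[of False] by (rule IH) (intro borel_measurable_times_ennreal Bm Pm)
  finally have BI: "(\<integral>\<^sup>+w. B w * I False w * I True w \<partial>N) = (\<integral>\<^sup>+w. B w * P True w * P False w \<partial>N)" .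
  note meas = outside_measurable_N[OF Am] outside_measurable_N[OF Bm] outside_measurable_N[OF Pm] ImN
  have "(\<integral>\<^sup>+w. g (w, L v w) * (if missed K t (Suc n) v w then 1 else 0) \<partial>N) =
      (\<integral>\<^sup>+w. A w + B w * I False w * I True w \<partial>N)"
    by (intro nn_integral_cong) (simp add: A_def B_def I_def)
  also have "\<dots> = (\<integral>\<^sup>+w. A w \<partial>N) + (\<integral>\<^sup>+w. B w * I False w * I True w \<partial>N)"
    by (intro nn_integral_add borel_measurable_times_ennreal meas)
  also have "\<dots> = (\<integral>\<^sup>+w. A w \<partial>N) + (\<integral>\<^sup>+w. B w * P True w * P False w \<partial>N)" by (simp only: BI)
  also have "\<dots> = (\<integral>\<^sup>+w. A w + B w * P True w * P False w \<partial>N)"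
    by (intro nn_integral_add[symmetric] borel_measurable_times_ennreal meas)
  also have "\<dots> = (\<integral>\<^sup>+w. g (w, L v w) *
      miss_step \<nu> K (miss_prob \<nu> K n) ((cl v w, t - birth v w), (L v w, H v w)) \<partial>N)"
    by (intro nn_integral_cong)
      (simp add: A_def B_def P_def miss_step_def death_time_def algebra_simps less_diff_eq)
  also have "\<dots> = (\<integral>\<^sup>+w. (\<lambda>(w, z). g (w, fst z) *
      miss_step \<nu> K (miss_prob \<nu> K n) ((cl v w, t - birth v w), z)) (w, (L v w, H v w)) \<partial>N)" by simp
  also have "\<dots> = (\<integral>\<^sup>+w. (\<integral>\<^sup>+z. (\<lambda>(w, z). g (w, fst z) *
      miss_step \<nu> K (miss_prob \<nu> K n) ((cl v w, t - birth v w), z)) (w, z) \<partial>division_law \<Lambda> (cl v w)) \<partial>N)"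
  proof (rule division_nn_integral)
    have "(\<lambda>p. miss_step \<nu> K (miss_prob \<nu> K n)
        ((cl v (fst p), t - birth v (fst p)), (fst (snd p), snd (snd p)))) \<in> borel_measurable (outside v \<Otimes>\<^sub>M marks)"
      by (intro miss_step_measurable orient K miss_prob_measurable borel_measurable_diff borel_measurable_const
          measurable_compose[OF measurable_fst cell_outside] measurable_compose[OF measurable_fst birth_outside])
        measurable
    moreover have "(\<lambda>p. g (fst p, fst (snd p))) \<in> borel_measurable (outside v \<Otimes>\<^sub>M marks)"
      by (rule measurable_compose[OF _ g]) measurable
    ultimately show "(\<lambda>(w, z). g (w, fst z) *
      miss_step \<nu> K (miss_prob \<nu> K n) ((cl v w, t - birth v w), z)) \<in> borel_measurable (outside v \<Otimes>\<^sub>M marks)"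
      by (simp add: split_def)
  qed
  finally show ?thesis by simp
qed

text \<open>As the weight \<open>Z\<close> is arbitrary, this says that \<open>miss_prob\<close> is
  the conditional probability of \<open>missed\<close> given \<open>outside v\<close>. The weights
  are needed in the induction, where the sibling enters through them.\<close>

lemma missed_integral:
  assumes K: "compact K" and Z: "Z \<in> borel_measurable (outside v)"
  shows "(\<integral>\<^sup>+w. Z w * (if missed K t n v w then 1 else 0) \<partial>N) =
    (\<integral>\<^sup>+w. Z w * miss_prob \<nu> K n (cl v w, t - birth v w) \<partial>N)"
  using Z
proof (induction n arbitrary: v Z)
  case (Suc n)
  have "(\<lambda>p. Z (fst p)) \<in> borel_measurable (outside v \<Otimes>\<^sub>M borel)"
    by (rule measurable_compose[OF measurable_fst Suc.prems])
  note missed_integral_step[OF K Suc.IH this]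
  moreover have "(\<integral>\<^sup>+z. Z w * miss_step \<nu> K (miss_prob \<nu> K n) ((cl v w, t - birth v w), z) \<partial>division_law \<Lambda> (cl v w)) =
      Z w * miss_prob \<nu> K (Suc n) (cl v w, t - birth v w)" if "w \<in> space N" for w
    using cl_closed[OF that] by (simp add: nn_integral_cmult miss_step_section_measurable orient K)
  ultimately show ?case by (simp cong: nn_integral_cong)
qed simp

end

section \<open>Exponential lifetimes\<close>

context driving
begin

lemma division_law_iterated:
  assumes C: "closed C" and f [measurable]: "f \<in> borel_measurable marks"
  shows "(\<integral>\<^sup>+z. f z \<partial>division_law \<Lambda> C) = (\<integral>\<^sup>+x. ennreal (exponential_density (rate C) x) *
     (\<integral>\<^sup>+h. uniform_density C h * f (x, h) \<partial>\<Lambda>) \<partial>lborel)"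
proof -
  have s: "sets marks = sets (lborel \<Otimes>\<^sub>M \<Lambda>)"
    by (intro sets_pair_measure_cong refl sets_lborel[symmetric])
  have f' [measurable]: "f \<in> borel_measurable (lborel \<Otimes>\<^sub>M \<Lambda>)"
    using f by (simp only: measurable_cong_sets[OF s refl])
  have d [measurable]: "division_density C \<in> borel_measurable (lborel \<Otimes>\<^sub>M \<Lambda>)"
    using division_density_measurable'[OF C] by (simp only: measurable_cong_sets[OF s refl])
  have "(\<integral>\<^sup>+z. f z \<partial>division_law \<Lambda> C) = (\<integral>\<^sup>+z. division_density C z * f z \<partial>(lborel \<Otimes>\<^sub>M \<Lambda>))"
    unfolding division_law_density[OF C] by (rule nn_integral_density[OF d f'])
  also have "\<dots> = (\<integral>\<^sup>+x. (\<integral>\<^sup>+h. division_density C (x, h) * f (x, h) \<partial>\<Lambda>) \<partial>lborel)"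
    by (rule nn_integral_fst[symmetric]) (intro borel_measurable_times_ennreal d f')
  also have "\<dots> = (\<integral>\<^sup>+x. ennreal (exponential_density (rate C) x) *
     (\<integral>\<^sup>+h. uniform_density C h * f (x, h) \<partial>\<Lambda>) \<partial>lborel)"
  proof (rule nn_integral_cong)
    fix x :: real
    have [measurable]: "(\<lambda>h. f (x, h)) \<in> borel_measurable \<Lambda>" by measurable
    have [measurable]: "hits C \<in> sets \<Lambda>" by (rule hits_sets[OF C])
    have m: "(\<lambda>h. uniform_density C h * f (x, h)) \<in> borel_measurable \<Lambda>"
      by measurable
    show "(\<integral>\<^sup>+h. division_density C (x, h) * f (x, h) \<partial>\<Lambda>) = ennreal (exponential_density (rate C) x) *
       (\<integral>\<^sup>+h. uniform_density C h * f (x, h) \<partial>\<Lambda>)"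
      by (subst nn_integral_cmult[OF m, symmetric]) (simp add: division_density_def mult.assoc)
  qed
  finally show ?thesis .
qed

text \<open>A cell that has survived the time \<open>a\<close> starts afresh: its residual lifetime
  and its dividing hyperplane again have the division law. This is the translation of the
  exponential density.\<close>

lemma division_law_memoryless:
  assumes C: "closed C" and f [measurable]: "f \<in> borel_measurable marks" and a: "0 \<le> a"
  shows "(\<integral>\<^sup>+z. (if a < fst z then 1 else 0) * f (fst z - a, snd z) \<partial>division_law \<Lambda> C) =
    ennreal (exp (- rate C * a)) * (\<integral>\<^sup>+z. f z \<partial>division_law \<Lambda> C)"
proof -
  let ?l = "rate C"
  define G where "G x = (\<integral>\<^sup>+h. uniform_density C h * f (x, h) \<partial>\<Lambda>)" for x :: real
  have [measurable]: "hits C \<in> sets \<Lambda>" by (rule hits_sets[OF C])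
  have G [measurable]: "G \<in> borel_measurable borel" unfolding G_def by measurable
  have e [measurable]: "exponential_density ?l \<in> borel_measurable borel" by measurable
  have fm: "(\<lambda>z. (if a < fst z then 1 else 0) * f (fst z - a, snd z)) \<in> borel_measurable marks"
    by measurable
  have Gm: "(\<lambda>x. ennreal (exponential_density ?l x) * ((if a < x then 1 else 0) * G (x - a))) \<in> borel_measurable borel"
    by measurable
  have "(\<integral>\<^sup>+z. (if a < fst z then 1 else 0) * f (fst z - a, snd z) \<partial>division_law \<Lambda> C) =
    (\<integral>\<^sup>+x. ennreal (exponential_density ?l x) * ((if a < x then 1 else 0) * G (x - a)) \<partial>lborel)"
    unfolding division_law_iterated[OF C fm] G_def by (intro nn_integral_cong) auto
  also have "\<dots> = (\<integral>\<^sup>+x. ennreal (exponential_density ?l (a + x)) * ((if 0 < x then 1 else 0) * G x) \<partial>lborel)"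
    using nn_integral_real_affine[OF Gm, of 1 a] by simp
  also have "\<dots> = (\<integral>\<^sup>+x. ennreal (exp (- ?l * a)) * (ennreal (exponential_density ?l x) * G x) \<partial>lborel)"
  proof (rule nn_integral_cong_AE)
    \<comment> \<open>The exponential density is defined to be nonzero at 0 for a positive rate,
      whereas the strict inequality \<open>a < x\<close> becomes \<open>0 < x\<close>; the two sides
      may differ at this single point.\<close>
    have "AE x in lborel. x \<noteq> (0::real)" by (rule AE_lborel_singleton)
    then show "AE x in lborel. ennreal (exponential_density ?l (a + x)) * ((if 0 < x then 1 else 0) * G x) =
      ennreal (exp (- ?l * a)) * (ennreal (exponential_density ?l x) * G x)"
    proof eventually_elim
      case (elim x)
      show ?case
      proof (cases "0 < x")
        case True
        then have "exponential_density ?l (a + x) = exp (- ?l * a) * exponential_density ?l x"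
          using a by (simp add: exponential_density_def exp_add[symmetric] algebra_simps)
        moreover have "0 \<le> exponential_density ?l x" by (simp add: exponential_density_def)
        ultimately show ?thesis using True by (simp add: ennreal_mult mult.assoc)
      next
        case False
        then show ?thesis using elim by (simp add: exponential_density_def)
      qed
    qed
  qed
  also have "\<dots> = ennreal (exp (- ?l * a)) * (\<integral>\<^sup>+x. ennreal (exponential_density ?l x) * G x \<partial>lborel)"
    by (rule nn_integral_cmult) measurable
  also have "(\<integral>\<^sup>+x. ennreal (exponential_density ?l x) * G x \<partial>lborel) = (\<integral>\<^sup>+z. f z \<partial>division_law \<Lambda> C)"
    unfolding G_def by (rule division_law_iterated[OF C f, symmetric])
  finally show ?thesis .
qed

lemma division_law_pos:
  assumes C: "closed C" shows "(\<integral>\<^sup>+z. (if fst z \<le> 0 then 1 else 0) \<partial>division_law \<Lambda> C) = 0"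
proof -
  have "(\<integral>\<^sup>+z. (if fst z \<le> 0 then 1 else 0) \<partial>division_law \<Lambda> C) =
    (\<integral>\<^sup>+x. ennreal (exponential_density (rate C) x) *
      (\<integral>\<^sup>+h. uniform_density C h * (if x \<le> 0 then 1 else 0) \<partial>\<Lambda>) \<partial>lborel)"
    by (subst division_law_iterated[OF C]) simp_all
  also have "\<dots> = (\<integral>\<^sup>+x. 0 \<partial>(lborel :: real measure))"
  proof (rule nn_integral_cong_AE)
    have "AE x in lborel. x \<noteq> (0::real)" by (rule AE_lborel_singleton)
    then show "AE x in lborel. ennreal (exponential_density (rate C) x) *
      (\<integral>\<^sup>+h. uniform_density C h * (if x \<le> 0 then 1 else 0) \<partial>\<Lambda>) = 0"
    proof eventually_elim
      case (elim x)
      then show ?case by (cases "x < 0") (simp_all add: exponential_density_def)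
    qed
  qed
  finally show ?thesis by simp
qed

lemma uniform_total_le_1:
  assumes C: "closed C"
  shows "(\<integral>\<^sup>+h. uniform_density C h \<partial>\<Lambda>) \<le> 1"
proof -
  have [measurable]: "hits C \<in> sets \<Lambda>" by (rule hits_sets[OF C])
  have "(indicator (hits C) :: 'a set \<Rightarrow> ennreal) \<in> borel_measurable \<Lambda>" by measurable
  from nn_integral_divide[OF this]
  have "(\<integral>\<^sup>+h. uniform_density C h \<partial>\<Lambda>) = emeasure \<Lambda> (hits C) / emeasure \<Lambda> (hits C)"
    by (simp add: nn_integral_indicator)
  also have "\<dots> \<le> 1" by (rule ennreal_divide_self_le_1)
  finally show ?thesis .
qed

text \<open>For a proper exponential lifetime the transform is the rate divided by the rate plus
  \<open>\<theta>\<close>. The cruder bound follows from dropping the factor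
  \<open>exp (- x * ?l)\<close>, covers rate 0, and is monotone in the rate in a simple way.\<close>

lemma division_law_laplace:
  assumes C: "closed C" and \<theta>: "0 < \<theta>"
  shows "(\<integral>\<^sup>+z. ennreal (exp (- \<theta> * fst z)) \<partial>division_law \<Lambda> C) \<le> ennreal (rate C / \<theta>)"
proof -
  let ?l = "rate C"
  have [measurable]: "hits C \<in> sets \<Lambda>" by (rule hits_sets[OF C])
  have m: "(\<lambda>h. uniform_density C h :: ennreal) \<in> borel_measurable \<Lambda>" by measurable
  have "(\<integral>\<^sup>+z. ennreal (exp (- \<theta> * fst z)) \<partial>division_law \<Lambda> C) =
    (\<integral>\<^sup>+x. ennreal (exponential_density ?l x) * (\<integral>\<^sup>+h. uniform_density C h * ennreal (exp (- \<theta> * x)) \<partial>\<Lambda>) \<partial>lborel)"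
    by (subst division_law_iterated[OF C]) auto
  also have "\<dots> \<le> (\<integral>\<^sup>+x. ennreal (?l / \<theta>) * ennreal (exponential_density \<theta> x) \<partial>lborel)"
  proof (rule nn_integral_mono)
    fix x :: real
    have "(\<integral>\<^sup>+h. uniform_density C h * ennreal (exp (- \<theta> * x)) \<partial>\<Lambda>) \<le> 1 * ennreal (exp (- \<theta> * x))"
      unfolding nn_integral_multc[OF m] by (intro mult_right_mono uniform_total_le_1 C) simp
    then have "ennreal (exponential_density ?l x) * (\<integral>\<^sup>+h. uniform_density C h * ennreal (exp (- \<theta> * x)) \<partial>\<Lambda>)
      \<le> ennreal (exponential_density ?l x) * ennreal (exp (- \<theta> * x))"
      by (intro mult_left_mono) simp_all
    also have "\<dots> = ennreal (exponential_density ?l x * exp (- \<theta> * x))"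
      by (rule ennreal_mult[symmetric]) (simp_all add: exponential_density_def)
    also have "\<dots> \<le> ennreal (?l / \<theta> * exponential_density \<theta> x)"
    proof (rule ennreal_leI)
      show "exponential_density ?l x * exp (- \<theta> * x) \<le> ?l / \<theta> * exponential_density \<theta> x"
      proof (cases "x < 0")
        case False
        have "exp (- x * ?l) \<le> 1" using False by simp
        then have "?l * exp (- x * ?l) * exp (- \<theta> * x) \<le> ?l * 1 * exp (- \<theta> * x)"
          by (intro mult_right_mono mult_left_mono) auto
        then show ?thesis using False \<theta> by (simp add: exponential_density_def mult.commute)
      qed (simp add: exponential_density_def)
    qed
    also have "\<dots> = ennreal (?l / \<theta>) * ennreal (exponential_density \<theta> x)"
      using \<theta> by (intro ennreal_mult) (simp_all add: exponential_density_def)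
    finally show "ennreal (exponential_density ?l x) * (\<integral>\<^sup>+h. uniform_density C h * ennreal (exp (- \<theta> * x)) \<partial>\<Lambda>)
      \<le> ennreal (?l / \<theta>) * ennreal (exponential_density \<theta> x)" .
  qed
  also have "\<dots> = ennreal (?l / \<theta>) * emeasure (density lborel (\<lambda>x. ennreal (exponential_density \<theta> x))) UNIV"
    by (subst nn_integral_cmult) (auto simp: emeasure_density)
  also have "\<dots> \<le> ennreal (?l / \<theta>) * 1"
    using exponential_le_1 \<theta> by (intro mult_left_mono) auto
  finally show ?thesis by simp
qed

lemma miss_step_mono:
  assumes "\<And>b. f (C \<inter> half_space \<nu> b h, r - x) \<le> g (C \<inter> half_space \<nu> b h, r - x)"
  shows "miss_step \<nu> K f ((C, r), (x, h)) \<le> miss_step \<nu> K g ((C, r), (x, h))"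
  using assms by (auto simp: miss_step_def intro!: mult_mono)

text \<open>Greater depth imposes more conditions. The base case is where total mass at most 1
  enters.\<close>

lemma miss_prob_Suc_le:
  assumes \<nu>: "orientation \<nu>" and C: "closed C"
  shows "miss_prob \<nu> K (Suc n) (C, r) \<le> miss_prob \<nu> K n (C, r)"
  using C
proof (induction n arbitrary: C r)
  case 0
  interpret S: subprob_space "division_law \<Lambda> C" by (rule subprob_division_law[OF 0])
  have "(\<integral>\<^sup>+z. miss_step \<nu> K (\<lambda>_. 1) ((C, r), z) \<partial>division_law \<Lambda> C) \<le> (\<integral>\<^sup>+z. 1 \<partial>division_law \<Lambda> C)"
    by (intro nn_integral_mono) (auto simp: miss_step_def)
  then show ?case using S.subprob_emeasure_le_1[of "space (division_law \<Lambda> C)"] by simp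
next
  case (Suc n)
  have "miss_step \<nu> K (miss_prob \<nu> K (Suc n)) ((C, r), z) \<le> miss_step \<nu> K (miss_prob \<nu> K n) ((C, r), z)"
    if z: "z \<in> space (division_law \<Lambda> C)" for z
  proof -
    obtain x h where zz: "z = (x, h)" "h \<in> hyperplanes" using z unfolding space_division_law by blast
    show ?thesis unfolding zz(1)
      by (intro miss_step_mono Suc.IH closed_Int Suc.prems half_space_closed[OF \<nu> zz(2)])
  qed
  then have "(\<integral>\<^sup>+z. miss_step \<nu> K (miss_prob \<nu> K (Suc n)) ((C, r), z) \<partial>division_law \<Lambda> C) \<le>
    (\<integral>\<^sup>+z. miss_step \<nu> K (miss_prob \<nu> K n) ((C, r), z) \<partial>division_law \<Lambda> C)"
    by (rule nn_integral_mono)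
  then show ?case by simp
qed

lemma miss_prob_le_1: "orientation \<nu> \<Longrightarrow> closed C \<Longrightarrow> miss_prob \<nu> K n (C, r) \<le> 1"
  by (induction n) (auto intro: order_trans[OF miss_prob_Suc_le] simp del: miss_prob.simps(2))

end

section \<open>Positive lifetimes, no explosion, and restarting a living cell\<close>

context cell_process
begin

text \<open>The root cell is the constant \<open>W\<close>, so integrating the constant 1 against
  the conditional law at the root gives the mass of the division law of \<open>W\<close>. It is 1
  because \<open>N\<close> is a probability.\<close>

lemma division_law_total: "(\<integral>\<^sup>+z. 1 \<partial>division_law \<Lambda> W) = 1"
proof -
  have "(\<integral>\<^sup>+w. 1 \<partial>N) = (\<integral>\<^sup>+w. (\<integral>\<^sup>+z. 1 \<partial>division_law \<Lambda> (cl [] w)) \<partial>N)"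
    using division_nn_integral[of "\<lambda>_. 1" "[]"] by simp
  then show ?thesis by (simp add: emeasure_space_1)
qed

lemma AE_lifetime_pos: "AE w in N. \<forall>v. 0 < L v w"
proof -
  have "AE w in N. 0 < L v w" for v
  proof -
    have "(\<lambda>p. if fst (snd p) \<le> (0::real) then 1 else 0 :: ennreal) \<in> borel_measurable (outside v \<Otimes>\<^sub>M marks)"
      by measurable
    from division_nn_integral[OF this]
    have "(\<integral>\<^sup>+w. (if L v w \<le> 0 then 1 else 0) \<partial>N) = (\<integral>\<^sup>+w. (\<integral>\<^sup>+z. (if fst z \<le> 0 then 1 else 0) \<partial>division_law \<Lambda> (cl v w)) \<partial>N)"
      by simp
    also have "\<dots> = (\<integral>\<^sup>+w. 0 \<partial>N)"
      by (intro nn_integral_cong division_law_pos cl_closed)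
    finally have "(\<integral>\<^sup>+w. (if L v w \<le> 0 then 1 else 0) \<partial>N) = 0" by simp
    moreover have "(\<lambda>w. if L v w \<le> 0 then 1 else 0 :: ennreal) \<in> borel_measurable N" by measurable
    ultimately have "AE w in N. (if L v w \<le> 0 then 1 else 0 :: ennreal) = 0"
      by (simp add: nn_integral_0_iff_AE)
    then show ?thesis by eventually_elim (auto simp: not_le split: if_splits)
  qed
  then show ?thesis by (simp add: AE_all_countable)
qed

lemma cl_subset: "cl v w \<subseteq> W"
  by (induction v) auto

text \<open>The birth time of \<open>v\<close> is a sum of \<open>length v\<close> lifetimes. Cells
  only shrink, so every rate is at most that of \<open>W\<close>, and each lifetime contributes at
  most the factor \<open>rate W / \<theta>\<close>.\<close>

lemma birth_laplace:
  assumes b: "bounded W" and \<theta>: "0 < \<theta>"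
  shows "(\<integral>\<^sup>+w. ennreal (exp (- \<theta> * birth v w)) \<partial>N) \<le> ennreal ((rate W / \<theta>) ^ length v)"
proof (induction v)
  case Nil then show ?case by (simp add: emeasure_space_1)
next
  case (Cons b v)
  let ?\<phi> = "\<lambda>p. ennreal (exp (- \<theta> * birth v (fst p))) * ennreal (exp (- \<theta> * fst (snd p)))"
  have bm: "(\<lambda>p. birth v (fst p)) \<in> borel_measurable (outside v \<Otimes>\<^sub>M marks)"
    by (rule measurable_compose[OF measurable_fst birth_outside])
  have \<phi>: "?\<phi> \<in> borel_measurable (outside v \<Otimes>\<^sub>M marks)" using bm by measurable
  have "(\<integral>\<^sup>+w. ennreal (exp (- \<theta> * birth (b # v) w)) \<partial>N) = (\<integral>\<^sup>+w. ?\<phi> (w, (L v w, H v w)) \<partial>N)"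
    by (intro nn_integral_cong) (simp add: ennreal_mult[symmetric] exp_add[symmetric] algebra_simps)
  also have "\<dots> = (\<integral>\<^sup>+w. (\<integral>\<^sup>+z. ?\<phi> (w, z) \<partial>division_law \<Lambda> (cl v w)) \<partial>N)"
    by (rule division_nn_integral[OF \<phi>])
  also have "\<dots> \<le> (\<integral>\<^sup>+w. ennreal (exp (- \<theta> * birth v w)) * ennreal (rate W / \<theta>) \<partial>N)"
  proof (rule nn_integral_mono)
    fix w assume w: "w \<in> space N"
    have m: "(\<lambda>z. ennreal (exp (- \<theta> * fst z))) \<in> borel_measurable (division_law \<Lambda> (cl v w))"
      unfolding measurable_cong_sets[OF sets_division_law refl] by measurable
    have "(\<integral>\<^sup>+z. ?\<phi> (w, z) \<partial>division_law \<Lambda> (cl v w)) =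
      ennreal (exp (- \<theta> * birth v w)) * (\<integral>\<^sup>+z. ennreal (exp (- \<theta> * fst z)) \<partial>division_law \<Lambda> (cl v w))"
      using nn_integral_cmult[OF m] by simp
    also have "\<dots> \<le> ennreal (exp (- \<theta> * birth v w)) * ennreal (rate (cl v w) / \<theta>)"
      by (intro mult_left_mono division_law_laplace cl_closed w \<theta>) simp
    also have "\<dots> \<le> ennreal (exp (- \<theta> * birth v w)) * ennreal (rate W / \<theta>)"
      using rate_mono[OF cl_closed[OF w] W cl_subset b] \<theta>
      by (intro mult_left_mono ennreal_leI divide_right_mono) auto
    finally show "(\<integral>\<^sup>+z. ?\<phi> (w, z) \<partial>division_law \<Lambda> (cl v w)) \<le> ennreal (exp (- \<theta> * birth v w)) * ennreal (rate W / \<theta>)" .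
  qed
  also have "\<dots> = (\<integral>\<^sup>+w. ennreal (exp (- \<theta> * birth v w)) \<partial>N) * ennreal (rate W / \<theta>)"
    using outside_measurable_N[OF birth_outside] by (intro nn_integral_multc) measurable
  also have "\<dots> \<le> ennreal ((rate W / \<theta>) ^ length v) * ennreal (rate W / \<theta>)"
    by (intro mult_right_mono Cons.IH) simp
  also have "\<dots> = ennreal ((rate W / \<theta>) ^ length (b # v))"
    using \<theta> by (simp add: ennreal_mult[symmetric] mult.commute)
  finally show ?case .
qed

text \<open>The sum over generation \<open>n\<close> of \<open>exp (- \<theta> * birth v w)\<close>
  has a summable expectation, so almost surely it tends to 0. This pushes all birth times of a late
  generation beyond any given \<open>t\<close> at once.\<close>

lemma AE_no_explosion:
  assumes b: "bounded W"
  shows "AE w in N. \<forall>t. \<exists>n. \<forall>v. length v = n \<longrightarrow> t < birth v w"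
proof -
  \<comment> \<open>Generation \<open>n\<close> has \<open>2 ^ n\<close> nodes; a factor of at most
    1/4 per generation leaves a geometric series of ratio 1/2. The summand 1 keeps
    \<open>\<theta>\<close> positive if the rate is 0.\<close>
  define \<theta> where "\<theta> = 4 * rate W + 1"
  have \<theta>: "0 < \<theta>" using rate_nonneg[of W] unfolding \<theta>_def by linarith
  have q: "0 \<le> rate W / \<theta>" "rate W / \<theta> \<le> 1 / 4"
  proof -
    show "0 \<le> rate W / \<theta>" using \<theta> by simp
    have "rate W \<le> 1 / 4 * \<theta>" unfolding \<theta>_def by simp
    then show "rate W / \<theta> \<le> 1 / 4" using \<theta> by (simp only: pos_divide_le_eq)
  qed
  define A where "A n = {v :: bool list. length v = n}" for n
  have A: "finite (A n)" "card (A n) = 2 ^ n" for n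
    using finite_lists_length_eq[of "UNIV :: bool set" n] card_lists_length_eq[of "UNIV :: bool set" n]
    by (simp_all add: A_def)
  define S where "S n w = (\<Sum>v\<in>A n. exp (- \<theta> * birth v w))" for n w
  have bm [measurable]: "birth v \<in> borel_measurable N" for v by (rule outside_measurable_N[OF birth_outside])
  have Sm [measurable]: "S n \<in> borel_measurable N" for n unfolding S_def by measurable
  have S0: "0 \<le> S n w" for n w by (simp add: S_def sum_nonneg)
  have "(\<integral>\<^sup>+w. ennreal (S n w) \<partial>N) \<le> ennreal ((1 / 2) ^ n)" for n
  proof -
    have "(\<integral>\<^sup>+w. ennreal (S n w) \<partial>N) = (\<integral>\<^sup>+w. (\<Sum>v\<in>A n. ennreal (exp (- \<theta> * birth v w))) \<partial>N)"
      unfolding S_def by (subst sum_ennreal) auto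
    also have "\<dots> = (\<Sum>v\<in>A n. (\<integral>\<^sup>+w. ennreal (exp (- \<theta> * birth v w)) \<partial>N))"
      by (rule nn_integral_sum) measurable
    also have "\<dots> \<le> (\<Sum>v\<in>A n. ennreal ((1 / 4) ^ n))"
    proof (rule sum_mono)
      fix v assume "v \<in> A n"
      then have "(\<integral>\<^sup>+w. ennreal (exp (- \<theta> * birth v w)) \<partial>N) \<le> ennreal ((rate W / \<theta>) ^ n)"
        using birth_laplace[OF b \<theta>, of v] by (simp add: A_def)
      also have "\<dots> \<le> ennreal ((1 / 4) ^ n)" by (intro ennreal_leI power_mono q)
      finally show "(\<integral>\<^sup>+w. ennreal (exp (- \<theta> * birth v w)) \<partial>N) \<le> ennreal ((1 / 4) ^ n)" .
    qed
    also have "\<dots> = ennreal (2 ^ n * (1 / 4) ^ n)"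
      by (subst sum_ennreal) (auto simp: A(2))
    also have "2 ^ n * (1 / 4) ^ n = (1 / 2 :: real) ^ n" by (simp flip: power_mult_distrib)
    finally show ?thesis .
  qed
  then have "(\<Sum>n. (\<integral>\<^sup>+w. ennreal (S n w) \<partial>N)) \<le> (\<Sum>n. ennreal ((1 / 2) ^ n))"
    by (intro suminf_le) auto
  also have "\<dots> = ennreal (\<Sum>n. (1 / 2) ^ n)"
    by (intro suminf_ennreal2 summable_geometric) auto
  also have "\<dots> < \<infinity>" by simp
  also have "(\<Sum>n. (\<integral>\<^sup>+w. ennreal (S n w) \<partial>N)) = (\<integral>\<^sup>+w. (\<Sum>n. ennreal (S n w)) \<partial>N)"
    by (rule nn_integral_suminf[symmetric]) measurable
  finally have "AE w in N. (\<Sum>n. ennreal (S n w)) \<noteq> \<infinity>"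
    by (intro nn_integral_PInf_AE) auto
  then show ?thesis
  proof eventually_elim
    case (elim w)
    then have "summable (\<lambda>n. S n w)" by (intro summable_suminf_not_top S0) auto
    then have lim: "(\<lambda>n. S n w) \<longlonglongrightarrow> 0" by (rule summable_LIMSEQ_zero)
    show ?case
    proof
      fix t
      have "eventually (\<lambda>n. S n w < exp (- \<theta> * t)) sequentially"
        using lim by (rule order_tendstoD(2)) simp
      then obtain n where n: "S n w < exp (- \<theta> * t)" by (auto simp: eventually_sequentially)
      have "t < birth v w" if "length v = n" for v
      proof -
        have "exp (- \<theta> * birth v w) \<le> S n w"
          unfolding S_def using A(1) that by (intro member_le_sum) (auto simp: A_def)
        then have "- \<theta> * birth v w < - \<theta> * t" using n by (metis exp_less_cancel_iff le_less_trans)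
        then show ?thesis using \<theta> by simp
      qed
      then show "\<exists>n. \<forall>v. length v = n \<longrightarrow> t < birth v w" by blast
    qed
  qed
qed

text \<open>If \<open>v\<close> is alive at time \<open>s\<close>, its further division is that of a
  process started at time \<open>s\<close> in the same cell, and survival costs the exponential
  factor. The depth is a successor because at depth 0 the lifetime of \<open>v\<close> would not be
  inspected.\<close>

lemma missed_alive:
  assumes K: "compact K" and Z: "Z \<in> borel_measurable (outside v)"
  shows "(\<integral>\<^sup>+w. Z w * (if birth v w \<le> s \<and> s < death v w then 1 else 0) * (if missed K t (Suc n) v w then 1 else 0) \<partial>N) =
    (\<integral>\<^sup>+w. Z w * (if birth v w \<le> s then 1 else 0) * ennreal (exp (- rate (cl v w) * (s - birth v w))) *
      miss_prob \<nu> K (Suc n) (cl v w, t - s) \<partial>N)"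
proof -
  let ?g = "\<lambda>p. Z (fst p) * (if birth v (fst p) \<le> s \<and> s < birth v (fst p) + snd p then 1 else 0)"
  have [measurable]: "(\<lambda>p. Z (fst p)) \<in> borel_measurable (outside v \<Otimes>\<^sub>M borel)"
    "(\<lambda>p. birth v (fst p)) \<in> borel_measurable (outside v \<Otimes>\<^sub>M borel)"
    by (rule measurable_compose[OF measurable_fst Z], rule measurable_compose[OF measurable_fst birth_outside])
  have g: "?g \<in> borel_measurable (outside v \<Otimes>\<^sub>M borel)" by measurable
  have "(\<integral>\<^sup>+w. Z w * (if birth v w \<le> s \<and> s < death v w then 1 else 0) * (if missed K t (Suc n) v w then 1 else 0) \<partial>N) =
    (\<integral>\<^sup>+w. ?g (w, L v w) * (if missed K t (Suc n) v w then 1 else 0) \<partial>N)"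
    by (simp only: fst_conv snd_conv death_time_def)
  also have "\<dots> = (\<integral>\<^sup>+w. (\<integral>\<^sup>+z. ?g (w, fst z) * miss_step \<nu> K (miss_prob \<nu> K n) ((cl v w, t - birth v w), z)
      \<partial>division_law \<Lambda> (cl v w)) \<partial>N)"
    by (rule missed_integral_step[OF K missed_integral[OF K] g])
  also have "\<dots> = (\<integral>\<^sup>+w. Z w * (if birth v w \<le> s then 1 else 0) * ennreal (exp (- rate (cl v w) * (s - birth v w))) *
      miss_prob \<nu> K (Suc n) (cl v w, t - s) \<partial>N)"
  proof (rule nn_integral_cong)
    fix w assume w: "w \<in> space N"
    let ?C = "cl v w" and ?a = "s - birth v w" and ?f = "\<lambda>z. miss_step \<nu> K (miss_prob \<nu> K n) ((cl v w, t - s), z)"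
    show "(\<integral>\<^sup>+z. ?g (w, fst z) * miss_step \<nu> K (miss_prob \<nu> K n) ((cl v w, t - birth v w), z)
      \<partial>division_law \<Lambda> (cl v w)) = Z w * (if birth v w \<le> s then 1 else 0) *
        ennreal (exp (- rate (cl v w) * (s - birth v w))) * miss_prob \<nu> K (Suc n) (cl v w, t - s)"
    proof (cases "birth v w \<le> s")
      case True
      have fD: "?f \<in> borel_measurable (division_law \<Lambda> ?C)"
        by (rule miss_step_section_measurable[OF orient K cl_closed[OF w]])
      then have f: "?f \<in> borel_measurable marks"
        by (simp only: measurable_cong_sets[OF sets_division_law refl])
      \<comment> \<open>Only the difference between remaining time and lifetime matters in
        \<open>miss_step\<close>; so moving the origin from the birth of \<open>v\<close> to
        \<open>s\<close> shortens both by \<open>?a\<close>, which is the form needed for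
        memorylessness.\<close>
      have shift: "miss_step \<nu> K (miss_prob \<nu> K n) ((cl v w, t - birth v w), z) = ?f (fst z - ?a, snd z)" for z
        by (cases z) (simp add: miss_step_def algebra_simps)
      have m: "(\<lambda>z. (if ?a < fst z then 1 else 0) * ?f (fst z - ?a, snd z)) \<in> borel_measurable (division_law \<Lambda> ?C)"
        unfolding measurable_cong_sets[OF sets_division_law refl] using measurable_compose[OF _ f]
        by measurable
      have "(\<integral>\<^sup>+z. ?g (w, fst z) * miss_step \<nu> K (miss_prob \<nu> K n) ((cl v w, t - birth v w), z) \<partial>division_law \<Lambda> ?C)
        = (\<integral>\<^sup>+z. Z w * ((if ?a < fst z then 1 else 0) * ?f (fst z - ?a, snd z)) \<partial>division_law \<Lambda> ?C)"
        unfolding shift using True by (intro nn_integral_cong) (auto simp: algebra_simps)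
      also have "\<dots> = Z w * (\<integral>\<^sup>+z. (if ?a < fst z then 1 else 0) * ?f (fst z - ?a, snd z) \<partial>division_law \<Lambda> ?C)"
        by (rule nn_integral_cmult[OF m])
      also have "\<dots> = Z w * (ennreal (exp (- rate ?C * ?a)) * (\<integral>\<^sup>+z. ?f z \<partial>division_law \<Lambda> ?C))"
        using True by (subst division_law_memoryless[OF cl_closed[OF w] f]) auto
      finally show ?thesis using True by (simp add: mult.assoc)
    next
      case False
      then show ?thesis by simp
    qed
  qed
  finally show ?thesis .
qed

end

section \<open>Geometry of the living cells\<close>

lemma half_space_Un:
  "orientation \<nu> \<Longrightarrow> h \<in> hyperplanes \<Longrightarrow> x \<in> half_space \<nu> True h \<or> x \<in> half_space \<nu> False h"
  by (erule (1) hyperplane_offset) auto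

lemma hyperplane_subset_half_space: "orientation \<nu> \<Longrightarrow> h \<in> hyperplanes \<Longrightarrow> h \<subseteq> half_space \<nu> b h"
proof -
  assume "orientation \<nu>" "h \<in> hyperplanes"
  then obtain c where c: "h = {x. \<nu> h \<bullet> x = c}"
    "half_space \<nu> True h = {x. \<nu> h \<bullet> x \<ge> c}" "half_space \<nu> False h = {x. \<nu> h \<bullet> x \<le> c}"
    by (rule hyperplane_offset)
  have "x \<in> half_space \<nu> b h" if "x \<in> h" for x
  proof -
    have "\<nu> h \<bullet> x = c" using that c(1) by blast
    then show ?thesis using c(2,3) by (cases b) simp_all
  qed
  then show ?thesis by blast
qed

lemma interior_half_space:
  "orientation \<nu> \<Longrightarrow> h \<in> hyperplanes \<Longrightarrow> interior (half_space \<nu> b h) = half_space \<nu> b h - h"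
proof -
  assume "orientation \<nu>" "h \<in> hyperplanes"
  then obtain c where c: "\<nu> h \<noteq> 0" "h = {x. \<nu> h \<bullet> x = c}"
    "half_space \<nu> True h = {x. \<nu> h \<bullet> x \<ge> c}" "half_space \<nu> False h = {x. \<nu> h \<bullet> x \<le> c}"
    by (rule hyperplane_offset)
  have mem: "x \<in> h \<longleftrightarrow> \<nu> h \<bullet> x = c" for x using c(2) by blast
  show ?thesis
    using c(1) by (cases b) (auto simp: c(3,4) mem interior_halfspace_ge interior_halfspace_le)
qed

lemma half_space_Int_subset:
  "orientation \<nu> \<Longrightarrow> h \<in> hyperplanes \<Longrightarrow> half_space \<nu> b h \<inter> half_space \<nu> (\<not> b) h \<subseteq> h"
proof -
  assume "orientation \<nu>" "h \<in> hyperplanes"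
  then obtain c where c: "h = {x. \<nu> h \<bullet> x = c}"
    "half_space \<nu> True h = {x. \<nu> h \<bullet> x \<ge> c}" "half_space \<nu> False h = {x. \<nu> h \<bullet> x \<le> c}"
    by (rule hyperplane_offset)
  have mem: "x \<in> h \<longleftrightarrow> \<nu> h \<bullet> x = c" for x using c(1) by blast
  show ?thesis by (cases b) (auto simp: c(2,3) mem)
qed

lemma half_space_polyhedron: "orientation \<nu> \<Longrightarrow> h \<in> hyperplanes \<Longrightarrow> polyhedron (half_space \<nu> b h)"
proof -
  assume "orientation \<nu>" "h \<in> hyperplanes"
  then obtain c where "half_space \<nu> True h = {x. \<nu> h \<bullet> x \<ge> c}" "half_space \<nu> False h = {x. \<nu> h \<bullet> x \<le> c}"
    by (rule hyperplane_offset)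
  then show ?thesis by (cases b) (simp_all add: polyhedron_halfspace_ge polyhedron_halfspace_le)
qed

text \<open>Incomparable nodes part at their last common ancestor, and so their cells lie on
  opposite sides of its hyperplane. Reversing the lists turns this into the decomposition of
  parallel lists at the first difference.\<close>

lemma incomparable_suffixes:
  assumes "\<not> suffix v u" "\<not> suffix u v"
  obtains u' b where "suffix (b # u') v" "suffix ((\<not> b) # u') u"
proof -
  have "\<not> prefix (rev v) (rev u)" "\<not> prefix (rev u) (rev v)" using assms by (simp_all only: suffix_to_prefix not_False_eq_True)
  from parallel_decomp[OF parallelI[OF this]]
  obtain as b bs c cs where d: "b \<noteq> c" "rev v = as @ b # bs" "rev u = as @ c # cs" by (elim exE conjE)
  have "rev (rev v) = rev (as @ b # bs)" "rev (rev u) = rev (as @ c # cs)" by (simp_all only: d)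
  then have "v = rev bs @ b # rev as" "u = rev cs @ c # rev as" by simp_all
  moreover have "c = (\<not> b)" using d(1) by auto
  ultimately show thesis using that[of b "rev as"] by (simp add: suffix_def)
qed

locale window_process = cell_process \<Lambda> N W \<nu> L H
  for \<Lambda> :: "'a::euclidean_space set measure" and N :: "'w measure" and W \<nu> L H +
  assumes window: "window W"
begin

text \<open>The almost sure event on which the rest is deterministic geometry. Nonnegative lifetimes
  make birth and death times monotone along branches; the last condition stops any descent in the
  tree at finite depth.\<close>

definition good :: "'w \<Rightarrow> bool" where
  "good w \<longleftrightarrow> w \<in> space N \<and> (\<forall>v. 0 \<le> L v w) \<and> (\<forall>t. \<exists>n. \<forall>v. length v = n \<longrightarrow> t < birth v w)"

abbreviation living :: "real \<Rightarrow> 'w \<Rightarrow> 'a set set" where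
  "living \<equiv> cells_alive \<nu> W L H"

lemma AE_good: "AE w in N. good w"
proof -
  have "bounded W" using window by (simp add: window_def polytope_imp_bounded)
  from AE_lifetime_pos AE_no_explosion[OF this] AE_space show ?thesis
    by eventually_elim (simp add: good_def less_imp_le)
qed

lemma good_space: "good w \<Longrightarrow> w \<in> space N"
  by (simp add: good_def)

lemma H_hyperplane_space: "w \<in> space N \<Longrightarrow> H v w \<in> hyperplanes"
  using measurable_space[OF H_meas, of w] by simp

lemmas H_hyperplane = H_hyperplane_space[OF good_space]

lemma cl_polytope_space: "w \<in> space N \<Longrightarrow> polytope (cl v w)"
  using window by (induction v)
    (auto simp: window_def intro!: polytope_Int_polyhedron half_space_polyhedron orient H_hyperplane_space)

lemmas cl_polytope = cl_polytope_space[OF good_space]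

lemma cl_convex: "good w \<Longrightarrow> convex (cl v w)"
  by (intro polytope_imp_convex cl_polytope)

lemma cl_closed': "good w \<Longrightarrow> closed (cl v w)"
  by (intro polytope_imp_closed cl_polytope)

lemma cl_antimono: "suffix v u \<Longrightarrow> cl u w \<subseteq> cl v w"
proof -
  assume "suffix v u"
  then obtain x where "u = x @ v" by (auto simp: suffix_def)
  moreover have "cl (x @ v) w \<subseteq> cl v w" by (induction x) auto
  ultimately show ?thesis by simp
qed

lemma birth_mono: "good w \<Longrightarrow> suffix v u \<Longrightarrow> birth v w \<le> birth u w"
proof -
  assume g: "good w" and "suffix v u"
  then obtain x where "u = x @ v" by (auto simp: suffix_def)
  moreover have "birth v w \<le> birth (x @ v) w"
    using g by (induction x) (auto simp: good_def intro: order_trans add_increasing2)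
  ultimately show ?thesis by simp
qed

lemma birth_le_death: "good w \<Longrightarrow> birth v w \<le> death v w"
  by (simp add: good_def death_time_def)

lemma birth_Cons: "birth (b # v) w = death v w"
  by (simp add: death_time_def)

lemma death_mono: "good w \<Longrightarrow> suffix v u \<Longrightarrow> death v w \<le> death u w"
proof -
  assume g: "good w" and s: "suffix v u"
  then obtain x where x: "u = x @ v" by (auto simp: suffix_def)
  show ?thesis
  proof (cases x rule: rev_cases)
    case Nil then show ?thesis using x by simp
  next
    case (snoc y b)
    then have "suffix (b # v) u" using x by (simp add: suffix_def)
    from birth_mono[OF g this] have "death v w \<le> birth u w" by (simp only: birth_Cons)
    then show ?thesis using birth_le_death[OF g, of u] by linarith
  qed
qed

lemma strict_suffix_obtain:
  assumes "suffix u v" "u \<noteq> v"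
  obtains b where "suffix (b # u) v"
proof -
  obtain x where x: "v = x @ u" using assms by (auto simp: suffix_def)
  with assms(2) have "x \<noteq> []" by auto
  then obtain y b where "x = y @ [b]" by (cases x rule: rev_cases) auto
  then show thesis using that[of b] x by (simp add: suffix_def)
qed

lemma cl_subset_half_space: "suffix (b # u) v \<Longrightarrow> cl v w \<subseteq> half_space \<nu> b (H u w)"
  using cl_antimono[of "b # u" v w] by auto

lemma interior_cl_miss_ancestor:
  assumes g: "good w" and s: "suffix (b # u) v"
  shows "interior (cl v w) \<inter> H u w = {}"
  using interior_mono[OF cl_subset_half_space[OF s, of w]] interior_half_space[OF orient H_hyperplane[OF g], of b u]
  by auto

lemma interior_cl_miss_incomparable:
  assumes g: "good w" and s: "\<not> suffix v u" "\<not> suffix u v"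
  shows "interior (cl v w) \<inter> cl u w = {}"
proof -
  obtain u' b where u': "suffix (b # u') v" "suffix ((\<not> b) # u') u" using incomparable_suffixes[OF s] .
  have "interior (cl v w) \<inter> cl u w \<subseteq> half_space \<nu> b (H u' w) \<inter> half_space \<nu> (\<not> b) (H u' w)"
    using cl_subset_half_space[OF u'(1), of w] cl_subset_half_space[OF u'(2), of w] interior_subset by blast
  also have "\<dots> \<subseteq> H u' w" by (rule half_space_Int_subset[OF orient H_hyperplane[OF g]])
  finally show ?thesis using interior_cl_miss_ancestor[OF g u'(1)] by blast
qed

text \<open>A division can cut the interior of \<open>cl v w\<close> only if it happens at
  \<open>v\<close> or below: a proper ancestor leaves this cell on one side of its hyperplane, and
  an incomparable cell is separated from it.\<close>

lemma interior_cl_miss_division: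
  assumes g: "good w" and s: "\<not> suffix v u"
  shows "interior (cl v w) \<inter> (H u w \<inter> cl u w) = {}"
proof (cases "suffix u v")
  case True
  moreover have "u \<noteq> v" using s by auto
  ultimately obtain b where "suffix (b # u) v" by (rule strict_suffix_obtain)
  then show ?thesis using interior_cl_miss_ancestor[OF g] by blast
next
  case False
  then show ?thesis using interior_cl_miss_incomparable[OF g s] by blast
qed

lemma alive_descendant:
  assumes g: "good w" and x: "x \<in> cl v w" and b: "birth v w \<le> t"
  obtains u where "suffix v u" "x \<in> cl u w" "birth u w \<le> t" "t < death u w"
proof -
  from g obtain n where n: "\<And>v. length v = n \<Longrightarrow> t < birth v w" unfolding good_def by blast
  have long: "t < birth v w" if "n \<le> length v" for v
  proof -
    have "length (drop (length v - n) v) = n" using that by simp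
    from n[OF this] show ?thesis using birth_mono[OF g suffix_drop] by (rule less_le_trans)
  qed
  \<comment> \<open>The number \<open>k\<close> bounds the generations that remain before generation
    \<open>n\<close>, from which on every node is born after \<open>t\<close>. The descent always
    moves to a daughter containing \<open>x\<close>.\<close>
  have "\<exists>u. suffix v u \<and> x \<in> cl u w \<and> birth u w \<le> t \<and> t < death u w"
    if "n \<le> length v + k" "x \<in> cl v w" "birth v w \<le> t" for k v
    using that
  proof (induction k arbitrary: v)
    case 0
    then show ?case using long[of v] by simp
  next
    case (Suc k)
    show ?case
    proof (cases "t < death v w")
      case True then show ?thesis using Suc.prems by blast
    next
      case False
      obtain b where "x \<in> half_space \<nu> b (H v w)" using half_space_Un[OF orient H_hyperplane[OF g]] by blast
      then have "x \<in> cl (b # v) w" using Suc.prems by simp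
      moreover have "birth (b # v) w \<le> t" using False by (simp only: birth_Cons)
      ultimately obtain u where "suffix (b # v) u" "x \<in> cl u w" "birth u w \<le> t" "t < death u w"
        using Suc.IH[of "b # v"] Suc.prems(1) by auto
      then show ?thesis by (metis suffix_ConsD)
    qed
  qed
  from this[of v n] show thesis using that x b by auto
qed

lemma interior_clI:
  assumes g: "good w" and "x \<in> cl u' w" "x \<in> interior W" "\<And>b u. suffix (b # u) u' \<Longrightarrow> x \<notin> H u w"
  shows "x \<in> interior (cl u' w)"
  using assms(2-)
proof (induction u')
  case (Cons b u')
  have "x \<in> interior (cl u' w)" by (rule Cons.IH) (use Cons.prems in \<open>auto simp: suffix_Cons\<close>)
  moreover have "x \<in> interior (half_space \<nu> b (H u' w))"
    using Cons.prems(1) Cons.prems(3)[of b u'] by (simp add: interior_half_space[OF orient H_hyperplane[OF g]])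
  ultimately show ?case by simp
qed simp

text \<open>Inside the window the boundary consists of the pieces inserted up to time
  \<open>t\<close>. A frontier point of a living cell lies on the hyperplane of an ancestor.
  Conversely, a point of an inserted piece belongs to some living cell below, but that cell stays on
  one side of the hyperplane, so the point is never interior to it.\<close>

lemma boundary_cells_alive:
  assumes g: "good w" and x: "x \<in> interior W"
  shows "x \<in> boundary (living t w) \<longleftrightarrow> (\<exists>u. death u w \<le> t \<and> x \<in> H u w \<inter> cl u w)"
proof
  assume "x \<in> boundary (living t w)"
  then obtain u' where u': "birth u' w \<le> t" "x \<in> frontier (cl u' w)"
    by (auto simp: boundary_def cells_alive_def)
  have xw: "x \<in> cl u' w" "x \<notin> interior (cl u' w)"
    using u'(2) cl_closed'[OF g, of u'] by (auto simp: frontier_def)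
  then obtain b u where u: "suffix (b # u) u'" "x \<in> H u w" using interior_clI[OF g _ x] by blast
  have "death u w \<le> birth u' w" using birth_mono[OF g u(1)] by (simp only: birth_Cons)
  moreover have "x \<in> cl u w" using cl_antimono[OF suffix_ConsD[OF u(1)]] xw(1) by auto
  ultimately show "\<exists>u. death u w \<le> t \<and> x \<in> H u w \<inter> cl u w" using u(2) u'(1) by (auto intro!: exI[of _ u])
next
  assume "\<exists>u. death u w \<le> t \<and> x \<in> H u w \<inter> cl u w"
  then obtain u where u: "death u w \<le> t" "x \<in> H u w" "x \<in> cl u w" by auto
  have "x \<in> cl (True # u) w"
    using u hyperplane_subset_half_space[OF orient H_hyperplane[OF g], of u True] by auto
  moreover have "birth (True # u) w \<le> t" using u(1) by (simp only: birth_Cons)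
  ultimately obtain u' where u': "suffix (True # u) u'" "x \<in> cl u' w" "birth u' w \<le> t" "t < death u' w"
    using alive_descendant[OF g] by blast
  have "x \<notin> interior (cl u' w)" using interior_cl_miss_ancestor[OF g u'(1)] u(2) by blast
  then have "x \<in> frontier (cl u' w)" using u'(2) closure_subset by (auto simp: frontier_def)
  then show "x \<in> boundary (living t w)"
    using u'(3,4) by (auto simp: boundary_def cells_alive_def)
qed

lemma boundary_cells_alive_miss:
  assumes g: "good w" and K: "K \<subseteq> interior W"
  shows "boundary (living t w) \<inter> K = {} \<longleftrightarrow> (\<forall>u. death u w \<le> t \<longrightarrow> H u w \<inter> cl u w \<inter> K = {})"
  using boundary_cells_alive[OF g] K by blast

text \<open>Stopping the recursion at a node that dies after \<open>t\<close> loses nothing, since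
  its descendants die no earlier.\<close>

lemma missed_iff:
  assumes g: "good w"
  shows "(\<forall>n. missed K t n v w) \<longleftrightarrow> (\<forall>u. suffix v u \<longrightarrow> death u w \<le> t \<longrightarrow> H u w \<inter> cl u w \<inter> K = {})"
proof
  assume m: "\<forall>n. missed K t n v w"
  have "H (x @ v) w \<inter> cl (x @ v) w \<inter> K = {}"
    if "missed K t (Suc (length x)) v w" "death (x @ v) w \<le> t" for x v
    using that
  proof (induction x arbitrary: v rule: rev_induct)
    case (snoc b x)
    have "suffix v ((x @ [b]) @ v)" by (simp add: suffix_def)
    from death_mono[OF g this] have "\<not> t < death v w" using snoc.prems(2) by simp
    then have "missed K t (Suc (length x)) (b # v) w" using snoc.prems(1) by (cases b) auto
    then show ?case using snoc.IH[of "b # v"] snoc.prems(2) by simp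
  qed auto
  then show "\<forall>u. suffix v u \<longrightarrow> death u w \<le> t \<longrightarrow> H u w \<inter> cl u w \<inter> K = {}"
    using m by (metis suffix_def)
next
  assume a: "\<forall>u. suffix v u \<longrightarrow> death u w \<le> t \<longrightarrow> H u w \<inter> cl u w \<inter> K = {}"
  have "missed K t n v w" if "\<forall>u. suffix v u \<longrightarrow> death u w \<le> t \<longrightarrow> H u w \<inter> cl u w \<inter> K = {}" for n v
    using that
  proof (induction n arbitrary: v)
    case (Suc n)
    have "missed K t n (b # v) w" for b by (rule Suc.IH) (metis Suc.prems suffix_ConsD)
    moreover have "t < death v w \<or> H v w \<inter> cl v w \<inter> K = {}"
      using Suc.prems[rule_format, of v] by (cases "t < death v w") auto
    ultimately show ?case by simp
  qed simp
  then show "\<forall>n. missed K t n v w" using a by blast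
qed

text \<open>The event depends on the subtree of \<open>v\<close> alone, because no other division
  reaches the interior of its cell.\<close>

lemma miss_inside_cell:
  assumes g: "good w" and K: "K \<subseteq> interior (cl v w)"
  shows "boundary (living t w) \<inter> K = {} \<longleftrightarrow> (\<forall>n. missed K t n v w)"
proof -
  have "K \<subseteq> interior W" using K interior_mono[OF cl_subset] by blast
  moreover have "H u w \<inter> cl u w \<inter> K = {}" if "\<not> suffix v u" for u
    using interior_cl_miss_division[OF g that] K by blast
  ultimately show ?thesis unfolding boundary_cells_alive_miss[OF g \<open>K \<subseteq> interior W\<close>] missed_iff[OF g] by blast
qed

text \<open>The divisions in the subtree of \<open>v\<close> stay inside its cell, so this event is
  measurable for \<open>outside v\<close>. With the preceding lemma it separates what happens near
  \<open>K\<close> from what happens near a set far away.\<close>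

lemma miss_outside_cell:
  assumes g: "good w" and K: "K \<subseteq> interior W" "K \<inter> cl v w = {}"
  shows "boundary (living t w) \<inter> K = {} \<longleftrightarrow>
    (\<forall>u. \<not> suffix v u \<longrightarrow> death u w \<le> t \<longrightarrow> H u w \<inter> cl u w \<inter> K = {})"
proof -
  have "H u w \<inter> cl u w \<inter> K = {}" if "suffix v u" for u
    using cl_antimono[OF that, of w] K by blast
  then show ?thesis unfolding boundary_cells_alive_miss[OF g K(1)] by blast
qed

lemma interior_alive_cell_miss:
  assumes g: "good w" and a: "s < death v w"
  shows "boundary (living s w) \<inter> interior (cl v w) = {}"
proof -
  have K: "interior (cl v w) \<subseteq> interior W" by (rule interior_mono[OF cl_subset])
  have "H u w \<inter> cl u w \<inter> interior (cl v w) = {}" if "death u w \<le> s" for u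
  proof -
    have "\<not> suffix v u" using death_mono[OF g, of v u] a that by force
    then show ?thesis using interior_cl_miss_division[OF g] by blast
  qed
  then show ?thesis unfolding boundary_cells_alive_miss[OF g K] by blast
qed

end

section \<open>Factorization over the enclosing cell\<close>

text \<open>For suitable \<open>A\<close>, \<open>D\<close> and \<open>x\<close>, this says in terms of the boundary alone that a single cell contains
  \<open>A\<close> and does not reach \<open>D\<close>.\<close>

definition enclosed :: "'a::euclidean_space set \<Rightarrow> 'a set \<Rightarrow> 'a \<Rightarrow> 'a set set \<Rightarrow> bool" where
  "enclosed A D x T \<longleftrightarrow> boundary T \<inter> A = {} \<and> (\<forall>q\<in>D. boundary T \<inter> closed_segment x q \<noteq> {})"

section \<open>Unbounded depth, and the factorization for a single node\<close>

context cell_process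
begin

lemma missed_antimono: "missed K t (Suc n) v w \<Longrightarrow> missed K t n v w"
proof (induction n arbitrary: v)
  case (Suc n)
  from Suc.prems have "t < death v w \<or> (H v w \<inter> cl v w \<inter> K = {} \<and>
      missed K t (Suc n) (True # v) w \<and> missed K t (Suc n) (False # v) w)"
    by (simp only: missed.simps(2)[of K t "Suc n"])
  then show ?case
    using Suc.IH[of "True # v"] Suc.IH[of "False # v"] unfolding missed.simps(2)[of K t n] by blast
qed simp

lemma missed_decreasing: "m \<le> n \<Longrightarrow> missed K t n v w \<Longrightarrow> missed K t m v w"
  by (induction n rule: dec_induct) (auto dest: missed_antimono simp del: missed.simps)

lemma missed_tendsto:
  "(\<lambda>n. (if missed K t (Suc n) v w then 1 else 0 :: ennreal)) \<longlonglongrightarrow> (if \<forall>n. missed K t n v w then 1 else 0)"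
proof (cases "\<forall>n. missed K t n v w")
  case True
  then show ?thesis by (simp del: missed.simps)
next
  case False
  then obtain m where m: "\<not> missed K t m v w" by blast
  have "\<not> missed K t (Suc n) v w" if "m \<le> n" for n
    using missed_decreasing[of m "Suc n"] m that by (meson le_SucI)
  then have "eventually (\<lambda>n. (if missed K t (Suc n) v w then 1 else 0 :: ennreal) = 0) sequentially"
    unfolding eventually_sequentially by (intro exI[of _ m]) (simp del: missed.simps)
  then have "(\<lambda>n. (if missed K t (Suc n) v w then 1 else 0 :: ennreal)) \<longlonglongrightarrow> 0"
    by (rule tendsto_eventually)
  then show ?thesis using False by (simp only: if_False)
qed

lemma missed_measurable: "compact K \<Longrightarrow> Measurable.pred N (missed K t n v)"
  by (rule missed_known[OF _ known_N])

lemma miss_prob_tendsto: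
  "closed C \<Longrightarrow> (\<lambda>n. miss_prob \<nu> K (Suc n) (C, r)) \<longlonglongrightarrow> (INF n. miss_prob \<nu> K n (C, r))"
proof -
  assume C: "closed C"
  have "(\<lambda>n. miss_prob \<nu> K n (C, r)) \<longlonglongrightarrow> (INF n. miss_prob \<nu> K n (C, r))"
    by (intro LIMSEQ_INF decseq_SucI miss_prob_Suc_le orient C)
  then show ?thesis by (rule LIMSEQ_Suc)
qed

lemma miss_prob_root:
  assumes K: "compact K"
  shows "emeasure N {w \<in> space N. \<forall>n. missed K t n [] w} = (INF n. miss_prob \<nu> K n (W, t))"
proof -
  have mm [measurable]: "Measurable.pred N (missed K t n [])" for n by (rule missed_measurable[OF K])
  have "(\<lambda>n. (\<integral>\<^sup>+w. (if missed K t (Suc n) [] w then 1 else 0) \<partial>N)) \<longlonglongrightarrow>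
      (\<integral>\<^sup>+w. (if \<forall>n. missed K t n [] w then 1 else 0) \<partial>N)"
  proof (rule nn_integral_dominated_convergence[where w = "\<lambda>_. 1"])
    show "(\<lambda>w. if missed K t (Suc n) [] w then 1 else 0 :: ennreal) \<in> borel_measurable N" for n
      using mm[of "Suc n"] by (intro measurable_If) simp_all
    show "(\<lambda>w. if \<forall>n. missed K t n [] w then 1 else 0 :: ennreal) \<in> borel_measurable N"
      using mm by measurable
  qed (auto simp: emeasure_space_1 missed_tendsto simp del: missed.simps)
  moreover have "(\<integral>\<^sup>+w. (if missed K t (Suc n) [] w then 1 else 0) \<partial>N) = miss_prob \<nu> K (Suc n) (W, t)" for n
    using missed_integral[OF K, of "\<lambda>_. 1" "[]" t "Suc n"] by (simp add: emeasure_space_1 del: missed.simps miss_prob.simps)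
  ultimately have "(INF n. miss_prob \<nu> K n (W, t)) = (\<integral>\<^sup>+w. (if \<forall>n. missed K t n [] w then 1 else 0) \<partial>N)"
    using miss_prob_tendsto[OF W, of K t] LIMSEQ_unique by (simp del: missed.simps miss_prob.simps)
  also have "\<dots> = (\<integral>\<^sup>+w. indicator {w \<in> space N. \<forall>n. missed K t n [] w} w \<partial>N)"
    by (intro nn_integral_cong) (simp add: indicator_def del: missed.simps)
  also have "\<dots> = emeasure N {w \<in> space N. \<forall>n. missed K t n [] w}"
    using mm by (intro nn_integral_indicator) measurable
  finally show ?thesis by simp
qed

text \<open>The information \<open>B\<close> from outside the subtree enters as a weight, and the
  limit of \<open>miss_prob\<close> is the constant \<open>q\<close> wherever \<open>B\<close>
  holds. Dominated convergence carries \<open>missed_alive\<close> to infinite depth.\<close>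

lemma alive_prob:
  assumes K: "compact K" and B: "Measurable.pred (outside v) B"
    and q: "\<And>w. w \<in> space N \<Longrightarrow> B w \<Longrightarrow> (INF n. miss_prob \<nu> K n (cl v w, t - s)) = q"
    and total: "\<And>w. w \<in> space N \<Longrightarrow> B w \<Longrightarrow> (\<integral>\<^sup>+z. 1 \<partial>division_law \<Lambda> (cl v w)) = 1"
  shows "emeasure N {w \<in> space N. B w \<and> birth v w \<le> s \<and> s < death v w \<and> (\<forall>n. missed K t n v w)} =
    q * emeasure N {w \<in> space N. B w \<and> birth v w \<le> s \<and> s < death v w}"
proof -
  define Z where "Z w = (if B w then 1 else 0 :: ennreal)" for w
  have Z: "Z \<in> borel_measurable (outside v)" unfolding Z_def using B by measurable
  have BN [measurable]: "Measurable.pred N B" by (rule outside_measurable_N[OF B])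
  have bm [measurable]: "birth v \<in> borel_measurable N" by (rule outside_measurable_N[OF birth_outside])
  have dm [measurable]: "death v \<in> borel_measurable N" unfolding death_time_def by measurable
  have rm [measurable]: "(\<lambda>w. rate (cl v w)) \<in> borel_measurable N"
    by (rule measurable_compose[OF outside_measurable_N[OF cell_outside] rate_measurable])
  have mm [measurable]: "Measurable.pred N (missed K t n v)" for n by (rule missed_measurable[OF K])
  define alive where "alive w = (if birth v w \<le> s \<and> s < death v w then 1 else 0 :: ennreal)" for w
  have am [measurable]: "alive \<in> borel_measurable N" unfolding alive_def by measurable
  have ZN [measurable]: "Z \<in> borel_measurable N" by (rule outside_measurable_N[OF Z])
  define D where "D w = Z w * (if birth v w \<le> s then 1 else 0) * ennreal (exp (- rate (cl v w) * (s - birth v w)))" for w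
  have Dm [measurable]: "D \<in> borel_measurable N" unfolding D_def by measurable
  have D1: "D w \<le> 1" for w
    by (auto simp: D_def Z_def mult_nonneg_nonneg)
  have mp [measurable]: "(\<lambda>w. miss_prob \<nu> K' n (cl v w, t - s)) \<in> borel_measurable N" if "compact K'" for n K'
    by (rule measurable_compose[OF measurable_Pair miss_prob_measurable[OF orient that]])
      (intro outside_measurable_N[OF cell_outside] measurable_const; simp)+
  have eq: "(\<integral>\<^sup>+w. Z w * alive w * (if missed K' t (Suc n) v w then 1 else 0) \<partial>N) =
      (\<integral>\<^sup>+w. D w * miss_prob \<nu> K' (Suc n) (cl v w, t - s) \<partial>N)" if "compact K'" for K' n
    unfolding alive_def D_def by (rule missed_alive[OF that Z])
  have "(\<lambda>n. (\<integral>\<^sup>+w. Z w * alive w * (if missed K t (Suc n) v w then 1 else 0) \<partial>N)) \<longlonglongrightarrow>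
    (\<integral>\<^sup>+w. Z w * alive w * (if \<forall>n. missed K t n v w then 1 else 0) \<partial>N)"
  proof (rule nn_integral_dominated_convergence[where w = "\<lambda>_. 1"])
    show "(\<lambda>w. Z w * alive w * (if missed K t (Suc n) v w then 1 else 0)) \<in> borel_measurable N" for n
      using mm[of "Suc n"] by (intro borel_measurable_times_ennreal measurable_If ZN am) simp_all
    show "(\<lambda>w. Z w * alive w * (if \<forall>n. missed K t n v w then 1 else 0)) \<in> borel_measurable N"
      using mm by measurable
    show "AE w in N. (\<lambda>n. Z w * alive w * (if missed K t (Suc n) v w then 1 else 0)) \<longlonglongrightarrow>
        Z w * alive w * (if \<forall>n. missed K t n v w then 1 else 0)"
      by (intro AE_I2 ennreal_tendsto_cmult missed_tendsto) (simp add: Z_def alive_def)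
  qed (auto simp: emeasure_space_1 Z_def alive_def simp del: missed.simps)
  moreover have "(\<lambda>n. (\<integral>\<^sup>+w. D w * miss_prob \<nu> K (Suc n) (cl v w, t - s) \<partial>N)) \<longlonglongrightarrow> (\<integral>\<^sup>+w. q * D w \<partial>N)"
  proof (rule nn_integral_dominated_convergence[where w = "\<lambda>_. 1"])
    show "(\<lambda>w. D w * miss_prob \<nu> K (Suc n) (cl v w, t - s)) \<in> borel_measurable N" for n
      by (intro borel_measurable_times_ennreal Dm mp K)
    show "AE w in N. D w * miss_prob \<nu> K (Suc n) (cl v w, t - s) \<le> 1" for n
    proof (rule AE_I2)
      fix w assume w: "w \<in> space N"
      have "D w * miss_prob \<nu> K (Suc n) (cl v w, t - s) \<le> 1 * 1"
        by (intro mult_mono D1 miss_prob_le_1 orient cl_closed w) simp_all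
      then show "D w * miss_prob \<nu> K (Suc n) (cl v w, t - s) \<le> 1" by simp
    qed
    show "AE w in N. (\<lambda>n. D w * miss_prob \<nu> K (Suc n) (cl v w, t - s)) \<longlonglongrightarrow> q * D w"
    proof (rule AE_I2)
      fix w assume w: "w \<in> space N"
      have "(\<lambda>n. D w * miss_prob \<nu> K (Suc n) (cl v w, t - s)) \<longlonglongrightarrow> D w * (INF n. miss_prob \<nu> K n (cl v w, t - s))"
        using le_less_trans[OF D1[of w] ennreal_one_less_top]
        by (intro ennreal_tendsto_cmult miss_prob_tendsto cl_closed w)
      moreover have "D w * (INF n. miss_prob \<nu> K n (cl v w, t - s)) = q * D w"
      proof (cases "B w")
        case True
        then show ?thesis using q[OF w] by (simp add: mult.commute)
      next
        case False
        then show ?thesis by (simp add: D_def Z_def)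
      qed
      ultimately show "(\<lambda>n. D w * miss_prob \<nu> K (Suc n) (cl v w, t - s)) \<longlonglongrightarrow> q * D w" by simp
    qed
  qed (auto simp: emeasure_space_1)
  ultimately have "(\<integral>\<^sup>+w. Z w * alive w * (if \<forall>n. missed K t n v w then 1 else 0) \<partial>N) = (\<integral>\<^sup>+w. q * D w \<partial>N)"
    unfolding eq[OF K] by (rule LIMSEQ_unique)
  also have "\<dots> = q * (\<integral>\<^sup>+w. D w \<partial>N)" by (rule nn_integral_cmult[OF Dm])
  \<comment> \<open>The survival weight \<open>D\<close> need not be evaluated. For an empty compact
    set and depth 1 the miss probability is the mass of the division law, that is 1 on
    \<open>B\<close>; so the same identity read backwards turns the integral of \<open>D\<close>
    into the probability that \<open>B\<close> holds and \<open>v\<close> is alive.\<close>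
  also have "(\<integral>\<^sup>+w. D w \<partial>N) = (\<integral>\<^sup>+w. D w * miss_prob \<nu> {} (Suc 0) (cl v w, t - s) \<partial>N)"
  proof (rule nn_integral_cong)
    fix w assume w: "w \<in> space N"
    have "miss_step \<nu> {} (\<lambda>_. 1) ((cl v w, t - s), z) = 1" for z by (cases z) (simp add: miss_step_def)
    then have "miss_prob \<nu> {} (Suc 0) (cl v w, t - s) = (\<integral>\<^sup>+z. 1 \<partial>division_law \<Lambda> (cl v w))" by simp
    then show "D w = D w * miss_prob \<nu> {} (Suc 0) (cl v w, t - s)"
      using total[OF w] by (cases "B w") (simp_all add: D_def Z_def)
  qed
  also have "\<dots> = (\<integral>\<^sup>+w. Z w * alive w * (if missed {} t (Suc 0) v w then 1 else 0) \<partial>N)"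
    by (rule eq[symmetric]) simp
  also have "\<dots> = (\<integral>\<^sup>+w. Z w * alive w \<partial>N)" by simp
  also have "\<dots> = (\<integral>\<^sup>+w. indicator {w \<in> space N. B w \<and> birth v w \<le> s \<and> s < death v w} w \<partial>N)"
    by (intro nn_integral_cong) (simp add: Z_def alive_def indicator_def)
  also have "\<dots> = emeasure N {w \<in> space N. B w \<and> birth v w \<le> s \<and> s < death v w}"
    by (intro nn_integral_indicator) measurable
  finally have "(\<integral>\<^sup>+w. Z w * alive w * (if \<forall>n. missed K t n v w then 1 else 0) \<partial>N) =
    q * emeasure N {w \<in> space N. B w \<and> birth v w \<le> s \<and> s < death v w}" .
  moreover have "(\<integral>\<^sup>+w. Z w * alive w * (if \<forall>n. missed K t n v w then 1 else 0) \<partial>N) =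
    (\<integral>\<^sup>+w. indicator {w \<in> space N. B w \<and> birth v w \<le> s \<and> s < death v w \<and> (\<forall>n. missed K t n v w)} w \<partial>N)"
    by (intro nn_integral_cong) (simp add: Z_def alive_def indicator_def del: missed.simps)
  moreover have "\<dots> = emeasure N {w \<in> space N. B w \<and> birth v w \<le> s \<and> s < death v w \<and> (\<forall>n. missed K t n v w)}"
    using mm by (intro nn_integral_indicator) measurable
  ultimately show ?thesis by simp
qed

end

context window_process
begin

text \<open>If a living cell lies between \<open>R\<close> and \<open>V\<close>, each tested segment
  leaves it and crosses its frontier. Conversely, the cell of \<open>x\<close> contains the
  connected set \<open>interior R\<close>, which misses the boundary. If it left \<open>V\<close>,
  its interior would meet the open shell between \<open>V\<close> and \<open>interior V'\<close>,
  hence contain a point of \<open>Q\<close> there, and by convexity the segment to this point would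
  miss the boundary.\<close>

lemma enclosed_cells_alive:
  assumes g: "good w" and s: "0 \<le> s" and R: "window R" "x \<in> interior R" "R \<subseteq> V"
    and V: "closed V" "V \<subseteq> interior V'" "V' \<subseteq> W"
    and Q: "\<And>U. open U \<Longrightarrow> U \<noteq> {} \<Longrightarrow> \<exists>q\<in>Q. q \<in> U"
  shows "enclosed (interior R) (Q \<inter> (interior V' - V)) x (living s w) \<longleftrightarrow>
    (\<exists>v. birth v w \<le> s \<and> s < death v w \<and> R \<subseteq> cl v w \<and> cl v w \<subseteq> V)"
proof
  let ?T = "living s w"
  assume "\<exists>v. birth v w \<le> s \<and> s < death v w \<and> R \<subseteq> cl v w \<and> cl v w \<subseteq> V"
  then obtain v where v: "birth v w \<le> s" "s < death v w" "R \<subseteq> cl v w" "cl v w \<subseteq> V" by blast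
  have fr: "frontier (cl v w) \<subseteq> boundary ?T" using v(1,2) by (auto simp: boundary_def cells_alive_def)
  have "boundary ?T \<inter> interior R = {}"
    using interior_alive_cell_miss[OF g v(2)] interior_mono[OF v(3)] by blast
  moreover have "boundary ?T \<inter> closed_segment x q \<noteq> {}" if "q \<in> Q \<inter> (interior V' - V)" for q
  proof -
    have "x \<in> closed_segment x q \<inter> cl v w" "q \<in> closed_segment x q - cl v w"
      using R(2) v(3,4) that interior_subset by auto
    then have "closed_segment x q \<inter> frontier (cl v w) \<noteq> {}"
      using connected_Int_frontier[of "closed_segment x q" "cl v w"] by (metis connected_segment(1) empty_iff)
    then show ?thesis using fr by blast
  qed
  ultimately show "enclosed (interior R) (Q \<inter> (interior V' - V)) x ?T" by (simp add: enclosed_def)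
next
  let ?T = "living s w"
  assume e: "enclosed (interior R) (Q \<inter> (interior V' - V)) x ?T"
  have "interior V' \<subseteq> W" using V(3) interior_subset by blast
  moreover have "x \<in> R" using R(2) interior_subset by blast
  ultimately have "x \<in> cl [] w" using R(3) V(2) by auto
  then obtain v where v: "x \<in> cl v w" "birth v w \<le> s" "s < death v w"
    using alive_descendant[OF g, of x "[]" s] s by auto
  have fr: "frontier (cl v w) \<subseteq> boundary ?T" using v(2,3) by (auto simp: boundary_def cells_alive_def)
  have cR: "convex R" "closed R" using R(1) by (simp_all add: window_def polytope_imp_convex polytope_imp_closed)
  have "interior R \<inter> frontier (cl v w) = {}" using e fr by (auto simp: enclosed_def)
  moreover have "interior R \<inter> cl v w \<noteq> {}" using R(2) v(1) by blast
  ultimately have "interior R \<subseteq> cl v w"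
    using connected_Int_frontier[of "interior R" "cl v w"] convex_connected[OF convex_interior[OF cR(1)]] by blast
  then have "closure (interior R) \<subseteq> cl v w" by (rule closure_minimal) (rule cl_closed'[OF g])
  then have Rv: "R \<subseteq> cl v w"
    using convex_closure_interior[OF cR(1)] R(2) cR(2) by auto
  have xi: "x \<in> interior (cl v w)" using interior_mono[OF Rv] R(2) by blast
  have "cl v w \<subseteq> V"
  proof (rule ccontr)
    assume "\<not> cl v w \<subseteq> V"
    then obtain y where y: "y \<in> cl v w" "y \<in> - V" by blast
    have "closure (interior (cl v w)) = closure (cl v w)"
      using convex_closure_interior[OF cl_convex[OF g]] xi by auto
    then have "y \<in> closure (interior (cl v w))" using y(1) closure_subset by auto
    then have ne: "interior (cl v w) \<inter> - V \<noteq> {}"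
      using y(2) V(1) open_Int_closure_eq_empty[of "- V" "interior (cl v w)"] by (auto simp: Int_commute)
    have conn: "connected (interior (cl v w))" by (intro convex_connected convex_interior cl_convex g)
    have "interior (cl v w) \<inter> (interior V' - V) \<noteq> {}"
    proof
      assume emp: "interior (cl v w) \<inter> (interior V' - V) = {}"
      \<comment> \<open>These two open sets cover the space since \<open>V\<close> lies in
        \<open>interior V'\<close>, and they overlap exactly in the shell.\<close>
      have "interior V' \<inter> interior (cl v w) = {} \<or> - V \<inter> interior (cl v w) = {}"
        using conn by (rule connectedD) (use V emp in auto)
      moreover have "x \<in> interior V'" using R(2,3) V(2) interior_subset by blast
      ultimately show False using xi ne by blast
    qed
    moreover have "open (interior (cl v w) \<inter> (interior V' - V))" using V(1) by (intro open_Int open_Diff) auto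
    ultimately obtain q where q: "q \<in> Q" "q \<in> interior (cl v w)" "q \<in> interior V' - V" using Q by blast
    have "closed_segment x q \<subseteq> interior (cl v w)"
      using closed_segment_subset[OF xi q(2)] convex_interior[OF cl_convex[OF g]] by blast
    then show False using e q(1,3) interior_alive_cell_miss[OF g v(3)] unfolding enclosed_def by blast
  qed
  then show "\<exists>v. birth v w \<le> s \<and> s < death v w \<and> R \<subseteq> cl v w \<and> cl v w \<subseteq> V"
    using v(2,3) Rv by blast
qed

lemma alive_cell_unique:
  assumes g: "good w" and x: "x \<in> interior (cl v w)" "x \<in> cl u w"
    and a: "birth v w \<le> s" "s < death v w" "birth u w \<le> s" "s < death u w"
  shows "v = u"
proof (rule ccontr)
  assume ne: "v \<noteq> u"
  have *: False if ww: "suffix u' v'" "u' \<noteq> v'" and "s < death u' w" "birth v' w \<le> s" for u' v'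
  proof -
    obtain b where "suffix (b # u') v'" by (rule strict_suffix_obtain[OF ww])
    from birth_mono[OF g this] show False using that(3,4) unfolding birth_Cons by linarith
  qed
  consider "suffix u v" | "suffix v u" | "\<not> suffix v u" "\<not> suffix u v" by blast
  then show False
    using *[of u v] *[of v u] a ne interior_cl_miss_incomparable[OF g, of v u] x by cases auto
qed


text \<open>The cell is closed, so containment of \<open>R\<close> can be tested on a countable
  dense subset of \<open>R\<close>.\<close>

lemma pred_cell_between:
  assumes V: "closed V" and M: "cl v \<in> M \<rightarrow>\<^sub>M fell"
  shows "Measurable.pred M (\<lambda>w. R \<subseteq> cl v w \<and> cl v w \<subseteq> V)"
proof -
  obtain D where D: "countable D" "D \<subseteq> R" "R \<subseteq> closure D" using separable by blast
  have "Measurable.pred M (\<lambda>w. (\<forall>x\<in>D. x \<in> cl v w) \<and> cl v w \<inter> - V = {})"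
    by (intro pred_intros_logic pred_Ball_countable D(1) pred_fell_member M pred_fell_miss_open open_Compl V)
      simp
  moreover have "(\<forall>x\<in>D. x \<in> cl v w) \<and> cl v w \<inter> - V = {} \<longleftrightarrow> R \<subseteq> cl v w \<and> cl v w \<subseteq> V"
    if "w \<in> space M" for w
  proof -
    have "closed (cl v w)" using measurable_space[OF M that] by simp
    then have "R \<subseteq> cl v w" if "D \<subseteq> cl v w" using closure_minimal[OF that] D(3) by blast
    then show ?thesis using D(2) by blast
  qed
  ultimately show ?thesis by (rule measurable_cong[THEN iffD1, rotated])
qed

lemma pred_division_miss:
  assumes K: "compact K" and k: "\<And>u'. suffix u' u \<Longrightarrow> known M u'"
  shows "Measurable.pred M (\<lambda>w. death u w \<le> t \<longrightarrow> H u w \<inter> cl u w \<inter> K = {})"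
proof -
  have ku: "L u \<in> borel_measurable M" "H u \<in> M \<rightarrow>\<^sub>M \<Lambda>" using k[of u] by (auto simp: known_def)
  have ks: "known M u'" if "strict_suffix u' u" for u' using that by (intro k) (simp add: strict_suffix_def)
  have "Measurable.pred M (\<lambda>w. H u w \<inter> cl u w \<inter> K = {})"
    by (intro pred_fell_miss_compact K measurable_fell_Int measurable_compose[OF ku(2) id_fell] cell_known ks)
  moreover have "Measurable.pred M (\<lambda>w. \<not> t < death u w)"
    unfolding death_time_def by (intro pred_intros_logic(2) borel_measurable_pred_less borel_measurable_const
        borel_measurable_add birth_known ks ku(1))
  ultimately show ?thesis unfolding not_less by (intro pred_intros_logic(4))
qed

text \<open>The event is split according to the node whose cell encloses \<open>R\<close>; each
  summand contributes the same factor \<open>q\<close>. Measurability of \<open>X\<close> and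
  \<open>Z\<close> is a premise because they agree with the node events only up to a null set; it
  will be supplied by the equality of path laws.\<close>

lemma enclosed_factorization:
  assumes s: "0 \<le> s" and R: "window R" "x \<in> interior R" "R \<subseteq> V"
    and V: "closed V" "V \<subseteq> interior V'" "V' \<subseteq> W"
    and Q: "\<And>U. open U \<Longrightarrow> U \<noteq> {} \<Longrightarrow> \<exists>q\<in>Q. q \<in> U"
    and K: "compact K" "K \<subseteq> interior R" and K': "compact K'" "K' \<subseteq> interior W" "K' \<inter> V = {}"
    and q: "\<And>C. window C \<Longrightarrow> R \<subseteq> C \<Longrightarrow> (INF n. miss_prob \<nu> K n (C, t - s)) = q"
    and total: "\<And>C. window C \<Longrightarrow> R \<subseteq> C \<Longrightarrow> (\<integral>\<^sup>+z. 1 \<partial>division_law \<Lambda> C) = 1"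
    and X: "X = {w \<in> space N. enclosed (interior R) (Q \<inter> (interior V' - V)) x (living s w) \<and>
      boundary (living t w) \<inter> K' = {}}"
    and Z: "Z = {w \<in> X. boundary (living t w) \<inter> K = {}}"
    and meas: "X \<in> sets N" "Z \<in> sets N"
  shows "emeasure N Z = q * emeasure N X"
proof -
  obtain Nul where Nul: "{w \<in> space N. \<not> good w} \<subseteq> Nul" "emeasure N Nul = 0" "Nul \<in> sets N"
    using AE_good by (rule AE_E)
  have good: "good w" if "w \<in> space N" "w \<notin> Nul" for w using that Nul(1) by blast
  \<comment> \<open>What \<open>X\<close> says about node \<open>v\<close> apart from its being
    alive, written with marks outside its subtree: for a cell inside \<open>V\<close>, the divisions
    of this subtree cannot reach \<open>K'\<close>.\<close>
  define B where "B v w \<longleftrightarrow> (R \<subseteq> cl v w \<and> cl v w \<subseteq> V) \<and>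
    (\<forall>u\<in>{u. \<not> suffix v u}. death u w \<le> t \<longrightarrow> H u w \<inter> cl u w \<inter> K' = {})" for v w
  have B: "Measurable.pred (outside v) (B v)" for v
    unfolding B_def
  proof (rule pred_intros_logic(3)[OF pred_cell_between[OF V(1) cell_outside] pred_Ball_countable])
    fix u assume u: "u \<in> {u. \<not> suffix v u}"
    have "known (outside v) u'" if "suffix u' u" for u'
      using u that suffix_order.trans by (intro known_outside) blast
    then show "Measurable.pred (outside v) (\<lambda>w. death u w \<le> t \<longrightarrow> H u w \<inter> cl u w \<inter> K' = {})"
      by (rule pred_division_miss[OF K'(1)])
  qed (rule countableI_type)
  have win: "window (cl v w)" if "w \<in> space N" "B v w" for v w
    using that R(2) interior_mono[of R "cl v w"] cl_polytope_space[OF that(1)] by (auto simp: window_def B_def)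
  define S where "S v = {w \<in> space N. B v w \<and> birth v w \<le> s \<and> s < death v w}" for v
  define S' where "S' v = {w \<in> space N. B v w \<and> birth v w \<le> s \<and> s < death v w \<and> (\<forall>n. missed K t n v w)}" for v
  have bm [measurable]: "birth v \<in> borel_measurable N" for v by (rule outside_measurable_N[OF birth_outside])
  have dm [measurable]: "death v \<in> borel_measurable N" for v unfolding death_time_def by measurable
  have [measurable]: "Measurable.pred N (B v)" for v by (rule outside_measurable_N[OF B])
  have [measurable]: "Measurable.pred N (\<lambda>w. \<forall>n. missed K t n v w)" for v
    by (intro pred_intros_countable missed_measurable[OF K(1)])
  have Sm: "S v \<in> sets N" for v unfolding S_def by measurable
  have Sm': "S' v \<in> sets N" for v unfolding S'_def by measurable
  have prob: "emeasure N (S' v) = q * emeasure N (S v)" for v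
    unfolding S_def S'_def
  proof (rule alive_prob[OF K(1) B])
    fix w assume w: "w \<in> space N" "B v w"
    then have "R \<subseteq> cl v w" by (simp add: B_def)
    from q[OF win[OF w] this] total[OF win[OF w] this]
    show "(INF n. miss_prob \<nu> K n (cl v w, t - s)) = q" "(\<integral>\<^sup>+z. 1 \<partial>division_law \<Lambda> (cl v w)) = 1" .
  qed
  have x_in: "x \<in> interior (cl v w)" if "B v w" for v w
    using that R(2) interior_mono[of R "cl v w"] by (auto simp: B_def)
  \<comment> \<open>On good paths only one living cell has \<open>x\<close> in its interior, so at
    most one node encloses \<open>R\<close>.\<close>
  have disj: "disjoint_family (\<lambda>v. S v - Nul)"
    unfolding disjoint_family_on_def
  proof (intro ballI impI)
    fix v u :: "bool list" assume "v \<noteq> u"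
    have False if "w \<in> (S v - Nul) \<inter> (S u - Nul)" for w
    proof -
      have "good w" "B v w" "B u w" "birth v w \<le> s" "s < death v w" "birth u w \<le> s" "s < death u w"
        using that good by (auto simp: S_def)
      then have "v = u" using x_in interior_subset by (intro alive_cell_unique[of w x v u s]) auto
      then show False using \<open>v \<noteq> u\<close> by simp
    qed
    then show "(S v - Nul) \<inter> (S u - Nul) = {}" by blast
  qed
  have disj': "disjoint_family (\<lambda>v. S' v - Nul)"
    using disj by (rule disjoint_family_on_bisimulation) (auto simp: S_def S'_def)
  have X_iff: "w \<in> X \<longleftrightarrow> (\<exists>v. w \<in> S v)" if w: "w \<in> space N" "w \<notin> Nul" for w
  proof -
    note g = good[OF w]
    have miss: "boundary (living t w) \<inter> K' = {} \<longleftrightarrow>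
        (\<forall>u\<in>{u. \<not> suffix v u}. death u w \<le> t \<longrightarrow> H u w \<inter> cl u w \<inter> K' = {})" if "cl v w \<subseteq> V" for v
    proof -
      have "K' \<inter> cl v w = {}" using K'(3) that by blast
      from miss_outside_cell[OF g K'(2) this] show ?thesis by simp
    qed
    have Sv: "w \<in> S v \<longleftrightarrow> (birth v w \<le> s \<and> s < death v w \<and> R \<subseteq> cl v w \<and> cl v w \<subseteq> V) \<and>
        boundary (living t w) \<inter> K' = {}" for v
    proof (cases "cl v w \<subseteq> V")
      case True
      then show ?thesis unfolding miss[OF True] S_def B_def using w(1) by blast
    next
      case False
      then show ?thesis unfolding S_def B_def by blast
    qed
    have "w \<in> X \<longleftrightarrow> enclosed (interior R) (Q \<inter> (interior V' - V)) x (living s w) \<and>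
        boundary (living t w) \<inter> K' = {}"
      unfolding X using w(1) by simp
    also have "enclosed (interior R) (Q \<inter> (interior V' - V)) x (living s w) \<longleftrightarrow>
        (\<exists>v. birth v w \<le> s \<and> s < death v w \<and> R \<subseteq> cl v w \<and> cl v w \<subseteq> V)"
      by (rule enclosed_cells_alive[OF g s R V]) (rule Q)
    also have "\<dots> \<and> boundary (living t w) \<inter> K' = {} \<longleftrightarrow> (\<exists>v. w \<in> S v)"
      unfolding Sv by (rule ex_simps(1)[symmetric])
    finally show ?thesis .
  qed
  have Z_iff: "w \<in> Z \<longleftrightarrow> (\<exists>v. w \<in> S' v)" if w: "w \<in> space N" "w \<notin> Nul" for w
  proof -
    note g = good[OF w]
    have "boundary (living t w) \<inter> K = {} \<longleftrightarrow> (\<forall>n. missed K t n v w)" if "w \<in> S v" for v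
    proof (rule miss_inside_cell[OF g])
      have "interior R \<subseteq> interior (cl v w)" using that by (intro interior_mono) (auto simp: S_def B_def)
      then show "K \<subseteq> interior (cl v w)" using K(2) by blast
    qed
    moreover have "w \<in> S' v \<longleftrightarrow> w \<in> S v \<and> (\<forall>n. missed K t n v w)" for v
      unfolding S_def S'_def by blast
    ultimately have S'v: "w \<in> S' v \<longleftrightarrow> w \<in> S v \<and> boundary (living t w) \<inter> K = {}" for v
      by (cases "w \<in> S v") simp_all
    show ?thesis unfolding Z mem_Collect_eq X_iff[OF w] S'v by (rule ex_simps(1)[symmetric])
  qed
  have cover: "A - Nul = (\<Union>v. F v - Nul)"
    if "A \<subseteq> space N" "\<And>v. F v \<subseteq> space N"
      "\<And>w. w \<in> space N \<Longrightarrow> w \<notin> Nul \<Longrightarrow> w \<in> A \<longleftrightarrow> (\<exists>v. w \<in> F v)"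
    for A and F :: "bool list \<Rightarrow> 'w set"
  proof (rule set_eqI)
    fix w
    show "w \<in> A - Nul \<longleftrightarrow> w \<in> (\<Union>v. F v - Nul)"
    proof (cases "w \<in> space N \<and> w \<notin> Nul")
      case True
      then show ?thesis using that(3)[of w] by simp
    next
      case False
      then have "w \<notin> A - Nul" "w \<notin> F v - Nul" for v using that(1) that(2)[of v] by blast+
      then show ?thesis unfolding UN_iff by blast
    qed
  qed
  have XS: "X - Nul = (\<Union>v. S v - Nul)"
    by (rule cover[OF sets.sets_into_space[OF meas(1)] sets.sets_into_space[OF Sm] X_iff])
  have ZS: "Z - Nul = (\<Union>v. S' v - Nul)"
    by (rule cover[OF sets.sets_into_space[OF meas(2)] sets.sets_into_space[OF Sm'] Z_iff])
  have null: "Nul \<in> null_sets N" using Nul by auto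
  have "emeasure N Z = emeasure N (\<Union>v. S' v - Nul)"
    using emeasure_Diff_null_set[OF null meas(2)] ZS by simp
  also have "\<dots> = (\<integral>\<^sup>+v. emeasure N (S' v - Nul) \<partial>count_space UNIV)"
    using Sm' Nul(3) disj' by (intro emeasure_UN_countable) auto
  also have "\<dots> = (\<integral>\<^sup>+v. q * emeasure N (S v - Nul) \<partial>count_space UNIV)"
    by (intro nn_integral_cong) (simp add: emeasure_Diff_null_set[OF null Sm'] emeasure_Diff_null_set[OF null Sm] prob)
  also have "\<dots> = q * (\<integral>\<^sup>+v. emeasure N (S v - Nul) \<partial>count_space UNIV)"
    by (intro nn_integral_cmult) simp
  also have "(\<integral>\<^sup>+v. emeasure N (S v - Nul) \<partial>count_space UNIV) = emeasure N (\<Union>v. S v - Nul)"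
    using Sm Nul(3) disj by (intro emeasure_UN_countable[symmetric]) auto
  also have "\<dots> = emeasure N X" using emeasure_Diff_null_set[OF null meas(1)] XS by simp
  finally show ?thesis .
qed

lemma root_boundary_prob:
  assumes K: "compact K" "K \<subseteq> interior W"
    and meas: "{w \<in> space N. boundary (living t w) \<inter> K = {}} \<in> sets N"
  shows "emeasure N {w \<in> space N. boundary (living t w) \<inter> K = {}} = (INF n. miss_prob \<nu> K n (W, t))"
  unfolding miss_prob_root[OF K(1), symmetric]
proof (rule emeasure_eq_AE)
  have "Measurable.pred N (\<lambda>w. \<forall>n. missed K t n [] w)"
    by (intro pred_intros_countable missed_measurable[OF K(1)])
  then show "{w \<in> space N. \<forall>n. missed K t n [] w} \<in> sets N" by (simp only: pred_def)
  show "AE w in N. (w \<in> {w \<in> space N. boundary (living t w) \<inter> K = {}}) =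
      (w \<in> {w \<in> space N. \<forall>n. missed K t n [] w})"
    using AE_good
  proof eventually_elim
    case (elim w)
    have "boundary (living t w) \<inter> K = {} \<longleftrightarrow> (\<forall>n. missed K t n [] w)"
      using K(2) by (intro miss_inside_cell[OF elim]) simp
    then show ?case by simp
  qed
qed (rule meas)

end

section \<open>Tessellations and measurability\<close>

lemma space_boundary_algebra [simp]: "space (boundary_algebra X D) = X"
  unfolding boundary_algebra_def by (rule space_measure_of) auto

abbreviation miss_events :: "'a::euclidean_space set set set \<Rightarrow> 'a set \<Rightarrow> 'a set set set set" where
  "miss_events X D \<equiv> {{T \<in> X. boundary T \<inter> C = {}} | C. compact C \<and> C \<subseteq> D}"

lemma sets_boundary_algebra:
  "sets (boundary_algebra X D) = sigma_sets X (miss_events X D)"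
  unfolding boundary_algebra_def by (rule sets_measure_of) auto

lemma pred_boundary_miss_compact:
  assumes f: "f \<in> M \<rightarrow>\<^sub>M boundary_algebra X D" and C: "compact C" "C \<subseteq> D"
  shows "Measurable.pred M (\<lambda>w. boundary (f w) \<inter> C = {})"
proof -
  have "{T \<in> X. boundary T \<inter> C = {}} \<in> sets (boundary_algebra X D)"
    unfolding sets_boundary_algebra using C by (intro sigma_sets.Basic) blast
  from measurable_sets[OF f this]
  have "f -` {T \<in> X. boundary T \<inter> C = {}} \<inter> space M \<in> sets M" .
  also have "f -` {T \<in> X. boundary T \<inter> C = {}} \<inter> space M = {w \<in> space M. boundary (f w) \<inter> C = {}}"
    using measurable_space[OF f] by auto
  finally show ?thesis by (simp add: pred_def)
qed

lemma pred_boundary_miss_open: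
  fixes f :: "'w \<Rightarrow> 'a::euclidean_space set set"
  assumes f: "f \<in> M \<rightarrow>\<^sub>M boundary_algebra X UNIV" and U: "open U"
  shows "Measurable.pred M (\<lambda>w. boundary (f w) \<inter> U = {})"
proof -
  obtain C :: "nat \<Rightarrow> 'a set" where C: "\<And>n. compact (C n)" "U = (\<Union>n. C n)"
    using open_countable_compacts[OF U] by blast
  have "Measurable.pred M (\<lambda>w. \<forall>n. boundary (f w) \<inter> C n = {})"
    by (intro pred_intros_countable pred_boundary_miss_compact[OF f C(1)]) simp
  moreover have "(\<forall>n. boundary (f w) \<inter> C n = {}) \<longleftrightarrow> boundary (f w) \<inter> U = {}" for w
    unfolding C(2) by blast
  ultimately show ?thesis by simp
qed

lemma pred_enclosed:
  fixes f :: "'w \<Rightarrow> 'a::euclidean_space set set"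
  assumes f: "f \<in> M \<rightarrow>\<^sub>M boundary_algebra X UNIV" and A: "open A" and D: "countable D"
  shows "Measurable.pred M (\<lambda>w. enclosed A D x (f w))"
  unfolding enclosed_def
  by (intro pred_intros_logic(2,3) pred_Ball_countable D pred_boundary_miss_open[OF f A]
      pred_boundary_miss_compact[OF f]) auto

section \<open>The boundary of a tessellation restricted to a window\<close>

lemma frontier_Int_interior:
  assumes "closed D" "x \<in> interior W"
  shows "x \<in> frontier (D \<inter> W) \<longleftrightarrow> x \<in> frontier D"
proof -
  have "closure (D \<inter> W) \<inter> interior W = closure D \<inter> interior W"
  proof
    show "closure (D \<inter> W) \<inter> interior W \<subseteq> closure D \<inter> interior W"
      using closure_mono[of "D \<inter> W" D] by blast
    have "interior W \<inter> closure D \<subseteq> closure (interior W \<inter> D)"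
      by (rule open_Int_closure_subset) simp
    also have "\<dots> \<subseteq> closure (D \<inter> W)" using interior_subset by (intro closure_mono) auto
    finally show "closure D \<inter> interior W \<subseteq> closure (D \<inter> W) \<inter> interior W" by blast
  qed
  then have "x \<in> closure (D \<inter> W) \<longleftrightarrow> x \<in> closure D" using assms(2) by blast
  then show ?thesis using assms(2) by (simp add: frontier_def)
qed

lemma interior_Int_nonempty:
  fixes D :: "'a::euclidean_space set"
  assumes "convex D" "interior D \<noteq> {}" "x \<in> D" "x \<in> interior W"
  shows "interior (D \<inter> W) \<noteq> {}"
proof -
  have "x \<in> closure (interior D)"
    using convex_closure_interior[OF assms(1,2)] assms(3) closure_subset by auto
  then have "interior W \<inter> interior D \<noteq> {}"
    using assms(4) open_Int_closure_eq_empty[of "interior W" "interior D"] by auto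
  then show ?thesis by (simp add: Int_commute)
qed

lemma boundary_restrict_tess_interior:
  assumes T: "T \<in> tessellations" and x: "x \<in> interior W"
  shows "x \<in> boundary (restrict_tess W T) \<longleftrightarrow> x \<in> boundary T"
proof -
  have cell: "closed D" "convex D" "interior D \<noteq> {}" if "D \<in> T" for D
    using T that unfolding tessellations_def by (auto intro: polytope_imp_closed polytope_imp_convex)
  show ?thesis
  proof
    assume "x \<in> boundary (restrict_tess W T)"
    then obtain D where "D \<in> T" "x \<in> frontier (D \<inter> W)" unfolding boundary_def restrict_tess_def by blast
    then show "x \<in> boundary T"
      using frontier_Int_interior[OF cell(1) x] unfolding boundary_def by blast
  next
    assume "x \<in> boundary T"
    then obtain D where D: "D \<in> T" "x \<in> frontier D" unfolding boundary_def by blast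
    then have "x \<in> D" using cell(1)[OF D(1)] frontier_subset_closed by blast
    then have "D \<inter> W \<in> restrict_tess W T"
      using interior_Int_nonempty[OF cell(2,3)[OF D(1)] _ x] D(1) unfolding restrict_tess_def by blast
    then show "x \<in> boundary (restrict_tess W T)"
      using frontier_Int_interior[OF cell(1)[OF D(1)] x] D(2) unfolding boundary_def by blast
  qed
qed

text \<open>A frontier point of \<open>W\<close> is a limit of interior points, and finitely many
  cells cover these. So the trace of one cell on \<open>interior W\<close> accumulates at the point,
  which lies in the restricted cell but cannot be interior to it.\<close>

lemma boundary_restrict_tess_frontier:
  assumes T: "T \<in> tessellations" and W: "window W"
  shows "frontier W \<subseteq> boundary (restrict_tess W T)"
proof
  fix x assume x: "x \<in> frontier W"
  have cW: "closed W" "convex W" "bounded W" "interior W \<noteq> {}"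
    using W by (auto simp: window_def polytope_imp_closed polytope_imp_convex polytope_imp_bounded)
  define F where "F = {D \<in> T. D \<inter> W \<noteq> {}}"
  have F: "finite F" using T cW(3) by (simp add: F_def tessellations_def)
  have cell: "closed D" "convex D" "interior D \<noteq> {}" if "D \<in> T" for D
    using T that unfolding tessellations_def by (auto intro: polytope_imp_closed polytope_imp_convex)
  have cov: "interior W \<subseteq> (\<Union>D\<in>F. interior W \<inter> D)"
  proof
    fix y assume y: "y \<in> interior W"
    have "\<Union>T = UNIV" using T by (simp add: tessellations_def)
    then obtain D where "D \<in> T" "y \<in> D" by blast
    then show "y \<in> (\<Union>D\<in>F. interior W \<inter> D)" using y interior_subset by (auto simp: F_def)
  qed
  have "(\<Union>D\<in>F. interior W \<inter> D) \<subseteq> (\<Union>D\<in>F. closure (interior W \<inter> D))"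
    by (intro UN_mono closure_subset subset_refl)
  from subset_trans[OF cov this]
  have "closure (interior W) \<subseteq> (\<Union>D\<in>F. closure (interior W \<inter> D))"
    by (rule closure_minimal) (intro closed_UN F ballI closed_closure)
  moreover have "x \<in> closure (interior W)"
    using x cW convex_closure_interior[OF cW(2,4)] by (auto simp: frontier_def)
  ultimately obtain D where D: "D \<in> F" "x \<in> closure (interior W \<inter> D)" by blast
  then have DT: "D \<in> T" by (simp add: F_def)
  obtain y where y: "y \<in> interior W \<inter> D" using D(2) by (metis closure_empty empty_iff all_not_in_conv)
  have ne: "interior (D \<inter> W) \<noteq> {}" by (rule interior_Int_nonempty[OF cell(2,3)[OF DT]]) (use y in auto)
  have "closure (interior W \<inter> D) \<subseteq> D \<inter> W"
    using cell(1)[OF DT] cW(1) interior_subset by (intro closure_minimal) auto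
  then have "x \<in> D \<inter> W" using D(2) by blast
  moreover have "x \<notin> interior (D \<inter> W)" using x by (auto simp: frontier_def)
  ultimately have "x \<in> frontier (D \<inter> W)" using closure_subset[of "D \<inter> W"] unfolding frontier_def by blast
  moreover have "D \<inter> W \<in> restrict_tess W T" using DT ne unfolding restrict_tess_def by blast
  ultimately show "x \<in> boundary (restrict_tess W T)" unfolding boundary_def by blast
qed

lemma boundary_subset_window:
  assumes T: "T \<in> tessellations" and W: "closed W"
  shows "boundary (restrict_tess W T) \<subseteq> W"
proof -
  have "frontier (D \<inter> W) \<subseteq> W" if "D \<in> T" for D
  proof -
    have "closed D" using T that by (auto simp: tessellations_def polytope_imp_closed)
    then show ?thesis using W frontier_subset_closed[of "D \<inter> W"] by blast
  qed
  then show ?thesis unfolding boundary_def restrict_tess_def by blast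
qed

lemma measurable_restrict_tess:
  assumes W: "window W"
  shows "restrict_tess W \<in> tess_borel \<rightarrow>\<^sub>M boundary_algebra UNIV UNIV"
  unfolding boundary_algebra_def[of UNIV]
proof (rule measurable_measure_of)
  fix A :: "'a set set set" assume "A \<in> (miss_events UNIV UNIV)"
  then obtain C where C: "compact C" "A = {T. boundary T \<inter> C = {}}" by auto
  have cW: "closed W" using W by (simp add: window_def polytope_imp_closed)
  show "restrict_tess W -` A \<inter> space tess_borel \<in> sets tess_borel"
  \<comment> \<open>A compact set that meets the frontier of \<open>W\<close> is never missed.
    Otherwise its part in \<open>W\<close> lies in the interior, where restriction does not change
    the boundary.\<close>
  proof (cases "C \<inter> frontier W = {}")
    case True
    then have CW: "C \<inter> W = C \<inter> interior W" using cW interior_subset by (auto simp: frontier_def)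
    have "boundary (restrict_tess W T) \<inter> C = {} \<longleftrightarrow> boundary T \<inter> (C \<inter> W) = {}" if "T \<in> tessellations" for T
      using boundary_restrict_tess_interior[OF that] boundary_subset_window[OF that cW] unfolding CW using CW by blast
    then have "restrict_tess W -` A \<inter> space tess_borel = {T \<in> tessellations. boundary T \<inter> (C \<inter> W) = {}}"
      using C(2) by auto
    also have "\<dots> \<in> sets tess_borel"
      unfolding sets_boundary_algebra using C(1) cW by (intro sigma_sets.Basic) (auto intro!: exI[of _ "C \<inter> W"])
    finally show ?thesis .
  next
    case False
    then have "boundary (restrict_tess W T) \<inter> C \<noteq> {}" if "T \<in> tessellations" for T
      using boundary_restrict_tess_frontier[OF that W] by blast
    then have "restrict_tess W -` A \<inter> space tess_borel = {}" using C(2) by auto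
    then show ?thesis by simp
  qed
qed auto

text \<open>If \<open>g\<close> were not measurable, \<open>distr N S g\<close> would be the null measure; so equality with an image of a
  probability measure makes \<open>g\<close> measurable.\<close>

lemma distr_eq_imp_measurable:
  assumes M: "prob_space M" and N: "prob_space N" and f: "f \<in> M \<rightarrow>\<^sub>M S" and g: "g \<in> space N \<rightarrow> space S"
    and eq: "distr M S f = distr N S g"
  shows "g \<in> N \<rightarrow>\<^sub>M S"
proof (rule measurableI)
  show "g x \<in> space S" if "x \<in> space N" for x using g that by auto
  fix A assume A: "A \<in> sets S"
  interpret M: prob_space M by (rule M)
  interpret N: prob_space N by (rule N)
  interpret D: prob_space "distr M S f" by (rule M.prob_space_distr[OF f])
  have one: "emeasure (distr N S g) (space S) = 1" using D.emeasure_space_1 eq by simp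
  let ?\<mu> = "\<lambda>A. emeasure N (g -` A \<inter> space N)"
  have ms: "measure_space (space S) (sigma_sets (space S) (sets S)) ?\<mu>"
    using one emeasure_measure_of_conv[of "space S" "sets S" ?\<mu>, THEN fun_cong, of "space S"]
    unfolding distr_def by (auto split: if_splits)
  have val: "emeasure (distr N S g) B = ?\<mu> B" if "B \<in> sets S" for B
    using ms that emeasure_measure_of_conv[of "space S" "sets S" ?\<mu>, THEN fun_cong, of B]
    unfolding distr_def by (simp add: sets.sigma_sets_eq)
  \<comment> \<open>The mass 1 is shared by \<open>A\<close> and its complement, and a nonmeasurable
    preimage would be given the value 0. So one of the two preimages is measurable, and they are
    complementary.\<close>
  have "emeasure (distr N S g) A + emeasure (distr N S g) (space S - A) = emeasure (distr N S g) (space S)"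
    using A sets.sets_into_space[OF A] by (subst plus_emeasure) (auto simp: Un_absorb1)
  then have "?\<mu> A + ?\<mu> (space S - A) = 1" using one val[OF A] val[of "space S - A"] A by simp
  then have "?\<mu> A \<noteq> 0 \<or> ?\<mu> (space S - A) \<noteq> 0" by auto
  then show "g -` A \<inter> space N \<in> sets N"
  proof
    assume "?\<mu> A \<noteq> 0" then show ?thesis using emeasure_notin_sets by blast
  next
    assume "?\<mu> (space S - A) \<noteq> 0"
    then have "g -` (space S - A) \<inter> space N \<in> sets N" using emeasure_notin_sets by blast
    moreover have "g -` A \<inter> space N = space N - (g -` (space S - A) \<inter> space N)" using g by auto
    ultimately show ?thesis by auto
  qed
qed

text \<open>Used twice: with factor \<open>q\<close> to extend the factorization to all events
  outside a window, and with the whole space as \<open>Z\<close> to extend independence from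
  generators to the tail event itself.\<close>

lemma proportional_on_generator:
  assumes M: "prob_space M" and f: "f \<in> M \<rightarrow>\<^sub>M S" and S: "sets S = sigma_sets \<Omega> G" "space S = \<Omega>"
    and G: "Int_stable G" "G \<subseteq> Pow \<Omega>" "\<Omega> \<in> G" and X: "X \<in> sets M" "Z \<in> sets M"
    and eq: "\<And>A. A \<in> G \<Longrightarrow> measure M (X \<inter> (f -` A \<inter> space M)) = c * measure M (Z \<inter> (f -` A \<inter> space M))"
    and A: "A \<in> sets S"
  shows "measure M (X \<inter> (f -` A \<inter> space M)) = c * measure M (Z \<inter> (f -` A \<inter> space M))"
proof -
  interpret prob_space M by (rule M)
  have meas: "f -` B \<inter> space M \<in> sets M" if "B \<in> sigma_sets \<Omega> G" for B
    using measurable_sets[OF f] that S(1) by simp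
  from A have "A \<in> sigma_sets \<Omega> G" using S(1) by simp
  with G(1,2) show ?thesis
  proof (induction rule: sigma_sets_induct_disjoint)
    case (basic A) then show ?case by (rule eq)
  next
    case empty then show ?case by simp
  next
    case (compl A)
    have d: "measure M (Y \<inter> (f -` (\<Omega> - A) \<inter> space M)) =
        measure M (Y \<inter> (f -` \<Omega> \<inter> space M)) - measure M (Y \<inter> (f -` A \<inter> space M))" if "Y \<in> sets M" for Y
    proof -
      have "Y \<inter> (f -` (\<Omega> - A) \<inter> space M) = Y \<inter> (f -` \<Omega> \<inter> space M) - Y \<inter> (f -` A \<inter> space M)" by auto
      moreover have "A \<subseteq> \<Omega>" using compl(1) G(2) by (metis sigma_sets_into_sp)
      moreover have "f -` \<Omega> \<inter> space M \<in> sets M" using G(3) by (intro meas sigma_sets.Basic)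
      ultimately show ?thesis using that meas[OF compl(1)]
        by (simp only:) (intro finite_measure_Diff, auto)
    qed
    show ?case by (simp only: d[OF X(1)] d[OF X(2)] compl(2) eq[OF G(3)] right_diff_distrib)
  next
    case (union A)
    have s: "(\<lambda>i. measure M (Y \<inter> (f -` A i \<inter> space M))) sums measure M (Y \<inter> (f -` (\<Union>i. A i) \<inter> space M))"
      if "Y \<in> sets M" for Y
    proof -
      have "range (\<lambda>i. Y \<inter> (f -` A i \<inter> space M)) \<subseteq> sets M"
        using union(2) that by (intro image_subsetI sets.Int meas) auto
      moreover have "disjoint_family (\<lambda>i. Y \<inter> (f -` A i \<inter> space M))"
        using union(1) unfolding disjoint_family_on_def by blast
      moreover have "(\<Union>i. Y \<inter> (f -` A i \<inter> space M)) = Y \<inter> (f -` (\<Union>i. A i) \<inter> space M)" by auto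
      ultimately show ?thesis using finite_measure_UNION[of "\<lambda>i. Y \<inter> (f -` A i \<inter> space M)"] by simp
    qed
    have "(\<lambda>i. measure M (X \<inter> (f -` A i \<inter> space M))) sums (c * measure M (Z \<inter> (f -` (\<Union>i. A i) \<inter> space M)))"
      unfolding union(3) by (rule sums_mult[OF s[OF X(2)]])
    then show ?case using s[OF X(1)] sums_unique2 by blast
  qed
qed

section \<open>Transfer to the STIT process\<close>

locale stit = driving \<Lambda> for \<Lambda> :: "'a::euclidean_space set measure" +
  fixes M :: "'w measure" and Y :: "real \<Rightarrow> 'w \<Rightarrow> 'a set set"
  assumes stit: "stit_process \<Lambda> M Y"
begin

sublocale prob_space M using stit by (simp add: stit_process_def)

lemma Y_measurable: "0 < t \<Longrightarrow> Y t \<in> M \<rightarrow>\<^sub>M tess_borel"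
  using stit unfolding stit_process_def markov_process_def by blast

lemma Y_tessellation: "0 < t \<Longrightarrow> w \<in> space M \<Longrightarrow> Y t w \<in> tessellations"
  using measurable_space[OF Y_measurable] by simp

abbreviation paths :: "(real \<Rightarrow> 'a set set) measure" where
  "paths \<equiv> \<Pi>\<^sub>M t\<in>{0<..}. boundary_algebra UNIV UNIV"

lemma component_measurable: "0 < t \<Longrightarrow> (\<lambda>p. p t) \<in> paths \<rightarrow>\<^sub>M boundary_algebra UNIV UNIV"
  by (rule measurable_component_singleton) simp

definition window_path :: "'a set \<Rightarrow> 'w \<Rightarrow> real \<Rightarrow> 'a set set" where
  "window_path W = (\<lambda>w. \<lambda>t\<in>{0<..}. restrict_tess W (Y t w))"

lemma window_path_measurable: "window W \<Longrightarrow> window_path W \<in> M \<rightarrow>\<^sub>M paths"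
  unfolding window_path_def
  by (rule measurable_restrict) (rule measurable_compose[OF Y_measurable measurable_restrict_tess], simp_all)

definition division_path ::
  "('a set \<Rightarrow> 'a) \<Rightarrow> 'a set \<Rightarrow> (bool list \<Rightarrow> 'v \<Rightarrow> real) \<Rightarrow> (bool list \<Rightarrow> 'v \<Rightarrow> 'a set) \<Rightarrow> 'v \<Rightarrow> real \<Rightarrow> 'a set set" where
  "division_path \<nu> W L H = (\<lambda>w. \<lambda>t\<in>{0<..}. cells_alive \<nu> W L H t w)"

text \<open>The measurability of the path map of the realisation is not part of
  \<open>cell_division\<close>; it is deduced from the equality of laws.\<close>

lemma window_realisation:
  assumes W: "window W"
  obtains N :: "(bool list \<Rightarrow> real \<times> 'a set) measure" and \<nu> L H where "window_process \<Lambda> N W \<nu> L H"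
    "division_path \<nu> W L H \<in> N \<rightarrow>\<^sub>M paths"
    "distr M paths (window_path W) = distr N paths (division_path \<nu> W L H)"
proof -
  obtain N :: "(bool list \<Rightarrow> real \<times> 'a set) measure" and \<nu> L H where
    d: "cell_division \<Lambda> W N \<nu> L H" and
    eq: "path_law M (\<lambda>t w. restrict_tess W (Y t w)) = path_law N (cells_alive \<nu> W L H)"
    using stit W unfolding stit_process_def by blast
  have cW: "closed W" using W by (simp add: window_def polytope_imp_closed)
  have P: "window_process \<Lambda> N W \<nu> L H"
    by standard (rule d, rule cW, rule W)
  have N: "prob_space N" using d by (simp add: cell_division_def)
  have eq': "distr M paths (window_path W) = distr N paths (division_path \<nu> W L H)"
    using eq unfolding path_law_def window_path_def division_path_def .
  have "division_path \<nu> W L H \<in> space N \<rightarrow> space paths"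
    by (auto simp: division_path_def space_PiM)
  then have "division_path \<nu> W L H \<in> N \<rightarrow>\<^sub>M paths"
    by (rule distr_eq_imp_measurable[OF prob_space_axioms N window_path_measurable[OF W] _ eq'])
  from that[OF P this eq'] show thesis .
qed

lemma path_transfer:
  assumes W: "window W" and m: "division_path \<nu> W L H \<in> N \<rightarrow>\<^sub>M paths"
    and eq: "distr M paths (window_path W) = distr N paths (division_path \<nu> W L H)"
    and E: "Measurable.pred paths E"
  shows "{w \<in> space N. E (division_path \<nu> W L H w)} \<in> sets N"
    and "emeasure M {w \<in> space M. E (window_path W w)} = emeasure N {w \<in> space N. E (division_path \<nu> W L H w)}"
proof -
  let ?A = "{p \<in> space paths. E p}"
  have A: "?A \<in> sets paths" using E by (simp add: pred_def)
  have p1: "window_path W -` ?A \<inter> space M = {w \<in> space M. E (window_path W w)}"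
    using measurable_space[OF window_path_measurable[OF W]] by blast
  have p2: "division_path \<nu> W L H -` ?A \<inter> space N = {w \<in> space N. E (division_path \<nu> W L H w)}"
    using measurable_space[OF m] by blast
  show "{w \<in> space N. E (division_path \<nu> W L H w)} \<in> sets N"
    using measurable_sets[OF m A] unfolding p2 .
  show "emeasure M {w \<in> space M. E (window_path W w)} = emeasure N {w \<in> space N. E (division_path \<nu> W L H w)}"
    using emeasure_distr[OF window_path_measurable[OF W] A] emeasure_distr[OF m A] eq
    unfolding p1 p2 by simp
qed

lemma window_path_miss:
  assumes "0 < t" "w \<in> space M" "K \<subseteq> interior W"
  shows "boundary (window_path W w t) \<inter> K = {} \<longleftrightarrow> boundary (Y t w) \<inter> K = {}"
proof -
  have "x \<in> boundary (window_path W w t) \<longleftrightarrow> x \<in> boundary (Y t w)" if "x \<in> K" for x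
    using boundary_restrict_tess_interior[OF Y_tessellation[OF assms(1,2)]] that assms
    by (simp add: window_path_def subset_iff)
  then show ?thesis by blast
qed

lemma window_path_enclosed:
  assumes "0 < t" "w \<in> space M" "A \<subseteq> interior W" "\<And>q. q \<in> D \<Longrightarrow> closed_segment x q \<subseteq> interior W"
  shows "enclosed A D x (window_path W w t) \<longleftrightarrow> enclosed A D x (Y t w)"
  unfolding enclosed_def using window_path_miss[OF assms(1,2)] assms(3,4) by simp

lemma division_path_eq: "0 < t \<Longrightarrow> division_path \<nu> W L H w t = cells_alive \<nu> W L H t w"
  by (simp add: division_path_def)

text \<open>Consistency in the form that is used: the right-hand side does not mention
  \<open>C\<close>. The window \<open>C\<close> is made the root cell of its own realisation, which
  also gives mass 1 for its division law.\<close>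

lemma miss_prob_limit:
  assumes C: "window C" and K: "compact K" "K \<subseteq> interior C" and r: "0 < r" and \<nu>: "orientation \<nu>"
  shows "(INF n. miss_prob \<nu> K n (C, r)) = emeasure M {w \<in> space M. boundary (Y r w) \<inter> K = {}}"
    and "(\<integral>\<^sup>+z. 1 \<partial>division_law \<Lambda> C) = 1"
proof -
  obtain N :: "(bool list \<Rightarrow> real \<times> 'a set) measure" and \<nu>' L H where
    P: "window_process \<Lambda> N C \<nu>' L H" and m: "division_path \<nu>' C L H \<in> N \<rightarrow>\<^sub>M paths"
    and eq: "distr M paths (window_path C) = distr N paths (division_path \<nu>' C L H)"
    using window_realisation[OF C] .
  interpret P: window_process \<Lambda> N C \<nu>' L H by (rule P)
  show "(\<integral>\<^sup>+z. 1 \<partial>division_law \<Lambda> C) = 1" by (rule P.division_law_total)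
  have E: "Measurable.pred paths (\<lambda>p. boundary (p r) \<inter> K = {})"
    by (rule pred_boundary_miss_compact[OF component_measurable[OF r] K(1)]) simp
  note tr = path_transfer[OF C m eq E, unfolded division_path_eq[OF r]]
  have "emeasure M {w \<in> space M. boundary (Y r w) \<inter> K = {}} =
      emeasure M {w \<in> space M. boundary (window_path C w r) \<inter> K = {}}"
    using window_path_miss[OF r _ K(2)] by (intro arg_cong[where f = "emeasure M"]) auto
  also have "\<dots> = (INF n. miss_prob \<nu>' K n (C, r))"
    unfolding tr(2) by (rule P.root_boundary_prob[OF K tr(1)])
  finally show "(INF n. miss_prob \<nu> K n (C, r)) = emeasure M {w \<in> space M. boundary (Y r w) \<inter> K = {}}"
    using miss_prob_orientation[OF \<nu> P.orient] by simp
qed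

lemma process_factorization:
  assumes st: "0 < s" "s < t" and R: "window R" "x \<in> interior R" "R \<subseteq> V"
    and V: "closed V" "V \<subseteq> interior V'" "convex V'" "V' \<subseteq> interior W" and W: "window W"
    and Q: "countable Q" "\<And>U. open U \<Longrightarrow> U \<noteq> {} \<Longrightarrow> \<exists>q\<in>Q. q \<in> U"
    and K: "compact K" "K \<subseteq> interior R" and K': "compact K'" "K' \<subseteq> interior W" "K' \<inter> V = {}"
  shows "emeasure M {w \<in> space M. (enclosed (interior R) (Q \<inter> (interior V' - V)) x (Y s w) \<and>
      boundary (Y t w) \<inter> K' = {}) \<and> boundary (Y t w) \<inter> K = {}} =
    emeasure M {w \<in> space M. boundary (Y (t - s) w) \<inter> K = {}} *
    emeasure M {w \<in> space M. enclosed (interior R) (Q \<inter> (interior V' - V)) x (Y s w) \<and>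
      boundary (Y t w) \<inter> K' = {}}"
proof -
  let ?D = "Q \<inter> (interior V' - V)"
  have t: "0 < t" using st by simp
  obtain N :: "(bool list \<Rightarrow> real \<times> 'a set) measure" and \<nu> L H where
    P: "window_process \<Lambda> N W \<nu> L H" and m: "division_path \<nu> W L H \<in> N \<rightarrow>\<^sub>M paths"
    and eq: "distr M paths (window_path W) = distr N paths (division_path \<nu> W L H)"
    using window_realisation[OF W] .
  interpret P: window_process \<Lambda> N W \<nu> L H by (rule P)
  have VW: "V \<subseteq> V'" "R \<subseteq> V'" "V' \<subseteq> W" using V(2,4) R(3) interior_subset by blast+
  have RW: "interior R \<subseteq> interior W" "K \<subseteq> interior W"
    using VW(2,3) K(2) interior_mono[of R W] by blast+
  \<comment> \<open>Convexity of \<open>V'\<close> keeps the tested segments in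
    \<open>interior W\<close>, so that restricting to \<open>W\<close> does not change the enclosing
    event.\<close>
  have seg: "closed_segment x q \<subseteq> interior W" if "q \<in> ?D" for q
  proof -
    have "x \<in> V'" "q \<in> V'" using R(2) VW(2) that interior_subset by blast+
    then show ?thesis using closed_segment_subset[OF _ _ V(3)] V(4) by blast
  qed
  have cD: "countable ?D" using Q(1) by (rule countable_subset[rotated]) auto
  have X: "Measurable.pred paths (\<lambda>p. enclosed (interior R) ?D x (p s) \<and> boundary (p t) \<inter> K' = {})"
    by (intro pred_intros_logic(3) pred_enclosed[OF component_measurable] open_interior cD st
        pred_boundary_miss_compact[OF component_measurable] K' t subset_UNIV)
  have Z: "Measurable.pred paths (\<lambda>p. (enclosed (interior R) ?D x (p s) \<and> boundary (p t) \<inter> K' = {}) \<and> boundary (p t) \<inter> K = {})"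
    by (rule pred_intros_logic(3)[OF X pred_boundary_miss_compact[OF component_measurable[OF t] K(1)]]) simp
  note trX = path_transfer[OF W m eq X, unfolded division_path_eq[OF st(1)] division_path_eq[OF t]]
  note trZ = path_transfer[OF W m eq Z, unfolded division_path_eq[OF st(1)] division_path_eq[OF t]]
  have iff: "enclosed (interior R) ?D x (window_path W w s) \<longleftrightarrow> enclosed (interior R) ?D x (Y s w)"
    "boundary (window_path W w t) \<inter> K' = {} \<longleftrightarrow> boundary (Y t w) \<inter> K' = {}"
    "boundary (window_path W w t) \<inter> K = {} \<longleftrightarrow> boundary (Y t w) \<inter> K = {}" if "w \<in> space M" for w
    by (rule window_path_enclosed[OF st(1) that RW(1) seg], assumption)
      (rule window_path_miss[OF t that K'(2)], rule window_path_miss[OF t that RW(2)])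
  have q: "(INF n. miss_prob \<nu> K n (C, t - s)) = emeasure M {w \<in> space M. boundary (Y (t - s) w) \<inter> K = {}}"
    "(\<integral>\<^sup>+z. 1 \<partial>division_law \<Lambda> C) = 1" if C: "window C" "R \<subseteq> C" for C
  proof -
    have KC: "K \<subseteq> interior C" using K(2) interior_mono[OF C(2)] by blast
    have ts: "0 < t - s" using st by simp
    show "(INF n. miss_prob \<nu> K n (C, t - s)) = emeasure M {w \<in> space M. boundary (Y (t - s) w) \<inter> K = {}}"
      "(\<integral>\<^sup>+z. 1 \<partial>division_law \<Lambda> C) = 1"
      using miss_prob_limit[OF C(1) K(1) KC ts P.orient] .
  qed
  have "emeasure M {w \<in> space M. (enclosed (interior R) ?D x (Y s w) \<and>
      boundary (Y t w) \<inter> K' = {}) \<and> boundary (Y t w) \<inter> K = {}} =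
    emeasure M {w \<in> space M. (enclosed (interior R) ?D x (window_path W w s) \<and>
      boundary (window_path W w t) \<inter> K' = {}) \<and> boundary (window_path W w t) \<inter> K = {}}"
    using iff by (intro arg_cong[where f = "emeasure M"] Collect_cong conj_cong refl) simp_all
  also have "\<dots> = emeasure M {w \<in> space M. boundary (Y (t - s) w) \<inter> K = {}} *
    emeasure N {w \<in> space N. enclosed (interior R) ?D x (cells_alive \<nu> W L H s w) \<and>
      boundary (cells_alive \<nu> W L H t w) \<inter> K' = {}}"
    unfolding trZ(2)
    by (rule P.enclosed_factorization[OF _ R V(1,2) VW(3) Q(2) K K' q refl _ trX(1) trZ(1)])
      (use st in auto)
  also have "emeasure N {w \<in> space N. enclosed (interior R) ?D x (cells_alive \<nu> W L H s w) \<and>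
      boundary (cells_alive \<nu> W L H t w) \<inter> K' = {}} =
    emeasure M {w \<in> space M. enclosed (interior R) ?D x (window_path W w s) \<and>
      boundary (window_path W w t) \<inter> K' = {}}"
    by (rule trX(2)[symmetric])
  also have "\<dots> = emeasure M {w \<in> space M. enclosed (interior R) ?D x (Y s w) \<and> boundary (Y t w) \<inter> K' = {}}"
    using iff by (intro arg_cong[where f = "emeasure M"] Collect_cong conj_cong refl) simp_all
  finally show ?thesis .
qed

end

section \<open>Triviality of the tail\<close>

lemma sets_boundary_algebra_mono: "D \<subseteq> D' \<Longrightarrow> sets (boundary_algebra X D) \<subseteq> sets (boundary_algebra X D')"
  unfolding sets_boundary_algebra by (rule sigma_sets_subseteq) blast

lemma Int_stable_boundary_miss: "Int_stable (miss_events X D)"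
proof (rule Int_stableI)
  fix A B assume "A \<in> (miss_events X D)"
    "B \<in> (miss_events X D)"
  then obtain C C' where C: "A = {T \<in> X. boundary T \<inter> C = {}}" "compact C" "C \<subseteq> D"
    and C': "B = {T \<in> X. boundary T \<inter> C' = {}}" "compact C'" "C' \<subseteq> D" by blast
  have "A \<inter> B = {T \<in> X. boundary T \<inter> (C \<union> C') = {}}" unfolding C(1) C'(1) by blast
  moreover have "compact (C \<union> C')" "C \<union> C' \<subseteq> D" using C C' by auto
  ultimately show "A \<inter> B \<in> (miss_events X D)" by blast
qed

lemma exhausting_windows_mono:
  assumes "exhausting_windows W" "m \<le> n" shows "W m \<subseteq> W n"
proof (rule lift_Suc_mono_le[OF _ assms(2)])
  show "W n \<subseteq> W (Suc n)" for n
    using assms(1) interior_subset[of "W (Suc n)"] unfolding exhausting_windows_def by blast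
qed

lemma exhausting_windows_compact:
  assumes W: "exhausting_windows W" and K: "compact K"
  obtains n where "K \<subseteq> interior (W n)"
proof -
  have mono: "interior (W m) \<subseteq> interior (W n)" if "m \<le> n" for m n
    by (rule interior_mono[OF exhausting_windows_mono[OF W that]])
  have "x \<in> (\<Union>n. interior (W n))" for x
  proof -
    have "(\<Union>n. W n) = UNIV" using W by (simp add: exhausting_windows_def)
    then obtain n where "x \<in> W n" by blast
    moreover have "W n \<subseteq> interior (W (Suc n))" using W unfolding exhausting_windows_def by blast
    ultimately show ?thesis by blast
  qed
  then have cover: "K \<subseteq> (\<Union>n\<in>UNIV. interior (W n))" by blast
  obtain F where F: "finite F" "K \<subseteq> (\<Union>n\<in>F. interior (W n))"
    using compactE_image[OF K _ cover] by (metis open_interior)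
  have "interior (W m) \<subseteq> interior (W (Max (insert 0 F)))" if "m \<in> F" for m
    using F(1) that by (intro mono Max_ge) auto
  then have "K \<subseteq> interior (W (Max (insert 0 F)))" using F(2) by blast
  then show thesis by (rule that)
qed

text \<open>This is where the boundedness of the cells enters.\<close>

lemma enclosed_eventually:
  assumes W: "exhausting_windows W" and T: "T \<in> tessellations" and A: "boundary T \<inter> A = {}"
  shows "\<exists>m. \<forall>n\<ge>m. enclosed A (Q \<inter> (interior (W (Suc n)) - W n)) x T"
proof -
  have "\<Union>T = UNIV" using T by (simp add: tessellations_def)
  then obtain C where C: "C \<in> T" "x \<in> C" by blast
  have "polytope C" using T C(1) by (simp add: tessellations_def)
  then obtain m where m: "C \<subseteq> interior (W m)"
    using exhausting_windows_compact[OF W polytope_imp_compact] by blast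
  have "boundary T \<inter> closed_segment x q \<noteq> {}" if "m \<le> n" "q \<notin> W n" for n q
  proof -
    have "q \<notin> C" using m that interior_subset[of "W m"] exhausting_windows_mono[OF W that(1)] by blast
    then have "q \<in> closed_segment x q - C" "x \<in> closed_segment x q \<inter> C" using C(2) by auto
    then have "closed_segment x q \<inter> frontier C \<noteq> {}"
      using connected_Int_frontier[of "closed_segment x q" C] by (metis connected_segment(1) empty_iff)
    then show ?thesis using C(1) unfolding boundary_def by blast
  qed
  then show ?thesis using A unfolding enclosed_def by (intro exI[of _ m]) blast
qed

section \<open>Choice of the time and the windows, and the limit in the error\<close>

context stit
begin

lemma Y_measurable_outside:
  assumes t: "0 < t" shows "Y t \<in> M \<rightarrow>\<^sub>M boundary_algebra tessellations D"
proof -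
  have "subalgebra tess_borel (boundary_algebra (tessellations :: 'a set set set) D)"
    by (simp add: subalgebra_def sets_boundary_algebra_mono)
  from measurable_from_subalg[OF this measurable_ident[unfolded id_def]]
  show ?thesis by (rule measurable_compose[OF Y_measurable[OF t]])
qed

text \<open>As long as the root of a realisation in \<open>R\<close> is undivided,
  \<open>interior R\<close> is missed. Its lifetime is almost surely positive, so it exceeds
  \<open>1 / real (Suc n)\<close> with probability tending to 1.\<close>

lemma miss_small_time:
  assumes R: "window R" and t: "0 < t" and e: "0 < e"
  obtains s where "0 < s" "s < t" "prob {w \<in> space M. boundary (Y s w) \<inter> interior R = {}} > 1 - e"
proof -
  obtain N :: "(bool list \<Rightarrow> real \<times> 'a set) measure" and \<nu> L H where
    P: "window_process \<Lambda> N R \<nu> L H" and m: "division_path \<nu> R L H \<in> N \<rightarrow>\<^sub>M paths"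
    and eq: "distr M paths (window_path R) = distr N paths (division_path \<nu> R L H)"
    using window_realisation[OF R] .
  interpret P: window_process \<Lambda> N R \<nu> L H by (rule P)
  define A where "A n = {w \<in> space N. 1 / real (Suc n) < L [] w}" for n
  have A: "A n \<in> sets N" for n unfolding A_def by measurable
  have "incseq A"
  proof (rule incseq_SucI)
    have "1 / real (Suc (Suc n)) \<le> 1 / real (Suc n)" for n by (simp add: frac_le)
    then show "A n \<le> A (Suc n)" for n unfolding A_def by (auto intro: le_less_trans)
  qed
  then have lim: "(\<lambda>n. measure N (A n)) \<longlonglongrightarrow> measure N (\<Union>n. A n)"
    using A by (intro P.finite_Lim_measure_incseq) auto
  have "measure N (\<Union>n. A n) = 1"
  proof (rule P.prob_eq_1[THEN iffD2])
    show "(\<Union>n. A n) \<in> sets N" using A by blast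
    show "AE w in N. w \<in> (\<Union>n. A n)"
      using P.AE_lifetime_pos AE_space
    proof eventually_elim
      case (elim w)
      then have "0 < L [] w" by blast
      then obtain n where "1 / real (Suc n) < L [] w" using nat_approx_posE by blast
      then show ?case using elim(2) by (auto simp: A_def)
    qed
  qed
  then have "eventually (\<lambda>n. 1 - e < measure N (A n)) sequentially"
    using order_tendstoD(1)[OF lim, of "1 - e"] e by simp
  moreover have "(\<lambda>n. 1 / real (Suc n)) \<longlonglongrightarrow> 0" by (rule LIMSEQ_Suc[OF lim_const_over_n])
  then have "eventually (\<lambda>n. 1 / real (Suc n) < t) sequentially" using t by (rule order_tendstoD(2))
  ultimately have "eventually (\<lambda>n. 1 - e < measure N (A n) \<and> 1 / real (Suc n) < t) sequentially"
    by (rule eventually_conj)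
  then obtain n where n: "1 - e < measure N (A n)" "1 / real (Suc n) < t"
    by (auto simp: eventually_sequentially)
  define s where "s = 1 / real (Suc n)"
  have s: "0 < s" "s < t" using n(2) by (simp_all add: s_def)
  have E: "Measurable.pred paths (\<lambda>p. boundary (p s) \<inter> interior R = {})"
    by (rule pred_boundary_miss_open[OF component_measurable[OF s(1)] open_interior])
  note tr = path_transfer[OF R m eq E, unfolded division_path_eq[OF s(1)]]
  have "1 - e < measure N (A n)" by (rule n(1))
  also have "\<dots> \<le> measure N {w \<in> space N. boundary (cells_alive \<nu> R L H s w) \<inter> interior R = {}}"
  proof (rule P.finite_measure_mono_AE)
    show "AE w in N. w \<in> A n \<longrightarrow> w \<in> {w \<in> space N. boundary (cells_alive \<nu> R L H s w) \<inter> interior R = {}}"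
      using P.AE_good
    proof eventually_elim
      case (elim w)
      show ?case
      proof
        assume "w \<in> A n"
        then have "s < death_time L [] w" by (simp add: A_def s_def death_time_def)
        from P.interior_alive_cell_miss[OF elim this]
        show "w \<in> {w \<in> space N. boundary (cells_alive \<nu> R L H s w) \<inter> interior R = {}}"
          using P.good_space[OF elim] by simp
      qed
    qed
  qed (rule tr(1))
  also have "\<dots> = prob {w \<in> space M. boundary (window_path R w s) \<inter> interior R = {}}"
    using tr(2) by (simp add: measure_def)
  also have "\<dots> = prob {w \<in> space M. boundary (Y s w) \<inter> interior R = {}}"
    using window_path_miss[OF s(1) _ subset_refl] by (intro arg_cong[where f = prob]) auto
  finally show thesis using s that by blast
qed

lemma enclosed_sets:
  assumes "0 < s" "countable D"
  shows "{w \<in> space M. enclosed (interior R) D x (Y s w)} \<in> sets M"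
  using pred_enclosed[OF Y_measurable[OF assms(1)] open_interior assms(2)] by (simp only: pred_def)

lemma miss_sets: "0 < t \<Longrightarrow> compact K \<Longrightarrow> {w \<in> space M. boundary (Y t w) \<inter> K = {}} \<in> sets M"
  using pred_boundary_miss_compact[OF Y_measurable _ subset_UNIV] by (simp only: pred_def)

lemma enclosed_prob:
  assumes W: "exhausting_windows W" and s: "0 < s" and Q: "countable Q" and e: "0 < e"
  obtains n where "m \<le> n" "prob {w \<in> space M. enclosed (interior R) (Q \<inter> (interior (W (Suc n)) - W n)) x (Y s w)} >
    prob {w \<in> space M. boundary (Y s w) \<inter> interior R = {}} - e"
proof -
  define X where "X n = {w \<in> space M. enclosed (interior R) (Q \<inter> (interior (W (Suc n)) - W n)) x (Y s w)}" for n
  define F where "F = {w \<in> space M. boundary (Y s w) \<inter> interior R = {}}"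
  \<comment> \<open>The enclosing events need not increase with \<open>n\<close>, since the tested
    shell moves. Requiring them from \<open>n\<close> on gives an increasing sequence, whose union
    is \<open>F\<close> because every path is eventually enclosed.\<close>
  define Z where "Z n = (\<Inter>k\<in>{n..}. X k)" for n
  have X: "X n \<in> sets M" for n
    unfolding X_def by (rule enclosed_sets[OF s]) (rule countable_subset[OF _ Q], blast)
  have Z: "Z n \<in> sets M" for n unfolding Z_def using X by (intro sets.countable_INT') auto
  have XF: "X n \<subseteq> F" for n by (auto simp: X_def F_def enclosed_def)
  have "F \<subseteq> (\<Union>n. Z n)"
  proof
    fix w assume u': "w \<in> F"
    then have "w \<in> space M" "boundary (Y s w) \<inter> interior R = {}" by (simp_all add: F_def)
    from enclosed_eventually[OF W Y_tessellation[OF s this(1)] this(2)]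
    obtain k where "\<forall>n\<ge>k. enclosed (interior R) (Q \<inter> (interior (W (Suc n)) - W n)) x (Y s w)" by blast
    then have "w \<in> Z k" using \<open>w \<in> space M\<close> by (simp add: Z_def X_def)
    then show "w \<in> (\<Union>n. Z n)" by blast
  qed
  moreover have "Z n \<subseteq> F" for n using XF[of n] by (auto simp: Z_def)
  ultimately have U: "(\<Union>n. Z n) = F" by blast
  have "incseq Z" by (rule incseq_SucI) (auto simp: Z_def)
  then have "(\<lambda>n. prob (Z n)) \<longlonglongrightarrow> prob F"
    using finite_Lim_measure_incseq[of Z] Z U by auto
  then have "eventually (\<lambda>n. prob F - e < prob (Z n)) sequentially" using e by (intro order_tendstoD(1)) auto
  then obtain n where n: "m \<le> n" "prob F - e < prob (Z n)"
    unfolding eventually_sequentially by (metis nle_le)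
  have "prob (Z n) \<le> prob (X n)" using X by (intro finite_measure_mono) (auto simp: Z_def)
  then show thesis using that[OF n(1)] n(2) by (simp add: X_def F_def)
qed

text \<open>On the enclosing event \<open>X\<close> both the tail event and the whole space factor
  with the same \<open>q\<close>, so \<open>q\<close> is close to the probability of
  \<open>B\<close>, and exact independence follows as the error tends to 0. Here \<open>q\<close>
  and \<open>X\<close> depend on the error, while \<open>A\<close> and \<open>B\<close> do
  not.\<close>

lemma tail_independent_of_miss:
  assumes W: "exhausting_windows W" and t: "0 < t" and E: "E \<in> tail_algebra W" and K: "compact K"
  defines "A \<equiv> Y t -` E \<inter> space M" and "B \<equiv> {w \<in> space M. boundary (Y t w) \<inter> K = {}}"
  shows "prob (A \<inter> B) = prob A * prob B"
proof -
  have EW: "E \<in> sets (tess_borel_outside (W n))" for n using E by (simp add: tail_algebra_def)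
  have A: "A \<in> sets M" unfolding A_def by (rule measurable_sets[OF Y_measurable_outside[OF t] EW])
  have B: "B \<in> sets M" unfolding B_def by (rule miss_sets[OF t K])
  have win: "window (W n)" for n using W by (simp add: exhausting_windows_def)
  have cW: "closed (W n)" "compact (W n)" "convex (W n)" for n
    using win[of n] by (simp_all add: window_def polytope_imp_closed polytope_imp_compact polytope_imp_convex)
  obtain m where m: "K \<subseteq> interior (W m)" using exhausting_windows_compact[OF W K] .
  obtain x where x: "x \<in> interior (W m)" using win[of m] by (auto simp: window_def)
  obtain Q :: "'a set" where Q: "countable Q" "\<And>U. open U \<Longrightarrow> U \<noteq> {} \<Longrightarrow> \<exists>q\<in>Q. q \<in> U"
    using countable_dense_setE by metis
  have "\<bar>prob (A \<inter> B) - prob A * prob B\<bar> \<le> e" if e: "0 < e" for e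
  proof -
    \<comment> \<open>The time \<open>s\<close> is chosen first, for the fixed window
      \<open>W m\<close>; the outer window \<open>W n\<close> is chosen for this \<open>s\<close>.
      The two losses of \<open>e / 4\<close> add up to \<open>e / 2\<close>.\<close>
    obtain s where s: "0 < s" "s < t"
      "prob {w \<in> space M. boundary (Y s w) \<inter> interior (W m) = {}} > 1 - e / 4"
      using miss_small_time[OF win t, of "e / 4" m] e by auto
    obtain n where n: "m \<le> n"
      "prob {w \<in> space M. enclosed (interior (W m)) (Q \<inter> (interior (W (Suc n)) - W n)) x (Y s w)} >
        prob {w \<in> space M. boundary (Y s w) \<inter> interior (W m) = {}} - e / 4"
      using enclosed_prob[OF W s(1) Q(1), of "e / 4" m] e by auto
    let ?D = "Q \<inter> (interior (W (Suc n)) - W n)"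
    define X where "X = {w \<in> space M. enclosed (interior (W m)) ?D x (Y s w)}"
    define q where "q = prob {w \<in> space M. boundary (Y (t - s) w) \<inter> K = {}}"
    have X: "X \<in> sets M"
      unfolding X_def by (rule enclosed_sets[OF s(1)]) (rule countable_subset[OF _ Q(1)], blast)
    have pX: "prob X > 1 - e / 2" using s(3) n(2) unfolding X_def by linarith
    have fact: "prob ((X \<inter> B) \<inter> (Y t -` F \<inter> space M)) = q * prob (X \<inter> (Y t -` F \<inter> space M))"
      if "F \<in> sets (tess_borel_outside (W n))" for F
    proof (rule proportional_on_generator[OF prob_space_axioms Y_measurable_outside[OF t] sets_boundary_algebra
          space_boundary_algebra Int_stable_boundary_miss _ _ sets.Int[OF X B] X _ that])
      show "(miss_events tessellations (- W n)) \<subseteq> Pow tessellations" by blast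
      show "tessellations \<in> (miss_events tessellations (- W n))"
        by (rule CollectI, rule exI[of _ "{}"]) simp
      fix G assume "G \<in> (miss_events tessellations (- W n))"
      then obtain C where G: "G = {T \<in> tessellations. boundary T \<inter> C = {}}" and C: "compact C" "C \<subseteq> - W n" by blast
      \<comment> \<open>A single generator outside \<open>W n\<close> is already visible in some
        large window, together with the shell used to test enclosure.\<close>
      obtain k where k: "C \<union> W (Suc n) \<subseteq> interior (W k)"
        using exhausting_windows_compact[OF W compact_Un[OF C(1) cW(2)]] .
      have Wn: "W n \<subseteq> interior (W (Suc n))" using W unfolding exhausting_windows_def by blast
      have "emeasure M {w \<in> space M. (enclosed (interior (W m)) ?D x (Y s w) \<and>
          boundary (Y t w) \<inter> C = {}) \<and> boundary (Y t w) \<inter> K = {}} =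
        emeasure M {w \<in> space M. boundary (Y (t - s) w) \<inter> K = {}} *
        emeasure M {w \<in> space M. enclosed (interior (W m)) ?D x (Y s w) \<and> boundary (Y t w) \<inter> C = {}}"
        by (rule process_factorization[OF s(1,2) win x exhausting_windows_mono[OF W n(1)] cW(1) Wn cW(3) _ win Q K m C(1)])
          (use k C(2) in auto)
      moreover have "{w \<in> space M. (enclosed (interior (W m)) ?D x (Y s w) \<and>
          boundary (Y t w) \<inter> C = {}) \<and> boundary (Y t w) \<inter> K = {}} = X \<inter> B \<inter> (Y t -` G \<inter> space M)"
        using Y_tessellation[OF t] by (auto simp: X_def B_def G)
      moreover have "{w \<in> space M. enclosed (interior (W m)) ?D x (Y s w) \<and> boundary (Y t w) \<inter> C = {}} =
          X \<inter> (Y t -` G \<inter> space M)"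
        using Y_tessellation[OF t] by (auto simp: X_def G)
      ultimately show "prob (X \<inter> B \<inter> (Y t -` G \<inter> space M)) = q * prob (X \<inter> (Y t -` G \<inter> space M))"
        by (simp add: measure_def q_def enn2real_mult)
    qed
    have XAB: "prob (X \<inter> (A \<inter> B)) = q * prob (X \<inter> A)"
      using fact[OF EW] unfolding A_def by (simp add: ac_simps)
    \<comment> \<open>Taking the whole space for the outside event gives the same identity without
      \<open>A\<close>, which compares \<open>q\<close> with the probability of
      \<open>B\<close>.\<close>
    have "Y t -` tessellations \<inter> space M = space M" using Y_tessellation[OF t] by auto
    then have XB: "prob (X \<inter> B) = q * prob X"
      using fact[OF sets.top] sets.sets_into_space[OF X] by (simp add: Int_absorb2 inf.absorb1 Int_assoc[symmetric])
        (metis Int_absorb2 Int_assoc Int_commute)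
    have close: "prob (X \<inter> C) \<le> prob C \<and> prob C \<le> prob (X \<inter> C) + e / 2" if C: "C \<in> sets M" for C
    proof
      show "prob (X \<inter> C) \<le> prob C" using C by (intro finite_measure_mono) auto
      have "prob C \<le> prob ((X \<inter> C) \<union> (space M - X))"
        using C X sets.sets_into_space[OF C] by (intro finite_measure_mono) auto
      also have "\<dots> \<le> prob (X \<inter> C) + prob (space M - X)" using C X by (intro measure_Un_le) auto
      also have "prob (space M - X) = 1 - prob X" by (rule prob_compl[OF X])
      finally show "prob C \<le> prob (X \<inter> C) + e / 2" using pX by simp
    qed
    have q01: "0 \<le> q" "q \<le> 1" by (simp_all add: q_def)
    have mult_close: "q * a \<le> q * b \<and> q * b \<le> q * a + e / 2" if "a \<le> b" "b \<le> a + e / 2" for a b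
    proof
      show "q * a \<le> q * b" using that(1) q01(1) by (rule mult_left_mono)
      have "q * b \<le> q * (a + e / 2)" using that(2) q01(1) by (rule mult_left_mono)
      also have "\<dots> = q * a + q * (e / 2)" by (simp add: distrib_left)
      also have "q * (e / 2) \<le> 1 * (e / 2)" using q01(2) e by (intro mult_right_mono) auto
      finally show "q * b \<le> q * a + e / 2" by simp
    qed
    have "\<bar>prob (A \<inter> B) - q * prob A\<bar> \<le> e / 2"
      using close[OF sets.Int[OF A B]] mult_close[of "prob (X \<inter> A)" "prob A"] close[OF A]
      unfolding XAB by linarith
    moreover have "\<bar>prob B - q\<bar> \<le> e / 2"
      using close[OF B] mult_close[of "prob X" 1] pX prob_le_1[of X] unfolding XB by linarith
    then have "\<bar>prob A * (prob B - q)\<bar> \<le> 1 * (e / 2)"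
      unfolding abs_mult by (intro mult_mono) auto
    moreover have "prob (A \<inter> B) - prob A * prob B = (prob (A \<inter> B) - q * prob A) - prob A * (prob B - q)"
      by (simp add: algebra_simps)
    ultimately show "\<bar>prob (A \<inter> B) - prob A * prob B\<bar> \<le> e" by linarith
  qed
  then have "\<bar>prob (A \<inter> B) - prob A * prob B\<bar> \<le> 0"
    by (rule field_le_epsilon[of _ 0, unfolded add_0])
  then show ?thesis by simp
qed

end

theorem theorem2:
  fixes \<Lambda> :: "'a::euclidean_space set measure"
    and M :: "'w measure"
    and Y :: "real \<Rightarrow> 'w \<Rightarrow> 'a set set"
    and W :: "nat \<Rightarrow> 'a set"
    and t :: real
    and E :: "'a set set set"
  assumes "driving_measure \<Lambda>"
    and "stit_process \<Lambda> M Y"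
    and "exhausting_windows W"
    and "t > 0"
    and "E \<in> tail_algebra W"
  shows "measure M {\<omega> \<in> space M. Y t \<omega> \<in> E} = 0 \<or> measure M {\<omega> \<in> space M. Y t \<omega> \<in> E} = 1"
proof -
  interpret stit \<Lambda> M Y by standard (rule assms)+
  let ?A = "Y t -` E \<inter> space M"
  have "E \<in> sets (tess_borel_outside (W 0))" using assms(5) by (simp add: tail_algebra_def)
  then have E: "E \<in> sets tess_borel" using sets_boundary_algebra_mono[OF subset_UNIV] by blast
  have A: "?A \<in> sets M" by (rule measurable_sets[OF Y_measurable[OF assms(4)] E])
  \<comment> \<open>With the whole space in the last factor this is independence of
    \<open>?A\<close> and the preimage of \<open>E\<close>; the two coincide, so the probability
    equals its square.\<close>
  have "measure M (?A \<inter> (Y t -` E \<inter> space M)) = measure M ?A * measure M (space M \<inter> (Y t -` E \<inter> space M))"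
  proof (rule proportional_on_generator[OF prob_space_axioms Y_measurable[OF assms(4)] sets_boundary_algebra
        space_boundary_algebra Int_stable_boundary_miss _ _ A sets.top _ E])
    show "(miss_events tessellations UNIV) \<subseteq> Pow tessellations" by blast
    show "tessellations \<in> (miss_events tessellations UNIV)"
      by (rule CollectI, rule exI[of _ "{}"]) simp
    fix G :: "'a set set set" assume "G \<in> (miss_events tessellations UNIV)"
    then obtain C where G: "G = {T \<in> tessellations. boundary T \<inter> C = {}}" and C: "compact C" by blast
    have "Y t -` G \<inter> space M = {\<omega> \<in> space M. boundary (Y t \<omega>) \<inter> C = {}}"
      using Y_tessellation[OF assms(4)] by (auto simp: G)
    then show "measure M (?A \<inter> (Y t -` G \<inter> space M)) = measure M ?A * measure M (space M \<inter> (Y t -` G \<inter> space M))"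
      using tail_independent_of_miss[OF assms(3,4,5) C] by (simp add: Int_absorb1 inf.absorb2 Collect_conj_eq)
  qed
  moreover have "space M \<inter> ?A = ?A" by blast
  moreover have "?A = {\<omega> \<in> space M. Y t \<omega> \<in> E}" by blast
  ultimately show ?thesis by simp
qed

end
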